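(* Let $q$ be a prime power, let $n>1$ be an integer and let $\mathcal A=u+\mathcal V\subseteq \mathbb{F}_{q^n}$ be an $\mathbb{F}_q$-affine space of dimension $t\ge 1$. Suppose that there exists a nonzero element $y\in \mathcal V$ such that the set $\mathcal A_y:=\{ay^{-1} : a\in \mathcal A\}$ contains an element of degree $n$ over $\mathbb{F}_q$. If $\chi$ is a nontrivial multiplicative character of $\mathbb{F}_{q^n}$, then $$\left|\sum_{a\in \mathcal A}\chi(a)\right|< n\cdot q^{t-1/2}.$$
   Context: An $\mathbb{F}_q$-affine space $\mathcal A=u+\mathcal V$ in $\mathbb{F}_{q^n}$ is a translate, by some $u\in\mathbb{F}_{q^n}$, of an $\mathbb{F}_q$-vector subspace $\mathcal V$ of $\mathbb{F}_{q^n}$; its dimension is $\dim_{\mathbb{F}_q}\mathcal V$. An element $\alpha$ has degree $k$ over $\mathbb{F}_q$ if $\mathbb{F}_q(\alpha)=\mathbb{F}_{q^k}$, i.e. its minimal polynomial over $\mathbb{F}_q$ has degree $k$. A multiplicative character $\chi$ of $\mathbb{F}_{q^n}$ is a group homomorphism from $\mathbb{F}_{q^n}^*$ to the complex unit circle, extended by $\chi(0)=0$; it is trivial if $\chi(a)=1$ for all $a\ne 0$. *)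

theory Defs
  imports
    Complex_Main
    "HOL-Algebra.Finite_Extensions"
    "HOL-Algebra.Multiplicative_Group"
    "HOL-Number_Theory.Prime_Powers"
begin

definition unit_circle :: "complex monoid"
  where "unit_circle = \<lparr>carrier = {z. cmod z = 1}, mult = (*), one = 1\<rparr>"

text \<open>
  Only the values of a character on the carrier matter; elements of the ambient type outside
  the carrier are unconstrained.
\<close>

definition multiplicative_character :: "('a, 'b) ring_scheme \<Rightarrow> ('a \<Rightarrow> complex) \<Rightarrow> bool"
  where "multiplicative_character R \<chi> \<longleftrightarrow> \<chi> \<in> hom (mult_of R) unit_circle \<and> \<chi> \<zero>\<^bsub>R\<^esub> = 0"

definition trivial_character :: "('a, 'b) ring_scheme \<Rightarrow> ('a \<Rightarrow> complex) \<Rightarrow> bool"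
  where "trivial_character R \<chi> \<longleftrightarrow> (\<forall>a \<in> carrier R - {\<zero>\<^bsub>R\<^esub>}. \<chi> a = 1)"

text \<open>
  The degree of \<open>x\<close> over the subfield \<open>K\<close>: the degree of its minimal polynomial \<open>Irr K x\<close>.
  This is meaningful when \<open>x\<close> is algebraic over \<open>K\<close>, in particular whenever \<open>R\<close> is a finite field.
\<close>

definition element_degree :: "('a, 'b) ring_scheme \<Rightarrow> 'a set \<Rightarrow> 'a \<Rightarrow> nat"
  where "element_degree R K x = Polynomials.degree (ring.Irr R K x)"

text \<open>
  The affine space \<open>u + V\<close> is the coset \<open>u <+\<^bsub>R\<^esub> V\<close>. The locale predicate \<open>subalgebra K V R\<close> of
  HOL-Algebra says, despite its name, just that \<open>V\<close> is a \<open>K\<close>-vector subspace of \<open>R\<close>: closure under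
  multiplication is not required.
\<close>

definition is_affine_space ::
    "('a, 'b) ring_scheme \<Rightarrow> 'a set \<Rightarrow> nat \<Rightarrow> 'a \<Rightarrow> 'a set \<Rightarrow> 'a set \<Rightarrow> bool"
  where "is_affine_space R K t u V A \<longleftrightarrow>
    u \<in> carrier R \<and> subalgebra K V R \<and> ring.dimension R t K V \<and> A = u <+\<^bsub>R\<^esub> V"

end

theory Submission
  imports Defs
    "HOL-Computational_Algebra.Computational_Algebra"
    "HOL-Library.Poly_Mapping"
    "HOL-Algebra.Algebraic_Closure"
begin

text \<open>
  Averaging over the lines \<open>a + K y\<close> turns the sum into line sums \<open>\<chi> y * (\<Sum>c\<in>K. \<chi> (b + c))\<close>
  with \<open>b = a / y\<close>. If \<open>b\<close> has degree \<open>n\<close>, Katz's bound \<open>(n - 1) * sqrt q\<close> applies. The other \<open>a\<close>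
  satisfy \<open>b ^ (q ^ d) = b\<close> for some \<open>0 < d < n\<close>; for each \<open>d\<close> they lie in a coset of a proper
  \<open>K\<close>-subspace of \<open>V\<close>, so there are at most \<open>(n - 1) * q ^ (t - 1)\<close> of them, and the trivial bound \<open>q\<close>
  suffices.

  Katz's bound: for \<open>\<theta>\<close> of degree \<open>n\<close> the series \<open>\<Sum>g. \<chi> (g \<theta>) * X ^ deg g\<close> over the monic \<open>g\<close> over \<open>K\<close>
  is a polynomial of degree less than \<open>n\<close>, because the values \<open>g \<theta>\<close> are equidistributed once
  \<open>deg g \<ge> n\<close>. By Newton's identities the sums \<open>S m\<close> over the extension of degree \<open>m\<close> are minus the power
  sums of its reciprocal roots, so it is enough to bound \<open>S (2 * n * k)\<close> by a constant times
  \<open>q ^ (n * k)\<close>. Over those extensions \<open>S m\<close> is a Kummer sum, and Stepanov's method applies. The field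
  having square order \<open>P * P\<close>, derivatives can be avoided: the auxiliary polynomial is the \<open>P\<close>-th
  power of a nonzero polynomial \<open>s\<close>, and it suffices to count the zeros of \<open>s\<close>.
\<close>

text \<open>The restriction to degrees 2 * n * k has two sources. Divisibility by n makes the n-step
  Frobenius return to \<theta>, so that the argument of \<chi> is a power of one fixed polynomial in
  c, with exponent (q ^ (2 * n * k) - 1) / r for r = q ^ n - 1: the fibres are sets with a
  prescribed r-th power residue symbol. The factor 2 makes raising to the power P = q ^ (n * k) an
  involution of the field with P * P elements, which lets a P-th power collapse to low degree there.
  The obstacle is to know that the auxiliary polynomial is nonzero. Products of different degrees
  are independent, which calls for a polynomial of degree prime to r; a simple zero moved to
  infinity supplies one of degree r - 1. Stepanov's method bounds each fibre only from above, but
  the fibres together exhaust the field up to at most n points, so the deficits are controlled by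
  the excesses. In the averaging, Katz's constant n - 1 leaves a slack of one sqrt q per line; it
  pays for the elements of lower degree and for strictness.\<close>

hide_const (open) Polynomials.degree UnivPoly.coeff UnivPoly.monom Poly_Mapping.degree Divisibility.prime
no_notation var (\<open>X\<index>\<close>)

section \<open>Arithmetic modulo a prime ideal\<close>

text \<open>
  A type of class field cannot depend on the term \<open>R\<close>. An algebraic closure of \<open>R\<close> is therefore
  handled as the residue ring of a ring of class \<open>comm_ring_1\<close> modulo a prime ideal \<open>M\<close>, which makes
  sums, products and polynomials of the type-class library available without carrier conditions.
\<close>

locale residue_field =
  fixes M :: "'r::comm_ring_1 set" and p :: nat
  assumes zero_M: "0 \<in> M"
    and add_M: "x \<in> M \<Longrightarrow> y \<in> M \<Longrightarrow> x + y \<in> M"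
    and mult_M: "x \<in> M \<Longrightarrow> y * x \<in> M"
    and one_M: "1 \<notin> M"
    and prime_M: "x * y \<in> M \<Longrightarrow> x \<in> M \<or> y \<in> M"
    and prime_p: "Factorial_Ring.prime p"
    and char_M: "of_nat p \<in> M"
    and root_M: "degree f > 0 \<Longrightarrow> Polynomial.lead_coeff f = 1 \<Longrightarrow> \<exists>x. poly f x \<in> M"
begin

section \<open>Congruence modulo \<open>M\<close> and representatives of the classes\<close>

definition eqv :: "'r \<Rightarrow> 'r \<Rightarrow> bool" (infix "\<approx>" 50) where "x \<approx> y \<longleftrightarrow> x - y \<in> M"

lemma mult_M2: "x \<in> M \<Longrightarrow> x * y \<in> M"
  using mult_M[of x y] by (simp add: mult.commute)

lemma uminus_M: "x \<in> M \<Longrightarrow> - x \<in> M"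
  using mult_M[of x "-1"] by simp

lemma diff_M: "x \<in> M \<Longrightarrow> y \<in> M \<Longrightarrow> x - y \<in> M"
  using add_M[of x "-y"] uminus_M by simp

lemma sum_M: "(\<And>i. i \<in> I \<Longrightarrow> f i \<in> M) \<Longrightarrow> sum f I \<in> M"
  by (induction I rule: infinite_finite_induct) (auto intro: zero_M add_M)

lemma eqv_refl [simp, intro]: "x \<approx> x"
  by (simp add: eqv_def zero_M)

lemma eqv_sym: "x \<approx> y \<Longrightarrow> y \<approx> x"
  using uminus_M[of "x - y"] by (simp add: eqv_def)

lemma eqv_trans [trans]: "x \<approx> y \<Longrightarrow> y \<approx> z \<Longrightarrow> x \<approx> z"
  using add_M[of "x - y" "y - z"] by (simp add: eqv_def)

lemma eqv_0: "x \<approx> 0 \<longleftrightarrow> x \<in> M"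
  by (simp add: eqv_def)

lemma eqv_M: "x \<approx> y \<Longrightarrow> x \<in> M \<longleftrightarrow> y \<in> M"
  using eqv_trans eqv_sym eqv_0 by blast

lemma eqv_add: "a \<approx> b \<Longrightarrow> c \<approx> d \<Longrightarrow> a + c \<approx> b + d"
  using add_M[of "a - b" "c - d"] by (simp add: eqv_def algebra_simps)

lemma eqv_uminus: "a \<approx> b \<Longrightarrow> - a \<approx> - b"
  using uminus_M[of "a - b"] by (simp add: eqv_def algebra_simps)

lemma eqv_diff: "a \<approx> b \<Longrightarrow> c \<approx> d \<Longrightarrow> a - c \<approx> b - d"
  using eqv_add[of a b "-c" "-d"] eqv_uminus by simp

lemma eqv_mult: "a \<approx> b \<Longrightarrow> c \<approx> d \<Longrightarrow> a * c \<approx> b * d"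
  using add_M[OF mult_M[of "c - d" a] mult_M2[of "a - b" d]] by (simp add: eqv_def algebra_simps)

lemma eqv_power: "a \<approx> b \<Longrightarrow> a ^ k \<approx> b ^ k"
  by (induction k) (auto intro: eqv_mult)

lemma eqv_sum: "(\<And>i. i \<in> I \<Longrightarrow> f i \<approx> g i) \<Longrightarrow> sum f I \<approx> sum g I"
  by (induction I rule: infinite_finite_induct) (auto intro: eqv_add)

lemma eqv_prod: "(\<And>i. i \<in> I \<Longrightarrow> f i \<approx> g i) \<Longrightarrow> prod f I \<approx> prod g I"
  by (induction I rule: infinite_finite_induct) (auto intro: eqv_mult)

lemma eqv_prod_mset: "(\<And>x. x \<in># X \<Longrightarrow> f x \<approx> g x) \<Longrightarrow> (\<Prod>x\<in>#X. f x) \<approx> (\<Prod>x\<in>#X. g x)"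
  by (induction X) (auto intro: eqv_mult)

lemma power_M: "x ^ k \<in> M \<Longrightarrow> x \<in> M"
  by (induction k) (auto simp: one_M dest: prime_M)

lemma prod_M: "finite I \<Longrightarrow> prod f I \<in> M \<longleftrightarrow> (\<exists>i\<in>I. f i \<in> M)"
  by (induction I rule: finite_induct) (auto simp: one_M mult_M mult_M2 dest: prime_M)

lemma prod_mset_M: "(\<Prod>x\<in>#X. f x) \<in> M \<longleftrightarrow> (\<exists>x\<in>#X. f x \<in> M)"
  by (induction X) (auto simp: one_M mult_M mult_M2 dest: prime_M)

lemma eqv_cancel: "c \<notin> M \<Longrightarrow> c * a \<approx> c * b \<Longrightarrow> a \<approx> b"
  using prime_M[of c "a - b"] by (simp add: eqv_def algebra_simps)

text \<open>A transversal of the residue classes. Finite sets, multisets and cardinalities need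
  elements for which congruence is equality; \<open>range rep\<close> provides them.\<close>

definition rep :: "'r \<Rightarrow> 'r" where "rep x = (SOME y. y \<approx> x)"

lemma rep_eqv: "rep x \<approx> x"
  unfolding rep_def by (rule someI[of _ x]) simp

lemma rep_eq_iff: "rep x = rep y \<longleftrightarrow> x \<approx> y"
proof
  show "rep x = rep y \<Longrightarrow> x \<approx> y" using rep_eqv eqv_sym eqv_trans by metis
  assume "x \<approx> y"
  hence "(\<lambda>z. z \<approx> x) = (\<lambda>z. z \<approx> y)" using eqv_sym eqv_trans by blast
  thus "rep x = rep y" by (simp add: rep_def)
qed

lemma rep_rep: "x \<in> range rep \<Longrightarrow> rep x = x"
  using rep_eq_iff rep_eqv by auto

lemma range_rep_eqI: "x \<in> range rep \<Longrightarrow> y \<in> range rep \<Longrightarrow> x \<approx> y \<Longrightarrow> x = y"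
  using rep_rep rep_eq_iff by metis

section \<open>Polynomials modulo \<open>M\<close>: roots and factorization\<close>

definition pM :: "'r poly \<Rightarrow> bool" where "pM f \<longleftrightarrow> (\<forall>i. coeff f i \<in> M)"

definition peqv :: "'r poly \<Rightarrow> 'r poly \<Rightarrow> bool" (infix "\<approx>\<^sub>p" 50) where "f \<approx>\<^sub>p g \<longleftrightarrow> (\<forall>i. coeff f i \<approx> coeff g i)"

lemma peqv_iff_pM: "f \<approx>\<^sub>p g \<longleftrightarrow> pM (f - g)"
  by (simp add: peqv_def pM_def eqv_def)

lemma peqv_refl [simp, intro]: "f \<approx>\<^sub>p f"
  by (simp add: peqv_def)

lemma peqv_sym: "f \<approx>\<^sub>p g \<Longrightarrow> g \<approx>\<^sub>p f"
  by (auto simp: peqv_def intro: eqv_sym)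

lemma peqv_trans [trans]: "f \<approx>\<^sub>p g \<Longrightarrow> g \<approx>\<^sub>p h \<Longrightarrow> f \<approx>\<^sub>p h"
  by (auto simp: peqv_def intro: eqv_trans)

lemma peqv_mult: "f \<approx>\<^sub>p f' \<Longrightarrow> g \<approx>\<^sub>p g' \<Longrightarrow> f * g \<approx>\<^sub>p f' * g'"
  by (auto simp: peqv_def coeff_mult intro!: eqv_sum eqv_mult)

lemma pM_poly: "pM f \<Longrightarrow> poly f x \<in> M"
  by (auto simp: pM_def poly_altdef intro!: sum_M mult_M2)

lemma poly_eqv: "f \<approx>\<^sub>p g \<Longrightarrow> poly f x \<approx> poly g x"
  using pM_poly[of "f - g" x] by (simp add: peqv_iff_pM eqv_def)

lemma poly_eqv_arg: "x \<approx> y \<Longrightarrow> poly f x \<approx> poly f y"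
  by (auto simp: poly_altdef intro!: eqv_sum eqv_mult eqv_power)

lemma coeff_linear_mult: "coeff ([:-c, 1:] * f) i = (if i = 0 then 0 else coeff f (i - 1)) - c * coeff f i"
  for c :: 'r
  by (cases i) auto

declare mult_pCons_left [simp del]

text \<open>As X - c is monic, the coefficients of \<open>f\<close> are recovered by descending from
  the top: coefficient i of \<open>f\<close> is coefficient i + 1 of the product plus c times
  coefficient i + 1 of \<open>f\<close>. This serves as cancellation of X - c modulo
  \<open>M\<close>.\<close>

lemma pM_linear_mult:
  assumes "pM ([:-c, 1:] * f)" shows "pM f"
proof -
  have "coeff f i \<in> M" if "i + k = Suc (degree f)" for i k
    using that
  proof (induction k arbitrary: i)
    case 0 thus ?case by (simp add: coeff_eq_0 zero_M)
  next
    case (Suc k)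
    have "coeff ([:-c, 1:] * f) (Suc i) \<in> M" using assms unfolding pM_def by blast
    hence "coeff f i - c * coeff f (Suc i) \<in> M" unfolding coeff_linear_mult by simp
    moreover have "c * coeff f (Suc i) \<in> M" using Suc by (intro mult_M) auto
    ultimately show ?case using add_M by fastforce
  qed
  hence "coeff f i \<in> M" if "i \<le> Suc (degree f)" for i
    using that le_Suc_ex by metis
  thus ?thesis unfolding pM_def by (metis coeff_eq_0 zero_M not_less_eq_eq nat_le_linear not_le)
qed

text \<open>Synthetic division by X - x leaves a remainder in \<open>M\<close>; for the other points
  y the difference y - x is not in \<open>M\<close>, so primality makes them roots of the quotient.
  The degree is that of the lift, which may exceed the degree modulo \<open>M\<close>.\<close>

lemma pM_of_many_roots:
  assumes "finite S" "\<And>x y. x \<in> S \<Longrightarrow> y \<in> S \<Longrightarrow> x \<approx> y \<Longrightarrow> x = y" "\<And>x. x \<in> S \<Longrightarrow> poly f x \<in> M"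
    "degree f < card S"
  shows "pM f"
  using assms
proof (induction S arbitrary: f rule: finite_induct)
  case empty thus ?case by simp
next
  case (insert x S)
  define g where "g = synthetic_div f x"
  have f: "f = [:-x, 1:] * g + [:poly f x:]" by (simp only: g_def synthetic_div_correct')
  have px: "poly f x \<in> M" using insert.prems by auto
  have "pM g"
  proof (cases "degree f = 0")
    case True thus ?thesis by (simp add: g_def synthetic_div_eq_0_iff[THEN iffD2] pM_def zero_M)
  next
    case False
    show ?thesis
    proof (rule insert.IH)
      show "x \<approx> y \<Longrightarrow> x = y" if "x \<in> S" "y \<in> S" for x y using insert.prems that by auto
      show "degree g < card S"
        using False insert by (simp add: g_def degree_synthetic_div)
      fix y assume y: "y \<in> S"
      have "poly f y = (y - x) * poly g y + poly f x" by (subst f) (simp add: algebra_simps)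
      moreover have "poly f y \<in> M" using insert.prems y by auto
      ultimately have "(y - x) * poly g y \<in> M" using diff_M[of "poly f y" "poly f x"] px by simp
      moreover have "y - x \<notin> M" using insert.prems(1)[of y x] y insert.hyps by (auto simp: eqv_def)
      ultimately show "poly g y \<in> M" using prime_M by blast
    qed
  qed
  hence "[:-x, 1:] * g + [:poly f x:] \<approx>\<^sub>p 0"
    using px by (auto simp: peqv_def pM_def eqv_0 coeff_linear_mult coeff_pCons zero_M
        intro!: add_M diff_M mult_M split: nat.splits)
  thus ?case using f by (simp add: peqv_iff_pM)
qed

lemma linear_mult_monic:
  fixes g :: "'r poly"
  assumes "Polynomial.lead_coeff g = 1"
  shows "degree ([:-c, 1:] * g) = Suc (degree g) \<and> Polynomial.lead_coeff ([:-c, 1:] * g) = 1"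
proof -
  have c1: "coeff ([:-c, 1:] * g) (Suc (degree g)) = 1"
    unfolding coeff_linear_mult using assms by (simp add: coeff_eq_0)
  have "degree ([:-c, 1:] * g) \<le> Suc (degree g)"
    unfolding mult_pCons_left by (intro degree_add_le) (auto intro: order.trans[OF degree_smult_le])
  moreover have "degree ([:-c, 1:] * g) \<ge> Suc (degree g)"
    using c1 by (intro le_degree) auto
  ultimately show ?thesis using c1 by simp
qed

lemma prod_linear_monic:
  "degree (\<Prod>x\<in>#X. [:- x, 1:]) = size X \<and> Polynomial.lead_coeff (\<Prod>x\<in>#X. [:- x, 1:]) = 1"
  for X :: "'r multiset"
proof (induction X)
  case (add x X)
  hence "Polynomial.lead_coeff (\<Prod>x\<in>#X. [:- x, 1:]) = 1" by blast
  from linear_mult_monic[OF this, of x] add show ?case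
    unfolding image_mset_add_mset prod_mset.add_mset size_add_mset by metis
qed simp

text \<open>Each root is replaced by its representative before it is split off; this is what makes
  the root multiset unique in \<open>prod_linear_eqv_imp_eq\<close>.\<close>

lemma splits_M:
  assumes "Polynomial.lead_coeff f = 1"
  shows "\<exists>X. size X = degree f \<and> set_mset X \<subseteq> range rep \<and> f \<approx>\<^sub>p (\<Prod>x\<in>#X. [:- x, 1:])"
  using assms
proof (induction "degree f" arbitrary: f)
  case 0
  then have "f = 1" by (metis degree_eq_zeroE lead_coeff_pCons(2) one_pCons)
  thus ?case by (intro exI[of _ "{#}"]) auto
next
  case (Suc d)
  obtain x where x: "poly f x \<in> M" using root_M[of f] Suc by auto
  define c where "c = rep x"
  have c: "poly f c \<in> M" using x poly_eqv_arg[OF rep_eqv[of x], of f] eqv_M by (simp add: c_def)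
  define g where "g = synthetic_div f c"
  have f: "[:-c, 1:] * g + [:poly f c:] = f" by (simp only: g_def synthetic_div_correct')
  have dg: "degree g = d" using Suc(2) by (simp add: g_def degree_synthetic_div)
  have "coeff f (Suc d) = coeff g d - c * coeff g (Suc d)"
    by (subst f[symmetric]) (simp add: coeff_linear_mult)
  hence lg: "Polynomial.lead_coeff g = 1" using Suc(2,3) dg by (simp add: coeff_eq_0)
  obtain X where X: "size X = d" "set_mset X \<subseteq> range rep" "g \<approx>\<^sub>p (\<Prod>x\<in>#X. [:- x, 1:])"
    using Suc(1)[of g] dg lg by auto
  have "f \<approx>\<^sub>p [:-c, 1:] * g"
    using c by (subst f[symmetric]) (auto simp: peqv_def eqv_def coeff_pCons zero_M split: nat.splits)
  also have "[:-c, 1:] * g \<approx>\<^sub>p [:-c, 1:] * (\<Prod>x\<in>#X. [:- x, 1:])" using X(3) by (intro peqv_mult) auto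
  finally show ?case using X Suc(2) by (intro exI[of _ "add_mset c X"]) (auto simp: c_def)
qed

text \<open>Evaluation at a member x of \<open>X\<close> makes the left product vanish, so x is
  congruent to a member of \<open>Y\<close> and, both being representatives, equal to it. Then X - x
  is cancelled by \<open>pM_linear_mult\<close>.\<close>

lemma prod_linear_eqv_imp_eq:
  assumes "set_mset X \<subseteq> range rep" "set_mset Y \<subseteq> range rep"
    "(\<Prod>x\<in>#X. [:- x, 1:]) \<approx>\<^sub>p (\<Prod>x\<in>#Y. [:- x, 1:])" "size X = size Y"
  shows "X = Y"
  using assms
proof (induction X arbitrary: Y)
  case empty thus ?case by simp
next
  case (add x X)
  have "poly (\<Prod>x\<in>#add_mset x X. [:- x, 1:]) x \<approx> poly (\<Prod>x\<in>#Y. [:- x, 1:]) x"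
    using add.prems(3) by (rule poly_eqv)
  hence "(\<Prod>y\<in>#Y. x - y) \<in> M"
    using eqv_sym eqv_0 by (fastforce simp: poly_prod_mset)
  then obtain y where y: "y \<in># Y" "x \<approx> y" by (auto simp: prod_mset_M eqv_def)
  hence "x = y" using add.prems by (intro range_rep_eqI) auto
  then obtain Z where Z: "Y = add_mset x Z" using y by (metis mset_add)
  have "pM ([:-x, 1:] * ((\<Prod>x\<in>#X. [:- x, 1:]) - (\<Prod>x\<in>#Z. [:- x, 1:])))"
    using add.prems(3) unfolding Z peqv_iff_pM by (simp only: image_mset_add_mset prod_mset.add_mset right_diff_distrib)
  hence "(\<Prod>x\<in>#X. [:- x, 1:]) \<approx>\<^sub>p (\<Prod>x\<in>#Z. [:- x, 1:])"
    unfolding peqv_iff_pM by (rule pM_linear_mult)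
  thus ?case using add.IH[of Z] add.prems Z by auto
qed

section \<open>Frobenius powers and the finite subfields\<close>

definition ppow :: "nat \<Rightarrow> bool" where "ppow q \<longleftrightarrow> (\<exists>s. q = p ^ s)"

lemma ppow_pos: "ppow q \<Longrightarrow> q > 0"
  using prime_p by (auto simp: ppow_def prime_gt_0_nat)

lemma ppow_power: "ppow q \<Longrightarrow> ppow (q ^ k)"
  by (auto simp: ppow_def simp flip: power_mult)

lemma ppow_M: "ppow q \<Longrightarrow> q > 1 \<Longrightarrow> of_nat q \<in> M"
  unfolding ppow_def by (metis char_M mult_M2 of_nat_mult power_0 power_Suc less_numeral_extra(4) not0_implies_Suc)

lemma frob_add_p: "(x + y) ^ p \<approx> x ^ p + y ^ p"
proof -
  have p0: "p > 0" using prime_p by (simp add: prime_gt_0_nat)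
  have "{..p} = insert 0 (insert p {0<..<p})" using p0 by auto
  hence "(x + y) ^ p = y ^ p + x ^ p + (\<Sum>k\<in>{0<..<p}. of_nat (p choose k) * x ^ k * y ^ (p - k))"
    using p0 by (simp add: binomial_ring)
  moreover have "(\<Sum>k\<in>{0<..<p}. of_nat (p choose k) * x ^ k * y ^ (p - k)) \<in> M"
  proof (rule sum_M, goal_cases)
    case (1 k)
    hence "p dvd (p choose k)" using prime_p by (intro dvd_choose_prime) auto
    then obtain m where "p choose k = p * m" by auto
    hence "of_nat (p choose k) \<in> M" using char_M by (simp add: mult_M2)
    thus ?case by (simp add: mult_M2)
  qed
  ultimately show ?thesis by (simp add: eqv_def)
qed

lemma frob_add: "ppow q \<Longrightarrow> (x + y) ^ q \<approx> x ^ q + y ^ q"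
proof -
  have "(x + y) ^ (p ^ s) \<approx> x ^ (p ^ s) + y ^ (p ^ s)" for s
  proof (induction s)
    case (Suc s)
    have "(x + y) ^ (p ^ Suc s) = ((x + y) ^ (p ^ s)) ^ p" by (simp add: mult.commute flip: power_mult)
    also have "\<dots> \<approx> (x ^ (p ^ s) + y ^ (p ^ s)) ^ p" using Suc by (rule eqv_power)
    also have "\<dots> \<approx> (x ^ (p ^ s)) ^ p + (y ^ (p ^ s)) ^ p" by (rule frob_add_p)
    finally show ?case by (simp add: mult.commute flip: power_mult)
  qed simp
  thus "ppow q \<Longrightarrow> ?thesis" by (auto simp: ppow_def)
qed

lemma frob_diff: "ppow q \<Longrightarrow> (x - y) ^ q \<approx> x ^ q - y ^ q"
proof -
  assume q: "ppow q"
  have "(x - y + y) ^ q \<approx> (x - y) ^ q + y ^ q" using q by (rule frob_add)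
  thus ?thesis using uminus_M[of "x ^ q - ((x - y) ^ q + y ^ q)"] by (simp add: eqv_def algebra_simps)
qed

lemma frob_sum: "ppow q \<Longrightarrow> (\<Sum>i\<in>I. f i) ^ q \<approx> (\<Sum>i\<in>I. f i ^ q)"
proof (induction I rule: infinite_finite_induct)
  case (insert i I)
  thus ?case using eqv_trans[OF frob_add eqv_add] by auto
qed (simp_all add: ppow_pos zero_power)

lemma frob_inj: "ppow q \<Longrightarrow> x ^ q \<approx> y ^ q \<longleftrightarrow> x \<approx> y"
proof -
  assume q: "ppow q"
  have "x \<approx> y" if "x ^ q \<approx> y ^ q"
  proof -
    have "(x - y) ^ q \<approx> x ^ q - y ^ q" using q by (rule frob_diff)
    also have "\<dots> \<approx> 0" using that by (simp add: eqv_0 eqv_def)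
    finally show ?thesis using power_M by (simp add: eqv_0) (simp add: eqv_def)
  qed
  thus ?thesis using eqv_power by blast
qed

text \<open>For a power \<open>Q > 1\<close> of \<open>p\<close> this is the subfield with
  \<open>Q\<close> elements, one representative for each element. Sums and products of members need
  not be members; their representatives are.\<close>

definition T :: "nat \<Rightarrow> 'r set" where "T Q = {z \<in> range rep. z ^ Q \<approx> z}"

lemma T_rep:
  assumes "x ^ Q \<approx> x" shows "rep x \<in> T Q"
proof -
  have "rep x ^ Q \<approx> x ^ Q" by (intro eqv_power rep_eqv)
  also note assms
  also have "x \<approx> rep x" by (rule eqv_sym[OF rep_eqv])
  finally show ?thesis by (simp add: T_def)
qed

lemma T_range: "z \<in> T Q \<Longrightarrow> z \<in> range rep"
  by (simp add: T_def)

lemma T_eqI: "x \<in> T Q \<Longrightarrow> y \<in> T Q' \<Longrightarrow> x \<approx> y \<Longrightarrow> x = y"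
  using T_range range_rep_eqI by blast

lemma T_power: "z \<in> T Q \<Longrightarrow> z ^ Q \<approx> z"
  by (simp add: T_def)

lemma T_finite_card:
  assumes "ppow Q" "Q > 1"
  shows "finite (T Q) \<and> card (T Q) = Q"
proof -
  define f :: "'r poly" where "f = monom 1 Q - [:0, 1:]"
  have cf: "coeff f i = (if i = Q then 1 else if i = 1 then -1 else 0)" for i
    using assms by (auto simp: f_def coeff_pCons split: nat.splits)
  have "degree f \<le> Q" using assms by (intro degree_le) (auto simp: cf)
  hence df: "degree f = Q" using le_degree[of f Q] by (simp add: cf)
  obtain X where X: "size X = Q" "set_mset X \<subseteq> range rep" "f \<approx>\<^sub>p (\<Prod>x\<in>#X. [:- x, 1:])"
    using splits_M[of f] df by (auto simp: cf)
  have root: "x ^ Q \<approx> x \<longleftrightarrow> (\<exists>y\<in>#X. x \<approx> y)" for x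
  proof -
    have "x ^ Q - x = poly f x" by (simp add: f_def poly_monom)
    also have "\<dots> \<approx> poly (\<Prod>x\<in>#X. [:- x, 1:]) x" using X(3) by (rule poly_eqv)
    also have "\<dots> = (\<Prod>y\<in>#X. x - y)" by (simp add: poly_prod_mset)
    finally have "x ^ Q - x \<in> M \<longleftrightarrow> (\<Prod>y\<in>#X. x - y) \<in> M" by (rule eqv_M)
    thus ?thesis by (simp add: prod_mset_M eqv_def)
  qed
  have TX: "T Q = set_mset X"
  proof
    show "T Q \<subseteq> set_mset X"
    proof
      fix x assume x: "x \<in> T Q"
      then obtain y where "y \<in># X" "x \<approx> y" using root T_power by blast
      moreover from this x have "x = y" using X(2) T_range by (intro range_rep_eqI) auto
      ultimately show "x \<in># X" by simp
    qed
    show "set_mset X \<subseteq> T Q" using X(2) root by (auto simp: T_def)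
  qed
  \<comment> \<open>The roots are simple: \<open>G\<close> is (X ^ Q - c ^ Q) / (X - c), so dividing
    f by X - c gives \<open>G - 1\<close> modulo \<open>M\<close>. A double root c would be a root
    of \<open>G - 1\<close>, whose value at c is Q * c ^ (Q - 1) - 1 and hence congruent to
    -1.\<close>
  have "count X c = 1" if c: "c \<in># X" for c
  proof (rule ccontr)
    assume "count X c \<noteq> 1"
    with c have "count X c \<ge> 2" by (simp add: Suc_leI numeral_2_eq_2 order_le_neq_trans)
    then obtain Z where Z: "X = add_mset c (add_mset c Z)"
      by (metis c count_add_mset count_eq_zero_iff multi_member_split \<open>count X c \<noteq> 1\<close> One_nat_def)
    define g where "g = (\<Prod>x\<in>#Z. [:- x, 1:])"
    define G where "G = (\<Sum>i<Q. [:c:] ^ (Q - Suc i) * [:0, 1:] ^ i)"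
    have "[:-c, 1:] * G = ([:0, 1:] - [:c:]) * G" by simp
    also have "\<dots> = [:0, 1:] ^ Q - [:c:] ^ Q" unfolding G_def by (rule power_diff_sumr2[symmetric])
    also have "\<dots> = monom 1 Q - [:c ^ Q:]"
      by (simp add: monom_altdef poly_const_pow)
    finally have "[:-c, 1:] * (G - 1) = monom 1 Q - [:c ^ Q:] - [:-c, 1:]"
      by (simp only: right_diff_distrib mult_1_right)
    moreover have "c ^ Q \<approx> c" using root[of c] c eqv_refl by blast
    hence "c - c ^ Q \<in> M" using eqv_sym unfolding eqv_def by blast
    ultimately have 1: "[:-c, 1:] * (G - 1) \<approx>\<^sub>p f"
      by (auto simp: peqv_def f_def eqv_def coeff_pCons uminus_M zero_M split: nat.splits)
    have 2: "f \<approx>\<^sub>p [:-c, 1:] * ([:-c, 1:] * g)" using X(3) by (simp only: Z g_def image_mset_add_mset prod_mset.add_mset)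
    have "pM ([:-c, 1:] * (G - 1 - [:-c, 1:] * g))"
      using peqv_trans[OF 1 2] by (simp only: right_diff_distrib peqv_iff_pM)
    hence "G - 1 \<approx>\<^sub>p [:-c, 1:] * g"
      unfolding peqv_iff_pM by (rule pM_linear_mult)
    hence "poly (G - 1) c \<approx> poly ([:-c, 1:] * g) c" by (rule poly_eqv)
    moreover have "poly G c = of_nat Q * c ^ (Q - 1)"
      by (simp add: G_def poly_sum flip: power_add)
    ultimately have "of_nat Q * c ^ (Q - 1) - 1 \<in> M" by (simp add: eqv_0)
    moreover have "of_nat Q * c ^ (Q - 1) \<in> M" using assms by (intro mult_M2 ppow_M)
    ultimately show False using one_M diff_M[of "of_nat Q * c ^ (Q - 1)" "of_nat Q * c ^ (Q - 1) - 1"] by simp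
  qed
  hence "size X = card (set_mset X)" by (simp add: size_multiset_overloaded_eq)
  thus ?thesis using X(1) TX by simp
qed

end

section \<open>Stepanov's method\<close>

text \<open>Leading coefficients are tracked at a prescribed degree bound, because degrees of
  products may drop in such a ring and only nonvanishing modulo \<open>M\<close> will
  matter.\<close>

lemma coeff_mult_bound:
  fixes f g :: "'a::comm_semiring_1 poly"
  assumes "degree f \<le> m" "degree g \<le> n"
  shows "coeff (f * g) (m + n) = coeff f m * coeff g n"
proof -
  have "coeff f i * coeff g (m + n - i) = 0" if "i \<noteq> m" "i \<le> m + n" for i
    using that assms by (cases "i < m") (auto simp: coeff_eq_0)
  hence "coeff (f * g) (m + n) = (\<Sum>i\<in>{m}. coeff f i * coeff g (m + n - i))"
    unfolding coeff_mult by (intro sum.mono_neutral_right) auto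
  thus ?thesis by simp
qed

lemma coeff_power_bound:
  fixes f :: "'a::comm_semiring_1 poly"
  assumes "degree f \<le> d"
  shows "degree (f ^ k) \<le> k * d \<and> coeff (f ^ k) (k * d) = coeff f d ^ k"
proof (induction k)
  case (Suc k)
  have "degree (f * f ^ k) \<le> d + k * d"
    using degree_mult_le[of f "f ^ k"] assms Suc by linarith
  thus ?case using coeff_mult_bound[OF assms, of "f ^ k" "k * d"] Suc by simp
qed simp

text \<open>
  The weights are the degrees of the products of \<open>X ^ l\<close>, \<open>X ^ (j * P)\<close> and \<open>h ^ (i * e)\<close> for \<open>deg h = r - 1\<close>;
  their distinctness makes the auxiliary polynomial nonzero.
\<close>

lemma stepanov_weights_inj:
  fixes r e P :: nat
  assumes r: "r \<ge> 2" and e: "e \<ge> r ^ 2" and P: "P = r * e + 1"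
  shows "inj_on (\<lambda>(i, j, l). l + j * P + i * e * (r - 1)) ({..<r} \<times> UNIV \<times> {..<e - r})"
proof (rule inj_onI, clarsimp)
  fix i j l i' j' l' :: nat
  assume i: "i < r" "i' < r" and l: "l < e - r" "l' < e - r"
    and eq: "l + j * P + i * e * (r - Suc 0) = l' + j' * P + i' * e * (r - Suc 0)"
  define u u' where "u = int i + int j" and "u' = int i' + int j'"
  \<comment> \<open>With this the weight reads l + (i + j) * P - i * (e + 1). The part outside the
    multiple of P varies by less than P, thanks to the bound on l, so i + j is determined; then l
    varies by less than e + 1, so i is.\<close>
  have er: "int e * (int r - 1) = int P - 1 - int e" by (simp add: P algebra_simps)
  have "int (l + j * P + i * e * (r - Suc 0)) = int (l' + j' * P + i' * e * (r - Suc 0))"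
    using eq by presburger
  hence "int l + int j * int P + int i * (int e * (int r - 1)) = int l' + int j' * int P + int i' * (int e * (int r - 1))"
    using r by (simp add: of_nat_diff mult.assoc)
  hence main: "(u - u') * int P = (int l' - int l) + (int i - int i') * (int e + 1)"
    unfolding er by (simp add: u_def u'_def algebra_simps)
  have b1: "\<bar>int i - int i'\<bar> \<le> int r - 1" using i by linarith
  have "\<bar>(int i - int i') * (int e + 1)\<bar> \<le> (int r - 1) * (int e + 1)"
    unfolding abs_mult using b1 by (intro mult_mono) auto
  moreover have "\<bar>int l' - int l\<bar> \<le> int e - int r - 1" using l by linarith
  moreover have "(int r - 1) * (int e + 1) + (int e - int r - 1) < int P"
    by (simp add: P algebra_simps)
  ultimately have "\<bar>(u - u') * int P\<bar> < int P" unfolding main by linarith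
  hence "\<bar>u - u'\<bar> * int P < 1 * int P" by (simp add: abs_mult)
  hence "\<bar>u - u'\<bar> < 1" by (rule mult_right_less_imp_less) simp
  hence uu: "u = u'" by linarith
  with main have m2: "(int i - int i') * (int e + 1) = int l - int l'" by simp
  moreover have "\<bar>int l - int l'\<bar> < int e + 1" using l by linarith
  ultimately have "\<bar>int i - int i'\<bar> * (int e + 1) < 1 * (int e + 1)" by (metis abs_mult abs_of_nonneg mult_1 of_nat_0_le_iff add_nonneg_nonneg zero_le_one)
  hence "\<bar>int i - int i'\<bar> < 1" by (rule mult_right_less_imp_less) simp
  hence ii: "i = i'" by linarith
  with m2 uu show "i = i' \<and> j = j' \<and> l = l'" by (simp add: u_def u'_def)
qed

text \<open>The left side is the number \<open>D\<close> of conditions in \<open>stepanov\<close>,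
  the right side the number of unknowns. Right minus left equals e * (3 * r - 2) - r ^ 3 - r ^ 2,
  and \<open>e \<ge> r ^ 2\<close> makes this at least r ^ 2 * (2 * r - 3).\<close>

lemma stepanov_dimension_count:
  fixes r e :: nat
  assumes r: "r \<ge> 2" and e: "e \<ge> r ^ 2"
  shows "(e - r - 1) * (r * e + 1) + (e + r + 1) + r * e * (r - 1) < r * ((e + r + 1) * (e - r))"
proof -
  have "r * 1 < r * r" using r by (intro mult_strict_left_mono) auto
  hence re: "e > r" using e unfolding power2_eq_square by linarith
  have "int e * (3 * int r - 2) \<ge> int r ^ 2 * (3 * int r - 2)"
    using r e by (intro mult_right_mono) (auto simp flip: of_nat_power)
  moreover have "int r ^ 2 * (2 * int r - 3) > 0" using r by (intro mult_pos_pos) auto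
  ultimately have "int e * (3 * int r - 2) > int r ^ 3 + int r ^ 2"
    by (simp add: algebra_simps power2_eq_square power3_eq_cube)
  hence "(int e - int r - 1) * (int r * int e + 1) + (int e + int r + 1) + int r * int e * (int r - 1)
      < int r * ((int e + int r + 1) * (int e - int r))"
    by (simp add: algebra_simps power2_eq_square power3_eq_cube)
  moreover have "int (e - r - 1) = int e - int r - 1" "int (e - r) = int e - int r" "int (r - 1) = int r - 1"
    using re r by auto
  ultimately have "int ((e - r - 1) * (r * e + 1) + (e + r + 1) + r * e * (r - 1)) < int (r * ((e + r + 1) * (e - r)))"
    by (simp only: of_nat_add of_nat_mult of_nat_1)
  thus ?thesis by linarith
qed

context residue_field begin

lemma coeff_fixed_mult:
  assumes Q: "ppow Q"
    and "\<And>i. coeff f i ^ Q \<approx> coeff f i" "\<And>i. coeff g i ^ Q \<approx> coeff g i"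
  shows "coeff (f * g) i ^ Q \<approx> coeff (f * g) i"
proof -
  have "coeff (f * g) i ^ Q \<approx> (\<Sum>k\<le>i. (coeff f k * coeff g (i - k)) ^ Q)"
    unfolding coeff_mult by (rule frob_sum[OF Q])
  also have "\<dots> \<approx> (\<Sum>k\<le>i. coeff f k * coeff g (i - k))"
    unfolding power_mult_distrib by (intro eqv_sum eqv_mult assms)
  finally show ?thesis unfolding coeff_mult .
qed

lemma coeff_fixed_power:
  assumes Q: "ppow Q" and f: "\<And>i. coeff f i ^ Q \<approx> coeff f i"
  shows "coeff (f ^ k) i ^ Q \<approx> coeff (f ^ k) i"
proof (induction k arbitrary: i)
  case 0
  show ?case using ppow_pos[OF Q] by (cases i) (auto simp: zero_power)
next
  case (Suc k)
  show ?case unfolding power_Suc by (rule coeff_fixed_mult[OF Q f Suc])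
qed

text \<open>The system is only additive in \<open>k\<close>; pigeonhole replaces linear algebra.\<close>

lemma exists_semilinear_relation:
  fixes W :: "'i \<Rightarrow> 'r poly"
  assumes P: "ppow P" and Q: "ppow Q" "Q > 1" and I: "finite I" and DI: "D < card I"
    and W: "\<And>x. x \<in> I \<Longrightarrow> degree (W x) < D"
    and Wf: "\<And>x i. x \<in> I \<Longrightarrow> coeff (W x) i ^ Q \<approx> coeff (W x) i"
  shows "\<exists>k. (\<exists>x\<in>I. k x \<notin> M) \<and> (\<Sum>x\<in>I. Polynomial.smult (k x ^ P) (W x)) \<approx>\<^sub>p 0"
proof -
  define F where "F k = (\<Sum>x\<in>I. Polynomial.smult (k x ^ P) (W x))" for k
  define G where "G k = restrict (\<lambda>i. rep (coeff (F k) i)) {..<D}" for k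
  have cF: "coeff (F k) i = (\<Sum>x\<in>I. k x ^ P * coeff (W x) i)" for k i
    by (simp add: F_def coeff_sum)
  have T: "finite (T Q)" "card (T Q) = Q" using T_finite_card[OF Q] by auto
  \<comment> \<open>\<open>G\<close> reads off the first \<open>D\<close> coefficients as elements
    of the field with \<open>Q\<close> elements. There are Q ^ card I vectors k but only Q ^ D
    possible values, so two vectors collide, and their difference is the relation sought.\<close>
  have "G ` (PiE I (\<lambda>_. T Q)) \<subseteq> PiE {..<D} (\<lambda>_. T Q)"
  proof clarsimp
    fix k assume k: "k \<in> (PiE I (\<lambda>_. T Q))"
    have "coeff (F k) i ^ Q \<approx> coeff (F k) i" for i
    proof -
      have "coeff (F k) i ^ Q \<approx> (\<Sum>x\<in>I. (k x ^ P * coeff (W x) i) ^ Q)"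
        unfolding cF by (rule frob_sum[OF Q(1)])
      also have "\<dots> = (\<Sum>x\<in>I. (k x ^ Q) ^ P * coeff (W x) i ^ Q)"
        by (simp add: power_mult_distrib mult.commute flip: power_mult)
      also have "\<dots> \<approx> coeff (F k) i"
        unfolding cF using k by (intro eqv_sum eqv_mult eqv_power Wf T_power) auto
      finally show ?thesis .
    qed
    thus "G k \<in> PiE {..<D} (\<lambda>_. T Q)" by (auto simp: G_def intro!: T_rep)
  qed
  hence "card (G ` (PiE I (\<lambda>_. T Q))) \<le> card (PiE {..<D} (\<lambda>_. T Q))"
    using T by (intro card_mono finite_PiE) auto
  also have "\<dots> = Q ^ D" using T by (simp add: card_PiE)
  also have "\<dots> < Q ^ card I" using DI Q by (intro power_strict_increasing) auto
  also have "\<dots> = card (PiE I (\<lambda>_. T Q))" using I T by (simp add: card_PiE)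
  finally have "\<not> inj_on G (PiE I (\<lambda>_. T Q))" using card_image by fastforce
  then obtain k1 k2 where k: "k1 \<in> PiE I (\<lambda>_. T Q)" "k2 \<in> PiE I (\<lambda>_. T Q)" "k1 \<noteq> k2" "G k1 = G k2"
    unfolding inj_on_def by blast
  from k(1-3) obtain x where x: "x \<in> I" "k1 x \<noteq> k2 x" by (metis PiE_ext)
  hence "\<not> k1 x \<approx> k2 x" using k(1,2) T_eqI by blast
  hence 1: "k1 x - k2 x \<notin> M" by (simp add: eqv_def)
  have "coeff (F (\<lambda>x. k1 x - k2 x)) i \<approx> 0" for i
  proof (cases "i < D")
    case True
    have "coeff (F (\<lambda>x. k1 x - k2 x)) i \<approx> (\<Sum>x\<in>I. (k1 x ^ P - k2 x ^ P) * coeff (W x) i)"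
      unfolding cF by (intro eqv_sum eqv_mult frob_diff[OF P] eqv_refl)
    also have "\<dots> = coeff (F k1) i - coeff (F k2) i"
      by (simp add: cF algebra_simps sum_subtractf)
    also have "\<dots> \<approx> 0"
    proof -
      have "rep (coeff (F k1) i) = rep (coeff (F k2) i)"
        using True fun_cong[OF k(4), of i] by (simp add: G_def)
      thus ?thesis by (simp add: rep_eq_iff eqv_def)
    qed
    finally show ?thesis .
  next
    case False
    hence "coeff (W x) i = 0" if "x \<in> I" for x using W[OF that] by (intro coeff_eq_0) simp
    hence "coeff (F (\<lambda>x. k1 x - k2 x)) i = 0" by (simp add: cF)
    thus ?thesis by simp
  qed
  thus ?thesis using x 1 by (intro exI[of _ "\<lambda>x. k1 x - k2 x"]) (auto simp: F_def peqv_def)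
qed

text \<open>Among the terms whose coefficient is not in \<open>M\<close>, the one of largest weight
  is alone in contributing modulo \<open>M\<close> to the coefficient of that degree.\<close>

lemma independent_of_distinct_degrees:
  fixes U :: "'i \<Rightarrow> 'r poly"
  assumes I: "finite I" and w: "inj_on w I"
    and U: "\<And>x. x \<in> I \<Longrightarrow> degree (U x) \<le> w x" "\<And>x. x \<in> I \<Longrightarrow> coeff (U x) (w x) \<notin> M"
    and x0: "x0 \<in> I" "k x0 \<notin> M"
  shows "\<not> pM (\<Sum>x\<in>I. Polynomial.smult (k x) (U x))"
proof -
  define A where "A = {x\<in>I. k x \<notin> M}"
  have A: "finite A" "A \<noteq> {}" using I x0 by (auto simp: A_def)
  have "Max (w ` A) \<in> w ` A" using A by (intro Max_in) auto
  then obtain y where y: "y \<in> A" "w y = Max (w ` A)" by auto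
  have yI: "y \<in> I" "k y \<notin> M" using y by (auto simp: A_def)
  have "k x * coeff (U x) (w y) \<in> M" if x: "x \<in> I - {y}" for x
  proof (cases "x \<in> A")
    case True
    hence "w x \<le> w y" using A y by auto
    moreover have "w x \<noteq> w y" using x y w by (auto simp: A_def inj_on_def)
    ultimately show ?thesis using U(1)[of x] x by (simp add: coeff_eq_0 zero_M)
  qed (use x in \<open>auto simp: A_def intro: mult_M2\<close>)
  hence "(\<Sum>x\<in>I - {y}. k x * coeff (U x) (w y)) \<in> M" by (rule sum_M)
  moreover have "coeff (\<Sum>x\<in>I. Polynomial.smult (k x) (U x)) (w y) = k y * coeff (U y) (w y) +
      (\<Sum>x\<in>I - {y}. k x * coeff (U x) (w y))"
    using I yI by (simp add: coeff_sum sum.remove)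
  moreover have "k y * coeff (U y) (w y) \<notin> M" using yI U(2) prime_M by blast
  ultimately show ?thesis unfolding pM_def using diff_M by (metis add_diff_cancel_right')
qed

text \<open>
  On the points counted, the \<open>P\<close>-th power of a term of \<open>s\<close> agrees, up to \<open>y ^ (P - 1)\<close>, with a term of
  low degree; the coefficients will be chosen so that the sum of the latter vanishes identically.
\<close>

lemma stepanov_identity:
  assumes P: "ppow P" "P = r * e + 1" and i: "i < r"
    and z: "z ^ (P * P) \<approx> z" and y: "y ^ (e * (P + 1)) \<approx> a"
  shows "(k * (z ^ (l + j * P) * y ^ (i * e))) ^ P * y ^ (P - 1) \<approx> k ^ P * (z ^ (l * P + j) * (a ^ i * y ^ ((r - i) * e)))"
proof -
  have "(k * (z ^ (l + j * P) * y ^ (i * e))) ^ P * y ^ (P - 1) = k ^ P * (z ^ (l * P) * (z ^ (P * P)) ^ j * y ^ (i * e * P + r * e))"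
    by (simp add: P(2) power_mult_distrib power_add mult_ac flip: power_mult)
  also have "i * e * P + r * e = e * (P + 1) * i + (r - i) * e"
  proof -
    obtain d where "r = i + d" using i less_imp_add_positive by blast
    thus ?thesis by (simp add: algebra_simps)
  qed
  also have "k ^ P * (z ^ (l * P) * (z ^ (P * P)) ^ j * y ^ (e * (P + 1) * i + (r - i) * e)) =
     k ^ P * (z ^ (l * P) * (z ^ (P * P)) ^ j * ((y ^ (e * (P + 1))) ^ i * y ^ ((r - i) * e)))"
    by (simp only: power_add power_mult mult.assoc)
  also have "\<dots> \<approx> k ^ P * (z ^ (l * P) * z ^ j * (a ^ i * y ^ ((r - i) * e)))"
    by (intro eqv_mult eqv_refl eqv_power z y)
  finally show ?thesis by (simp add: power_add)
qed

text \<open>Here Q - 1 = r * e * (P + 1), so the condition prescribes the r-th power residue symbol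
  of the value of \<open>h\<close>. About Q / r solutions are expected; the bound is e * P, which is
  less than Q / r, plus an error of (2 * r + 1) * P, where P is the square root of Q.\<close>

lemma stepanov:
  fixes h :: "'r poly" and r e P Q :: nat
  assumes r: "r \<ge> 2" and e: "e \<ge> r ^ 2" and P: "ppow P" "P = r * e + 1" and Q: "Q = P * P"
    and h: "degree h \<le> r - 1" "coeff h (r - 1) \<notin> M"
    and hQ: "\<And>i. coeff h i ^ Q \<approx> coeff h i" and aQ: "a ^ Q \<approx> a"
  shows "card {z \<in> T Q. poly h z \<notin> M \<and> poly h z ^ (e * (P + 1)) \<approx> a} \<le> (e + 2 * r + 1) * P"
proof -
  \<comment> \<open>\<open>B\<close> is the range of l for which the weights are distinct. The
    degree of \<open>s\<close> is governed by J * P, so \<open>J\<close> exceeds e only by r + 1,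
    enough for more unknowns than conditions.\<close>
  define J B where "J = e + r + 1" and "B = e - r"
  define I where "I = {..<r} \<times> {..<J} \<times> {..<B}"
  define D where "D = (B - 1) * P + J + r * e * (r - 1)"
  define W where "W = (\<lambda>(i, j, l). monom 1 (l * P + j) * Polynomial.smult (a ^ i) (h ^ ((r - i) * e)))"
  define U where "U = (\<lambda>(i::nat, j, l). monom 1 (l + j * P) * h ^ (i * e))"
  define w where "w = (\<lambda>(i, j, l). l + j * P + i * e * (r - 1))"
  have "r * 1 \<le> r * r" using r by (intro mult_left_mono) auto
  hence e0: "e > 0" using e r unfolding power2_eq_square by linarith
  have Qp: "ppow Q" "Q > 1" using P ppow_power[OF P(1), of 2] r e0 by (auto simp: Q power2_eq_square)
  have finI: "finite I" by (simp add: I_def)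
  have "\<exists>k. (\<exists>x\<in>I. k x \<notin> M) \<and> (\<Sum>x\<in>I. Polynomial.smult (k x ^ P) (W x)) \<approx>\<^sub>p 0"
  proof (rule exists_semilinear_relation[OF P(1) Qp finI])
    show "D < card I" using stepanov_dimension_count[OF r e]
      by (simp add: D_def I_def J_def B_def P(2) card_cartesian_product)
  next
    fix x assume "x \<in> I"
    then obtain i j l where x: "x = (i, j, l)" "i < r" "j < J" "l < B" by (auto simp: I_def)
    have "degree (monom (1::'r) (l * P + j)) \<le> l * P + j" by (simp add: degree_monom_le)
    moreover have "degree (Polynomial.smult (a ^ i) (h ^ ((r - i) * e))) \<le> r * e * (r - 1)"
    proof -
      have "degree (h ^ ((r - i) * e)) \<le> (r - i) * e * (r - 1)" using coeff_power_bound[OF h(1)] by blast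
      also have "\<dots> \<le> r * e * (r - 1)" by (intro mult_right_mono) auto
      finally show ?thesis by (rule order.trans[OF degree_smult_le])
    qed
    moreover have "l * P + j < (B - 1) * P + J"
    proof -
      have "l * P \<le> (B - 1) * P" using x by (intro mult_right_mono) auto
      thus ?thesis using x by linarith
    qed
    ultimately show "degree (W x) < D"
      unfolding W_def D_def x prod.case using degree_mult_le[of "monom (1::'r) (l * P + j)" "Polynomial.smult (a ^ i) (h ^ ((r - i) * e))"]
      by linarith
    have *: "coeff (Polynomial.smult (a ^ i) (h ^ ((r - i) * e))) n ^ Q \<approx> coeff (Polynomial.smult (a ^ i) (h ^ ((r - i) * e))) n" for n
    proof -
      have "(a ^ i) ^ Q * coeff (h ^ ((r - i) * e)) n ^ Q \<approx> a ^ i * coeff (h ^ ((r - i) * e)) n"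
        using eqv_power[OF aQ, of i]
        by (intro eqv_mult coeff_fixed_power[OF Qp(1) hQ]) (simp add: mult.commute flip: power_mult)
      thus ?thesis by (simp add: power_mult_distrib)
    qed
    show "coeff (W x) n ^ Q \<approx> coeff (W x) n" for n
      unfolding W_def x prod.case using Qp
      by (intro coeff_fixed_mult[OF Qp(1) _ *]) (auto simp: zero_power)
  qed
  then obtain k x0 where x0: "x0 \<in> I" "k x0 \<notin> M" and rel: "(\<Sum>x\<in>I. Polynomial.smult (k x ^ P) (W x)) \<approx>\<^sub>p 0"
    by blast
  define s where "s = (\<Sum>x\<in>I. Polynomial.smult (k x) (U x))"
  have Udeg: "degree (U x) \<le> w x" "coeff (U x) (w x) \<notin> M" if "x \<in> I" for x
  proof -
    obtain i j l where x: "x = (i, j, l)" using prod_cases3 by blast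
    have b: "degree (h ^ (i * e)) \<le> i * e * (r - 1)"
      "coeff (h ^ (i * e)) (i * e * (r - 1)) = coeff h (r - 1) ^ (i * e)"
      using coeff_power_bound[OF h(1), of "i * e"] by auto
    have m: "degree (monom (1::'r) (l + j * P)) \<le> l + j * P" by (simp add: degree_monom_le)
    show "degree (U x) \<le> w x"
      unfolding U_def w_def x prod.case using degree_mult_le[of "monom (1::'r) (l + j * P)" "h ^ (i * e)"] b m
      by linarith
    show "coeff (U x) (w x) \<notin> M"
      unfolding U_def w_def x prod.case coeff_mult_bound[OF m b(1)] b(2) using h(2) power_M by auto
  qed
  have "w = (\<lambda>(i, j, l). l + j * P + i * e * (r - 1))" by (simp add: w_def)
  hence winj: "inj_on w I" using stepanov_weights_inj[OF r e P(2)] by (auto simp: I_def B_def elim: inj_on_subset)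
  have snz: "\<not> pM s" unfolding s_def 
    by (rule independent_of_distinct_degrees[where k = k, OF finI winj _ _ x0]) (use Udeg in auto)
  have sdeg: "degree s \<le> (e + 2 * r + 1) * P"
    unfolding s_def
  proof (rule degree_sum_le[OF finI])
    fix x assume x: "x \<in> I"
    then obtain i j l where ijl: "x = (i, j, l)" "i < r" "j < J" "l < B" by (auto simp: I_def)
    have "i * e * (r - 1) \<le> r * P"
    proof -
      have "i * e * (r - 1) \<le> r * e * r" using ijl by (intro mult_mono) auto
      also have "\<dots> \<le> r * P" by (simp add: P(2))
      finally show ?thesis .
    qed
    moreover have "j * P \<le> (e + r) * P" using ijl by (intro mult_right_mono) (auto simp: J_def)
    moreover have "l \<le> P"
    proof -
      have "e \<le> r * e" using r by simp
      thus ?thesis using ijl(4) unfolding B_def P(2) by linarith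
    qed
    ultimately have "w x \<le> (e + 2 * r + 1) * P" unfolding w_def ijl prod.case by (simp add: algebra_simps)
    moreover have "degree (Polynomial.smult (k x) (U x)) \<le> degree (U x)" by (rule degree_smult_le)
    ultimately show "degree (Polynomial.smult (k x) (U x)) \<le> (e + 2 * r + 1) * P"
      using Udeg(1)[OF x] by linarith
  qed
  define S where "S = {z \<in> T Q. poly h z \<notin> M \<and> poly h z ^ (e * (P + 1)) \<approx> a}"
  have zero: "poly s z \<in> M" if z: "z \<in> S" for z
  proof -
    define y where "y = poly h z"
    have zz: "z ^ (P * P) \<approx> z" "y \<notin> M" "y ^ (e * (P + 1)) \<approx> a" using z by (auto simp: S_def y_def Q intro: T_power)
    have "poly s z ^ P * y ^ (P - 1) \<approx> (\<Sum>x\<in>I. (k x * poly (U x) z) ^ P) * y ^ (P - 1)"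
      unfolding s_def by (simp add: poly_sum eqv_mult frob_sum[OF P(1)])
    also have "\<dots> = (\<Sum>x\<in>I. (k x * poly (U x) z) ^ P * y ^ (P - 1))" by (simp add: sum_distrib_right)
    also have "\<dots> \<approx> (\<Sum>x\<in>I. k x ^ P * poly (W x) z)"
    proof (rule eqv_sum)
      fix x assume "x \<in> I"
      then obtain i j l where x: "x = (i, j, l)" "i < r" by (auto simp: I_def)
      show "(k x * poly (U x) z) ^ P * y ^ (P - 1) \<approx> k x ^ P * poly (W x) z"
        using stepanov_identity[OF P x(2) zz(1,3), of "k x" l j]
        by (simp add: U_def W_def x poly_monom y_def mult_ac)
    qed
    also have "\<dots> = poly (\<Sum>x\<in>I. Polynomial.smult (k x ^ P) (W x)) z" by (simp add: poly_sum)
    also have "\<dots> \<approx> poly 0 z" using rel by (rule poly_eqv)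
    finally have "poly s z ^ P * y ^ (P - 1) \<in> M" by (simp add: eqv_0)
    thus ?thesis using zz(2) power_M prime_M by blast
  qed
  have "card S \<le> degree s"
  proof (rule ccontr)
    assume "\<not> ?thesis"
    moreover have "finite S" using T_finite_card[OF Qp] by (simp add: S_def)
    ultimately have "pM s" using zero T_eqI by (intro pM_of_many_roots[of S]) (auto simp: S_def)
    thus False using snz by simp
  qed
  thus ?thesis using sdeg by (simp add: S_def)
qed

end

section \<open>The L-function of a character\<close>

text \<open>The length \<open>m\<close> may be a proper multiple of the period, and the cycle is
  then repeated. Such orbits account for the powers of irreducible polynomials in the logarithmic
  derivative of the L-function.\<close>

definition orbit_mset :: "('x \<Rightarrow> 'x) \<Rightarrow> nat \<Rightarrow> 'x \<Rightarrow> 'x multiset"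
  where "orbit_mset f m c = image_mset (\<lambda>i. (f ^^ i) c) (mset_set {..<m})"

lemma size_orbit_mset [simp]: "size (orbit_mset f m c) = m"
  by (simp add: orbit_mset_def)

lemma orbit_mset_0 [simp]: "orbit_mset f 0 c = {#}"
  by (simp add: orbit_mset_def)

lemma orbit_mset_Suc: "orbit_mset f (Suc m) c = add_mset ((f ^^ m) c) (orbit_mset f m c)"
  by (simp add: orbit_mset_def lessThan_Suc)

lemma orbit_mset_add: "orbit_mset f (m + n) c = orbit_mset f m c + orbit_mset f n ((f ^^ m) c)"
proof (induction n)
  case (Suc n)
  have "(f ^^ (m + n)) c = (f ^^ n) ((f ^^ m) c)" by (simp only: add.commute[of m] funpow_add comp_apply)
  thus ?case using Suc by (simp add: orbit_mset_Suc)
qed simp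

lemma image_mset_orbit_mset: "image_mset f (orbit_mset f m c) = orbit_mset f m (f c)"
  by (simp add: orbit_mset_def multiset.map_comp comp_def funpow_swap1)

lemma orbit_mset_stable:
  assumes "(f ^^ m) c = c" shows "image_mset f (orbit_mset f m c) = orbit_mset f m c"
proof -
  have "add_mset c (orbit_mset f m (f c)) = orbit_mset f (1 + m) c"
    unfolding orbit_mset_add by (simp add: orbit_mset_Suc)
  also have "\<dots> = add_mset c (orbit_mset f m c)" using assms by (simp add: orbit_mset_Suc)
  finally show ?thesis by (simp add: image_mset_orbit_mset)
qed

lemma orbit_mset_mult:
  assumes "(f ^^ d) c = c" shows "orbit_mset f (j * d) c = repeat_mset j (orbit_mset f d c)"
  using assms by (induction j) (auto simp: orbit_mset_add)

lemma stable_mset_inj_on: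
  assumes "image_mset f A = A" shows "inj_on f (set_mset A)"
proof -
  have "f ` set_mset A = set_mset A" using assms by (metis set_image_mset)
  thus ?thesis by (intro eq_card_imp_inj_on) auto
qed

lemma stable_mset_count:
  assumes "image_mset f A = A" "c \<in># A" shows "count A (f c) = count A c"
proof -
  have "count A (f c) = count (image_mset f A) (f c)" using assms by simp
  also have "\<dots> = (\<Sum>x\<in>f -` {f c} \<inter> set_mset A. count A x)" by (simp add: count_image_mset)
  also have "f -` {f c} \<inter> set_mset A = {c}"
    using assms(2) stable_mset_inj_on[OF assms(1)] by (auto simp: inj_on_def)
  finally show ?thesis by simp
qed

lemma stable_mset_count_funpow:
  assumes "image_mset f A = A" "c \<in># A" shows "(f ^^ i) c \<in># A \<and> count A ((f ^^ i) c) = count A c"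
proof (induction i)
  case (Suc i)
  hence "count A (f ((f ^^ i) c)) = count A c" using stable_mset_count[OF assms(1)] by auto
  moreover from this have "f ((f ^^ i) c) \<in># A" using assms(2) by (metis count_eq_zero_iff)
  ultimately show ?case by simp
qed (use assms in auto)

text \<open>The iterates of c stay in a finite set, so two of them coincide; injectivity on that set
  strips off the common iterations, and c itself recurs.\<close>

lemma stable_mset_period:
  assumes "image_mset f A = A" "c \<in># A"
  obtains d where "d > 0" "(f ^^ d) c = c"
proof -
  have "\<not> inj_on (\<lambda>i. (f ^^ i) c) (UNIV :: nat set)"
  proof
    assume "inj_on (\<lambda>i. (f ^^ i) c) (UNIV :: nat set)"
    moreover have "range (\<lambda>i. (f ^^ i) c) \<subseteq> set_mset A" using stable_mset_count_funpow[OF assms] by auto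
    ultimately show False using finite_subset finite_imageD infinite_UNIV_nat finite_set_mset by metis
  qed
  then obtain i j where ij: "i < j" "(f ^^ i) c = (f ^^ j) c"
    unfolding inj_on_def by (metis linorder_neqE_nat)
  have "(f ^^ (j - i)) c = c" if "i \<le> j" "(f ^^ i) c = (f ^^ j) c" for i j using that
  proof (induction i arbitrary: j)
    case (Suc i)
    then obtain j' where j': "j = Suc j'" by (cases j) auto
    have "f ((f ^^ i) c) = f ((f ^^ j') c)" using Suc j' by simp
    hence "(f ^^ i) c = (f ^^ j') c"
      using stable_mset_inj_on[OF assms(1)] stable_mset_count_funpow[OF assms] by (auto simp: inj_on_def)
    thus ?case using Suc j' by auto
  qed simp
  thus ?thesis using ij that[of "j - i"] by auto
qed

lemma funpow_mult_period: "(f ^^ d) c = c \<Longrightarrow> (f ^^ (d * j)) c = c"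
  by (induction j) (auto simp: funpow_add)

text \<open>The lengths of closed orbits from c are the multiples j * d of the period d, and such an
  orbit is j copies of the cycle. Multiplicity is constant along the cycle, so containment in
  \<open>A\<close> means that j is at most the multiplicity of c.\<close>

lemma stable_mset_orbits:
  assumes st: "image_mset f A = A" and c: "c \<in># A"
  shows "card {m. m > 0 \<and> (f ^^ m) c = c \<and> orbit_mset f m c \<subseteq># A} = count A c"
proof -
  define d where "d = (LEAST d. d > 0 \<and> (f ^^ d) c = c)"
  have "\<exists>d. d > 0 \<and> (f ^^ d) c = c" using stable_mset_period[OF assms] by metis
  hence d: "d > 0" "(f ^^ d) c = c" unfolding d_def by (metis (mono_tags, lifting) LeastI_ex)+
  have dmin: "(f ^^ i) c \<noteq> c" if "0 < i" "i < d" for i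
    using that not_less_Least[of i "\<lambda>d. d > 0 \<and> (f ^^ d) c = c"] by (auto simp: d_def)
  have per: "(f ^^ m) c = c \<longleftrightarrow> d dvd m" for m
  proof
    assume m: "(f ^^ m) c = c"
    have "(f ^^ m) c = (f ^^ (m mod d)) ((f ^^ (d * (m div d))) c)"
      by (metis comp_apply funpow_add mod_mult_div_eq)
    hence "(f ^^ (m mod d)) c = c" using m funpow_mult_period[OF d(2)] by simp
    hence "m mod d = 0" using dmin[of "m mod d"] d(1) by fastforce
    thus "d dvd m" by auto
  next
    assume "d dvd m" thus "(f ^^ m) c = c" using funpow_mult_period[OF d(2)] by auto
  qed
  have inj: "inj_on (\<lambda>i. (f ^^ i) c) {..<d}"
  proof (rule inj_onI)
    have aux: "i = j" if "i \<le> j" "j < d" "(f ^^ i) c = (f ^^ j) c" for i j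
    proof (rule ccontr)
      assume "i \<noteq> j"
      have "(f ^^ ((d - j) + i)) c = (f ^^ ((d - j) + j)) c" by (simp only: funpow_add comp_apply that)
      hence "(f ^^ (d - j + i)) c = c" using that d by simp
      moreover have "0 < d - j + i" "d - j + i < d" using \<open>i \<noteq> j\<close> that(1,2) by linarith+
      ultimately show False using dmin[of "d - j + i"] by simp
    qed
    show "i = j" if "i \<in> {..<d}" "j \<in> {..<d}" "(f ^^ i) c = (f ^^ j) c" for i j
    proof (cases "i \<le> j")
      case True
      show ?thesis by (rule aux[OF True _ that(3)]) (use that(2) in simp)
    next
      case False
      hence "j \<le> i" by simp
      show ?thesis by (rule aux[OF \<open>j \<le> i\<close> _ that(3)[symmetric], symmetric]) (use that(1) in simp)
    qed
  qed
  hence orb: "orbit_mset f d c = mset_set ((\<lambda>i. (f ^^ i) c) ` {..<d})"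
    by (simp add: orbit_mset_def image_mset_mset_set)
  have sub: "orbit_mset f (j * d) c \<subseteq># A \<longleftrightarrow> j \<le> count A c" for j
  proof
    assume "orbit_mset f (j * d) c \<subseteq># A"
    hence "count (orbit_mset f (j * d) c) c \<le> count A c" by (simp add: mset_subset_eq_count)
    moreover have "c \<in> (\<lambda>i. (f ^^ i) c) ` {..<d}" using d(1) by (intro image_eqI[of _ _ 0]) auto
    ultimately show "j \<le> count A c" by (simp add: orbit_mset_mult[OF d(2)] orb)
  next
    assume j: "j \<le> count A c"
    show "orbit_mset f (j * d) c \<subseteq># A"
    proof (rule mset_subset_eqI)
      fix x
      show "count (orbit_mset f (j * d) c) x \<le> count A x"
        using j stable_mset_count_funpow[OF assms]
        by (auto simp: orbit_mset_mult[OF d(2)] orb count_mset_set')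
    qed
  qed
  have "{m. m > 0 \<and> (f ^^ m) c = c \<and> orbit_mset f m c \<subseteq># A} = (\<lambda>j. j * d) ` {1..count A c}"
  proof safe
    fix m assume m: "m > 0" "(f ^^ m) c = c" "orbit_mset f m c \<subseteq># A"
    then obtain j where j: "m = j * d" using per by (metis dvd_def mult.commute)
    thus "m \<in> (\<lambda>j. j * d) ` {1..count A c}" using m sub by (intro image_eqI[of _ _ j]) auto
  qed (use d sub per in auto)
  moreover have "inj_on (\<lambda>j. j * d) {1..count A c}" using d by (auto simp: inj_on_def)
  ultimately show ?thesis by (simp add: card_image)
qed

text \<open>Combinatorial form of \<open>(\<Sum>d dvd g. \<Lambda> d) = deg g\<close> for a monic polynomial with root multiset \<open>A\<close>.\<close>

lemma card_stable_mset_orbits: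
  assumes st: "image_mset f A = A"
  shows "card {(m, c). m > 0 \<and> (f ^^ m) c = c \<and> orbit_mset f m c \<subseteq># A} = size A"
    and "finite {(m, c). m > 0 \<and> (f ^^ m) c = c \<and> orbit_mset f m c \<subseteq># A}"
proof -
  define E where "E c = {m. m > 0 \<and> (f ^^ m) c = c \<and> orbit_mset f m c \<subseteq># A}" for c
  have cA: "c \<in># A" if "m > 0" "orbit_mset f m c \<subseteq># A" for m c
  proof -
    have "c \<in># orbit_mset f m c" using that by (auto simp: orbit_mset_def intro!: image_eqI[of _ _ 0])
    thus ?thesis using that mset_subset_eqD by metis
  qed
  have eq: "{(m, c). m > 0 \<and> (f ^^ m) c = c \<and> orbit_mset f m c \<subseteq># A} = prod.swap ` (Sigma (set_mset A) E)"
    using cA by (auto simp: E_def)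
  have "m \<le> size A" if "m \<in> E c" for m c using that size_mset_mono by (fastforce simp: E_def)
  hence fE: "finite (E c)" for c by (meson finite_nat_set_iff_bounded_le)
  show "finite {(m, c). m > 0 \<and> (f ^^ m) c = c \<and> orbit_mset f m c \<subseteq># A}"
    unfolding eq using fE by auto
  have "card (Sigma (set_mset A) E) = (\<Sum>c\<in>set_mset A. card (E c))" using fE by (intro card_SigmaI) auto
  also have "\<dots> = (\<Sum>c\<in>set_mset A. count A c)"
    using stable_mset_orbits[OF st] by (intro sum.cong) (auto simp: E_def)
  also have "\<dots> = size A" by (simp add: size_multiset_overloaded_eq)
  finally show "card {(m, c). m > 0 \<and> (f ^^ m) c = c \<and> orbit_mset f m c \<subseteq># A} = size A"
    unfolding eq by (simp add: card_image)
qed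

text \<open>A character of the field with q ^ n elements, pulled back to the ambient ring: it
  depends only on the class modulo \<open>M\<close>, and it is multiplicative on the elements of
  that field. Nontriviality enters as the vanishing of the complete sum.\<close>

locale katz_setup = residue_field M p for M :: "'r::comm_ring_1 set" and p :: nat +
  fixes q n :: nat and \<theta> :: 'r and \<chi> :: "'r \<Rightarrow> complex"
  assumes q: "ppow q" "q > 1" and n: "n \<ge> 1"
    and \<theta>_fixed: "\<theta> ^ (q ^ n) \<approx> \<theta>"
    and \<theta>_degree: "\<And>i. 0 < i \<Longrightarrow> i < n \<Longrightarrow> \<not> \<theta> ^ (q ^ i) \<approx> \<theta>"
    and \<chi>_cong: "\<And>x y. x \<approx> y \<Longrightarrow> \<chi> x = \<chi> y"
    and \<chi>_mult: "\<And>x y. x ^ (q ^ n) \<approx> x \<Longrightarrow> y ^ (q ^ n) \<approx> y \<Longrightarrow> \<chi> (x * y) = \<chi> x * \<chi> y"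
    and \<chi>_1: "\<chi> 1 = 1"
    and \<chi>_0: "\<chi> 0 = 0"
    and \<chi>_norm: "\<And>x. x \<notin> M \<Longrightarrow> x ^ (q ^ n) \<approx> x \<Longrightarrow> cmod (\<chi> x) = 1"
    and \<chi>_sum: "(\<Sum>z\<in>T (q ^ n). \<chi> z) = 0"
begin

text \<open>Frobenius followed by the choice of a representative, so that orbits close up with
  equality, as the multiset lemmas require.\<close>

definition \<phi> :: "'r \<Rightarrow> 'r" where "\<phi> z = rep (z ^ q)"

lemma ppow_qk: "ppow (q ^ k)"
  using q ppow_power by blast

lemma qk_gt_1: "k > 0 \<Longrightarrow> q ^ k > 1"
  using q one_less_power by blast

lemma T_qk: "k > 0 \<Longrightarrow> finite (T (q ^ k))" "k > 0 \<Longrightarrow> card (T (q ^ k)) = q ^ k"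
  using T_finite_card[OF ppow_qk qk_gt_1] by auto

lemma T_q: "finite (T q)" "card (T q) = q"
  using T_qk[of 1] by auto

lemma T_q_power:
  assumes "x \<in> T q" shows "x ^ (q ^ j) \<approx> x"
proof (induction j)
  case (Suc j)
  have "x ^ (q ^ Suc j) = (x ^ (q ^ j)) ^ q" by (simp add: mult.commute flip: power_mult)
  also have "\<dots> \<approx> x ^ q" using Suc by (rule eqv_power)
  also have "\<dots> \<approx> x" using assms by (rule T_power)
  finally show ?case .
qed simp

lemma \<phi>_funpow_eqv: "(\<phi> ^^ i) c \<approx> c ^ (q ^ i)"
proof (induction i)
  case (Suc i)
  have "(\<phi> ^^ Suc i) c \<approx> ((\<phi> ^^ i) c) ^ q" by (simp add: \<phi>_def rep_eqv)
  also have "\<dots> \<approx> (c ^ (q ^ i)) ^ q" using Suc by (rule eqv_power)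
  finally show ?case by (simp add: mult.commute flip: power_mult)
qed simp

lemma \<phi>_funpow_range: "c \<in> range rep \<Longrightarrow> (\<phi> ^^ i) c \<in> range rep"
  by (cases i) (auto simp: \<phi>_def)

lemma \<phi>_funpow_fixed: "c \<in> range rep \<Longrightarrow> (\<phi> ^^ m) c = c \<longleftrightarrow> c \<in> T (q ^ m)"
  using \<phi>_funpow_eqv[of m c] \<phi>_funpow_range[of c m] range_rep_eqI[of "(\<phi> ^^ m) c" c]
  by (auto simp: T_def intro: eqv_trans eqv_sym)

section \<open>Monic polynomials over the field with \<open>q\<close> elements as stable multisets
  of roots\<close>

definition frob_poly :: "'r poly \<Rightarrow> 'r poly" where "frob_poly f = map_poly (\<lambda>c. c ^ q) f"

lemma coeff_frob_poly: "coeff (frob_poly f) i = coeff f i ^ q"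
  using q by (simp add: frob_poly_def coeff_map_poly zero_power)

lemma frob_poly_cong: "f \<approx>\<^sub>p g \<Longrightarrow> frob_poly f \<approx>\<^sub>p frob_poly g"
  by (auto simp: peqv_def coeff_frob_poly intro: eqv_power)

lemma frob_poly_mult: "frob_poly (f * g) \<approx>\<^sub>p frob_poly f * frob_poly g"
proof -
  have "(\<Sum>k\<le>i. coeff f k * coeff g (i - k)) ^ q \<approx>
      (\<Sum>k\<le>i. (coeff f k * coeff g (i - k)) ^ q)" for i
    by (rule frob_sum[OF q(1)])
  thus ?thesis by (auto simp: peqv_def coeff_frob_poly coeff_mult power_mult_distrib)
qed

lemma frob_poly_prod_linear: "frob_poly (\<Prod>c\<in>#A. [:- c, 1:]) \<approx>\<^sub>p (\<Prod>c\<in>#image_mset \<phi> A. [:- c, 1:])"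
proof (induction A)
  case empty
  show ?case using q by (auto simp: peqv_def coeff_frob_poly zero_power)
next
  case (add c A)
  have "(- c) ^ q \<approx> - \<phi> c"
  proof -
    have "(0 - c) ^ q \<approx> 0 ^ q - c ^ q" by (rule frob_diff[OF q(1)])
    also have "\<dots> = - (c ^ q)" using q by (simp add: zero_power)
    also have "\<dots> \<approx> - \<phi> c" unfolding \<phi>_def by (intro eqv_uminus eqv_sym[OF rep_eqv])
    finally show ?thesis by simp
  qed
  hence "frob_poly [:- c, 1:] \<approx>\<^sub>p [:- \<phi> c, 1:]"
    using q by (auto simp: peqv_def coeff_frob_poly coeff_pCons zero_power split: nat.splits)
  hence "frob_poly [:- c, 1:] * frob_poly (\<Prod>c\<in>#A. [:- c, 1:]) \<approx>\<^sub>p [:- \<phi> c, 1:] * (\<Prod>c\<in>#image_mset \<phi> A. [:- c, 1:])"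
    using add by (rule peqv_mult)
  with frob_poly_mult have "frob_poly ([:- c, 1:] * (\<Prod>c\<in>#A. [:- c, 1:])) \<approx>\<^sub>p [:- \<phi> c, 1:] * (\<Prod>c\<in>#image_mset \<phi> A. [:- c, 1:])"
    by (rule peqv_trans)
  thus ?case by (simp only: image_mset_add_mset prod_mset.add_mset)
qed

text \<open>Root multisets of the monic polynomials of degree \<open>k\<close> over the field with \<open>q\<close> elements.\<close>

definition stable :: "nat \<Rightarrow> 'r multiset set" where
  "stable k = {A. size A = k \<and> set_mset A \<subseteq> range rep \<and> image_mset \<phi> A = A}"

text \<open>The character at g(\<theta>), for g the monic polynomial with root multiset
  \<open>A\<close>.\<close>

definition wt :: "'r multiset \<Rightarrow> complex" where "wt A = \<chi> (\<Prod>c\<in>#A. \<theta> - c)"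

text \<open>The leading coefficient is 1 and is left out; \<open>restrict\<close> makes the
  coefficient vectors extensional, hence members of a \<open>PiE\<close>.\<close>

definition mcoeff :: "'r multiset \<Rightarrow> nat \<Rightarrow> 'r" where
  "mcoeff A = restrict (\<lambda>i. rep (coeff (\<Prod>c\<in>#A. [:- c, 1:]) i)) {..<size A}"

lemma mcoeff_T:
  assumes "A \<in> stable k" shows "mcoeff A \<in> PiE {..<k} (\<lambda>_. T q)"
proof -
  have "frob_poly (\<Prod>c\<in>#A. [:- c, 1:]) \<approx>\<^sub>p (\<Prod>c\<in>#A. [:- c, 1:])"
    using frob_poly_prod_linear[of A] assms by (simp add: stable_def)
  thus ?thesis using assms by (auto simp: mcoeff_def stable_def peqv_def coeff_frob_poly intro!: T_rep)
qed

lemma mcoeff_inj: "inj_on mcoeff (stable k)"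
proof (rule inj_onI)
  fix A B assume AB: "A \<in> stable k" "B \<in> stable k" "mcoeff A = mcoeff B"
  have "coeff (\<Prod>c\<in>#A. [:- c, 1:]) i \<approx> coeff (\<Prod>c\<in>#B. [:- c, 1:]) i" for i
  proof -
    consider "i < k" | "i = k" | "i > k" by linarith
    thus ?thesis
    proof cases
      case 1
      have "size A = k" "size B = k" using AB by (auto simp: stable_def)
      hence "rep (coeff (\<Prod>c\<in>#A. [:- c, 1:]) i) = rep (coeff (\<Prod>c\<in>#B. [:- c, 1:]) i)"
        using 1 fun_cong[OF AB(3), of i] by (simp add: mcoeff_def)
      thus ?thesis by (simp only: rep_eq_iff)
    next
      case 2
      have "size A = k" "size B = k" using AB by (auto simp: stable_def)
      hence "coeff (\<Prod>c\<in>#A. [:- c, 1:]) k = 1" "coeff (\<Prod>c\<in>#B. [:- c, 1:]) k = 1"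
        using prod_linear_monic[of A] prod_linear_monic[of B] by metis+
      thus ?thesis using 2 by simp
    next
      case 3
      thus ?thesis using AB prod_linear_monic[of A] prod_linear_monic[of B] by (simp add: stable_def coeff_eq_0)
    qed
  qed
  thus "A = B" using AB by (intro prod_linear_eqv_imp_eq) (auto simp: stable_def peqv_def)
qed

text \<open>Frobenius fixes the coefficients of f and moves its roots by \<phi>. Uniqueness of the
  root multiset therefore makes it stable.\<close>

lemma mcoeff_surj:
  assumes a: "a \<in> PiE {..<k} (\<lambda>_. T q)"
  shows "\<exists>A\<in>stable k. mcoeff A = a"
proof -
  define f where "f = monom 1 k + (\<Sum>i<k. monom (a i) i)"
  have cf: "coeff f i = (if i = k then 1 else if i < k then a i else 0)" for i
    by (simp add: f_def coeff_sum sum.delta)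
  have "degree f \<le> k" by (intro degree_le) (auto simp: cf)
  hence df: "degree f = k" using le_degree[of f k] by (simp add: cf)
  obtain A where A: "size A = k" "set_mset A \<subseteq> range rep" "f \<approx>\<^sub>p (\<Prod>c\<in>#A. [:- c, 1:])"
    using splits_M[of f] df by (auto simp: cf)
  have "frob_poly f \<approx>\<^sub>p f"
    using a q by (auto simp: peqv_def coeff_frob_poly cf zero_power intro: T_power)
  have "(\<Prod>c\<in>#image_mset \<phi> A. [:- c, 1:]) \<approx>\<^sub>p frob_poly (\<Prod>c\<in>#A. [:- c, 1:])"
    by (rule peqv_sym[OF frob_poly_prod_linear])
  also have "\<dots> \<approx>\<^sub>p frob_poly f" by (rule frob_poly_cong[OF peqv_sym[OF A(3)]])
  also note \<open>frob_poly f \<approx>\<^sub>p f\<close>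
  also note A(3)
  finally have "image_mset \<phi> A = A"
    using A by (intro prod_linear_eqv_imp_eq) (auto simp: \<phi>_def)
  hence "A \<in> stable k" using A by (simp add: stable_def)
  moreover have "mcoeff A = a"
  proof
    fix i show "mcoeff A i = a i"
    proof (cases "i < k")
      case True
      have "coeff f i \<approx> coeff (\<Prod>c\<in>#A. [:- c, 1:]) i" using A(3) by (simp add: peqv_def)
      hence "rep (coeff (\<Prod>c\<in>#A. [:- c, 1:]) i) = rep (a i)"
        using True by (auto simp: cf rep_eq_iff intro: eqv_sym)
      also have "rep (a i) = a i" using a True by (intro rep_rep) (auto simp: T_def)
      finally show ?thesis using True A by (simp add: mcoeff_def)
    qed (use a A in \<open>auto simp: mcoeff_def PiE_def extensional_def\<close>)
  qed
  ultimately show ?thesis by blast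
qed

lemma mcoeff_bij: "bij_betw mcoeff (stable k) (PiE {..<k} (\<lambda>_. T q))"
  unfolding bij_betw_def using mcoeff_inj mcoeff_T mcoeff_surj by blast

lemma finite_stable: "finite (stable k)"
  using bij_betw_finite[OF mcoeff_bij[of k]] T_q by (simp add: finite_PiE)

lemma wt_eq:
  assumes "A \<in> stable k"
  shows "wt A = \<chi> (\<theta> ^ k + (\<Sum>i<k. mcoeff A i * \<theta> ^ i))"
  unfolding wt_def
proof (rule \<chi>_cong)
  have k: "size A = k" using assms by (simp add: stable_def)
  define f where "f = (\<Prod>c\<in>#A. [:- c, 1:])"
  have f: "degree f = k" "coeff f k = 1" using prod_linear_monic[of A] k by (auto simp: f_def)
  have "(\<Prod>c\<in>#A. \<theta> - c) = poly f \<theta>" by (simp add: f_def poly_prod_mset)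
  also have "\<dots> = \<theta> ^ k + (\<Sum>i<k. coeff f i * \<theta> ^ i)"
    unfolding poly_altdef f(1) using f(2) by (simp add: lessThan_Suc_atMost[symmetric] add.commute)
  also have "\<dots> \<approx> \<theta> ^ k + (\<Sum>i<k. mcoeff A i * \<theta> ^ i)"
    using k by (intro eqv_add eqv_sum eqv_mult eqv_refl) (auto simp: mcoeff_def f_def intro: eqv_sym rep_eqv)
  finally show "(\<Prod>c\<in>#A. \<theta> - c) \<approx> \<theta> ^ k + (\<Sum>i<k. mcoeff A i * \<theta> ^ i)" .
qed

section \<open>Coefficients of the L-function and their vanishing from degree \<open>n\<close>
  on\<close>

definition Lcoeff :: "nat \<Rightarrow> complex" where "Lcoeff k = (\<Sum>A\<in>stable k. wt A)"

lemma Lcoeff_eq: "Lcoeff k = (\<Sum>a\<in>PiE {..<k} (\<lambda>_. T q). \<chi> (\<theta> ^ k + (\<Sum>i<k. a i * \<theta> ^ i)))"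
  unfolding Lcoeff_def using wt_eq
  by (subst sum.reindex_bij_betw[OF mcoeff_bij, symmetric]) simp

lemma Lcoeff_0: "Lcoeff 0 = 1"
  by (simp add: Lcoeff_eq \<chi>_1)

lemma \<theta>_pow_distinct:
  assumes "i < n" "j < n" "\<theta> ^ (q ^ i) \<approx> \<theta> ^ (q ^ j)" shows "i = j"
proof -
  have aux: False if "i < j" "j < n" "\<theta> ^ (q ^ i) \<approx> \<theta> ^ (q ^ j)" for i j
  proof -
    have "\<theta> ^ (q ^ i) \<approx> (\<theta> ^ (q ^ (j - i))) ^ (q ^ i)"
      using that by (simp flip: power_mult power_add)
    hence "\<theta> \<approx> \<theta> ^ (q ^ (j - i))" by (simp only: frob_inj[OF ppow_qk])
    hence "\<theta> ^ (q ^ (j - i)) \<approx> \<theta>" by (rule eqv_sym)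
    moreover have "0 < j - i" "j - i < n" using that(1,2) by linarith+
    ultimately show False using \<theta>_degree by blast
  qed
  show ?thesis using aux[of i j] aux[of j i] assms eqv_sym by (metis linorder_neqE_nat)
qed

text \<open>The difference of the two combinations is the value at \<theta> of a polynomial of
  degree less than n with coefficients fixed by Frobenius. It vanishes at all n conjugates of
  \<theta>, which are distinct.\<close>

lemma \<theta>_independent:
  assumes a: "a \<in> PiE {..<n} (\<lambda>_. T q)" "b \<in> PiE {..<n} (\<lambda>_. T q)"
    and eq: "(\<Sum>i<n. a i * \<theta> ^ i) \<approx> (\<Sum>i<n. b i * \<theta> ^ i)"
  shows "a = b"
proof -
  define f where "f = (\<Sum>i<n. monom (a i - b i) i)"
  have cf: "coeff f i = (if i < n then a i - b i else 0)" for i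
    by (simp add: f_def coeff_sum sum.delta)
  have pf: "poly f x = (\<Sum>i<n. (a i - b i) * x ^ i)" for x by (simp add: f_def poly_sum poly_monom)
  have root: "poly f (\<theta> ^ (q ^ j)) \<in> M" for j
  proof -
    have "poly f \<theta> ^ (q ^ j) \<approx> (\<Sum>i<n. ((a i - b i) * \<theta> ^ i) ^ (q ^ j))"
      unfolding pf by (rule frob_sum[OF ppow_qk])
    also have "\<dots> = (\<Sum>i<n. (a i - b i) ^ (q ^ j) * (\<theta> ^ (q ^ j)) ^ i)"
      by (simp add: power_mult_distrib mult.commute flip: power_mult)
    also have "\<dots> \<approx> (\<Sum>i<n. (a i ^ (q ^ j) - b i ^ (q ^ j)) * (\<theta> ^ (q ^ j)) ^ i)"
      by (intro eqv_sum eqv_mult eqv_refl frob_diff ppow_qk)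
    also have "\<dots> \<approx> (\<Sum>i<n. (a i - b i) * (\<theta> ^ (q ^ j)) ^ i)"
      using a by (intro eqv_sum eqv_mult eqv_refl eqv_diff T_q_power) auto
    also have "\<dots> = poly f (\<theta> ^ (q ^ j))" by (simp add: pf)
    finally have 1: "poly f \<theta> ^ (q ^ j) \<approx> poly f (\<theta> ^ (q ^ j))" .
    have "poly f \<theta> \<in> M" using eq by (simp add: pf eqv_def algebra_simps sum_subtractf)
    hence "poly f \<theta> ^ (q ^ j) \<approx> 0 ^ (q ^ j)" by (intro eqv_power) (simp add: eqv_0)
    hence "poly f \<theta> ^ (q ^ j) \<in> M" using q by (simp add: eqv_0 zero_power)
    thus ?thesis using 1 eqv_M by blast
  qed
  define S where "S = (\<lambda>j. \<theta> ^ (q ^ j)) ` {..<n}"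
  have inj: "inj_on (\<lambda>j. \<theta> ^ (q ^ j)) {..<n}" using \<theta>_pow_distinct by (auto intro!: inj_onI)
  have "pM f"
  proof (rule pM_of_many_roots)
    show "finite S" by (simp add: S_def)
    show "x = y" if "x \<in> S" "y \<in> S" "x \<approx> y" for x y using that \<theta>_pow_distinct by (auto simp: S_def)
    show "poly f x \<in> M" if "x \<in> S" for x using that root by (auto simp: S_def)
    have "degree f \<le> n - 1" by (rule degree_le) (auto simp: cf)
    thus "degree f < card S" using n inj by (simp add: S_def card_image)
  qed
  hence "a i \<approx> b i" if "i < n" for i using that by (auto simp: pM_def cf eqv_def dest: spec[of _ i])
  hence "a i = b i" if "i < n" for i using that a T_eqI by blast
  thus ?thesis using a by (intro PiE_ext[of a _ _ b]) auto
qed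

lemma combination_fixed:
  assumes a: "\<And>i. i \<in> I \<Longrightarrow> a i \<in> T q" and \<beta>: "\<beta> ^ (q ^ n) \<approx> \<beta>"
  shows "(\<beta> + (\<Sum>i\<in>I. a i * \<theta> ^ i)) ^ (q ^ n) \<approx> \<beta> + (\<Sum>i\<in>I. a i * \<theta> ^ i)"
proof -
  have "(\<beta> + (\<Sum>i\<in>I. a i * \<theta> ^ i)) ^ (q ^ n) \<approx> \<beta> ^ (q ^ n) + (\<Sum>i\<in>I. a i * \<theta> ^ i) ^ (q ^ n)"
    by (rule frob_add[OF ppow_qk])
  also have "\<dots> \<approx> \<beta> + (\<Sum>i\<in>I. (a i * \<theta> ^ i) ^ (q ^ n))"
    by (intro eqv_add \<beta> frob_sum ppow_qk)
  also have "(\<Sum>i\<in>I. (a i * \<theta> ^ i) ^ (q ^ n)) = (\<Sum>i\<in>I. a i ^ (q ^ n) * (\<theta> ^ (q ^ n)) ^ i)"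
    by (simp add: power_mult_distrib mult.commute flip: power_mult)
  also have "\<beta> + \<dots> \<approx> \<beta> + (\<Sum>i\<in>I. a i * \<theta> ^ i)"
    by (intro eqv_add eqv_sum eqv_mult eqv_refl eqv_power \<theta>_fixed T_q_power a)
  finally show ?thesis .
qed

text \<open>For k = n the powers of \<theta> are a basis, so the argument of \<chi> runs once
  through the field with q ^ n elements, and \<open>\<chi>_sum\<close> applies. Higher coefficients
  are held fixed and absorbed in \<beta>.\<close>

lemma sum_\<chi>_combinations:
  assumes \<beta>: "\<beta> ^ (q ^ n) \<approx> \<beta>" and "k \<ge> n"
  shows "(\<Sum>a\<in>PiE {..<k} (\<lambda>_. T q). \<chi> (\<beta> + (\<Sum>i<k. a i * \<theta> ^ i))) = 0"
  using assms(2) \<beta>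
proof (induction k arbitrary: \<beta> rule: dec_induct)
  case base
  define g where "g a = rep (\<beta> + (\<Sum>i<n. a i * \<theta> ^ i))" for a
  have inj: "inj_on g (PiE {..<n} (\<lambda>_. T q))"
  proof (rule inj_onI)
    fix a b assume ab: "a \<in> PiE {..<n} (\<lambda>_. T q)" "b \<in> PiE {..<n} (\<lambda>_. T q)" "g a = g b"
    hence "(\<Sum>i<n. a i * \<theta> ^ i) \<approx> (\<Sum>i<n. b i * \<theta> ^ i)" by (simp add: g_def rep_eq_iff eqv_def)
    thus "a = b" using ab \<theta>_independent by blast
  qed
  have sub: "g ` PiE {..<n} (\<lambda>_. T q) \<subseteq> T (q ^ n)"
    using combination_fixed[OF _ base(1)] by (auto simp: g_def PiE_def intro!: T_rep)
  have "g ` PiE {..<n} (\<lambda>_. T q) = T (q ^ n)"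
  proof (rule card_subset_eq[OF _ sub])
    show "card (g ` PiE {..<n} (\<lambda>_. T q)) = card (T (q ^ n))"
      using inj T_q T_qk[of n] n by (simp add: card_image card_PiE)
  qed (use T_qk n in auto)
  hence bij: "bij_betw g (PiE {..<n} (\<lambda>_. T q)) (T (q ^ n))" using inj by (simp add: bij_betw_def)
  have "(\<Sum>a\<in>PiE {..<n} (\<lambda>_. T q). \<chi> (\<beta> + (\<Sum>i<n. a i * \<theta> ^ i))) = (\<Sum>a\<in>PiE {..<n} (\<lambda>_. T q). \<chi> (g a))"
    unfolding g_def by (intro sum.cong refl \<chi>_cong eqv_sym[OF rep_eqv])
  also have "\<dots> = (\<Sum>z\<in>T (q ^ n). \<chi> z)" by (rule sum.reindex_bij_betw[OF bij])
  finally show ?case using \<chi>_sum by simp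
next
  case (step k)
  have "PiE {..<Suc k} (\<lambda>_. T q) = (\<lambda>(x, a). a(k := x)) ` (T q \<times> PiE {..<k} (\<lambda>_. T q))"
    by (simp add: lessThan_Suc PiE_insert_eq)
  moreover have "inj_on (\<lambda>(x, a). a(k := x)) (T q \<times> PiE {..<k} (\<lambda>_. T q))"
    using inj_combinator[of k "{..<k}" "\<lambda>_. T q"] by simp
  ultimately have "(\<Sum>a\<in>PiE {..<Suc k} (\<lambda>_. T q). \<chi> (\<beta> + (\<Sum>i<Suc k. a i * \<theta> ^ i)))
      = (\<Sum>(x, a)\<in>T q \<times> PiE {..<k} (\<lambda>_. T q). \<chi> (\<beta> + (\<Sum>i<Suc k. (a(k := x)) i * \<theta> ^ i)))"
    by (simp add: sum.reindex case_prod_unfold del: sum.lessThan_Suc)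
  also have "\<dots> = (\<Sum>x\<in>T q. \<Sum>a\<in>PiE {..<k} (\<lambda>_. T q). \<chi> ((\<beta> + x * \<theta> ^ k) + (\<Sum>i<k. a i * \<theta> ^ i)))"
    by (simp add: sum.cartesian_product algebra_simps)
  also have "\<dots> = (\<Sum>x\<in>T q. 0)"
  proof (intro sum.cong refl step.IH)
    fix x assume "x \<in> T q"
    thus "(\<beta> + x * \<theta> ^ k) ^ (q ^ n) \<approx> \<beta> + x * \<theta> ^ k"
      using combination_fixed[of "{k}" "\<lambda>_. x", OF _ step.prems] by simp
  qed
  finally show ?case by simp
qed

lemma Lcoeff_eq_0:
  assumes "k \<ge> n" shows "Lcoeff k = 0"
  unfolding Lcoeff_eq
proof (rule sum_\<chi>_combinations[OF _ assms])
  have "(\<theta> ^ k) ^ (q ^ n) = (\<theta> ^ (q ^ n)) ^ k" by (simp add: mult.commute flip: power_mult)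
  also have "\<dots> \<approx> \<theta> ^ k" by (rule eqv_power[OF \<theta>_fixed])
  finally show "(\<theta> ^ k) ^ (q ^ n) \<approx> \<theta> ^ k" .
qed

text \<open>For \<open>m \<ge> 1\<close> the product is the value at \<theta> of the characteristic
  polynomial of c over the field with q elements. These sums are the coefficients of X * L' /
  L.\<close>

definition S :: "nat \<Rightarrow> complex" where
  "S m = (\<Sum>c\<in>T (q ^ m). \<chi> (\<Prod>i<m. \<theta> - c ^ (q ^ i)))"

lemma wt_orbit: "wt (orbit_mset \<phi> m c) = \<chi> (\<Prod>i<m. \<theta> - c ^ (q ^ i))"
  unfolding wt_def orbit_mset_def multiset.map_comp comp_def
  by (rule \<chi>_cong) (auto simp flip: prod_unfold_prod_mset intro!: eqv_prod eqv_diff \<phi>_funpow_eqv)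

text \<open>The n-th iterate of \<phi> permutes \<open>A\<close> and the q ^ n-th power fixes
  \<theta>. The product thus lies in the field on which \<chi> is multiplicative.\<close>

lemma wt_fixed:
  assumes "image_mset \<phi> A = A"
  shows "(\<Prod>c\<in>#A. \<theta> - c) ^ (q ^ n) \<approx> (\<Prod>c\<in>#A. \<theta> - c)"
proof -
  have st: "image_mset (\<phi> ^^ i) A = A" for i
  proof (induction i)
    case (Suc i)
    have "image_mset (\<phi> ^^ Suc i) A = image_mset \<phi> (image_mset (\<phi> ^^ i) A)"
      by (simp add: multiset.map_comp)
    thus ?case by (simp only: Suc assms)
  qed simp
  have "(\<Prod>c\<in>#A. \<theta> - c) ^ (q ^ n) = (\<Prod>c\<in>#A. (\<theta> - c) ^ (q ^ n))" by (induction A) (simp_all add: power_mult_distrib)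
  also have "\<dots> \<approx> (\<Prod>c\<in>#A. \<theta> - (\<phi> ^^ n) c)"
  proof (rule eqv_prod_mset)
    fix c
    have "(\<theta> - c) ^ (q ^ n) \<approx> \<theta> ^ (q ^ n) - c ^ (q ^ n)" by (rule frob_diff[OF ppow_qk])
    also have "\<dots> \<approx> \<theta> - (\<phi> ^^ n) c" by (intro eqv_diff \<theta>_fixed eqv_sym[OF \<phi>_funpow_eqv])
    finally show "(\<theta> - c) ^ (q ^ n) \<approx> \<theta> - (\<phi> ^^ n) c" .
  qed
  also have "(\<Prod>c\<in>#A. \<theta> - (\<phi> ^^ n) c) = (\<Prod>c\<in>#image_mset (\<phi> ^^ n) A. \<theta> - c)"
    by (simp add: multiset.map_comp comp_def)
  also have "\<dots> = (\<Prod>c\<in>#A. \<theta> - c)" by (simp only: st)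
  finally show ?thesis .
qed

lemma wt_add: "image_mset \<phi> A = A \<Longrightarrow> image_mset \<phi> B = B \<Longrightarrow> wt (A + B) = wt A * wt B"
  by (simp add: wt_def \<chi>_mult wt_fixed)

text \<open>This is X * L' = L * (sum of S m * X ^ m), read off in degree k. A closed orbit and a
  stable multiset of size k - m add up to a stable multiset of size k, and each of the latter
  contains exactly k closed orbits counted with their starting points.\<close>

theorem newton_identity: "of_nat k * Lcoeff k = (\<Sum>m=1..k. S m * Lcoeff (k - m))"
proof -
  define Orb where "Orb A = {(m, c). m > 0 \<and> (\<phi> ^^ m) c = c \<and> orbit_mset \<phi> m c \<subseteq># A}" for A
  have Orb: "card (Orb A) = k" "finite (Orb A)" if "A \<in> stable k" for A
    using card_stable_mset_orbits[of \<phi> A] that by (auto simp: Orb_def stable_def)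
  have sub_stable: "set_mset (orbit_mset \<phi> m c) \<subseteq> range rep \<and> image_mset \<phi> (orbit_mset \<phi> m c) = orbit_mset \<phi> m c"
    if "c \<in> T (q ^ m)" for m c
    using that \<phi>_funpow_fixed[of c m] orbit_mset_stable[where f = \<phi> and m = m and c = c] \<phi>_funpow_range[of c] T_range[OF that]
    by (auto simp: orbit_mset_def)
  have "(\<Sum>m=1..k. S m * Lcoeff (k - m)) = (\<Sum>m=1..k. \<Sum>c\<in>T (q ^ m). \<Sum>B\<in>stable (k - m). wt (orbit_mset \<phi> m c + B))"
    unfolding S_def Lcoeff_def sum_product
    by (intro sum.cong refl) (use sub_stable in \<open>auto simp: wt_add wt_orbit stable_def\<close>)
  also have "\<dots> = (\<Sum>(m, c, B)\<in>(SIGMA m:{1..k}. SIGMA c:T (q ^ m). stable (k - m)). wt (orbit_mset \<phi> m c + B))"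
    using T_qk finite_stable by (simp add: sum.Sigma)
  also have "\<dots> = (\<Sum>(A, m, c)\<in>Sigma (stable k) Orb. wt A)"
  proof (rule sum.reindex_bij_witness[where i = "\<lambda>(A, m, c). (m, c, A - orbit_mset \<phi> m c)"
        and j = "\<lambda>(m, c, B). (orbit_mset \<phi> m c + B, m, c)"]; clarsimp)
    fix m c B assume *: "Suc 0 \<le> m" "m \<le> k" "c \<in> T (q ^ m)" "B \<in> stable (k - m)"
    thus "orbit_mset \<phi> m c + B \<in> stable k \<and> (m, c) \<in> Orb (orbit_mset \<phi> m c + B)"
      using sub_stable[of c m] \<phi>_funpow_fixed[of c m] T_range[of c] by (auto simp: stable_def Orb_def)
  next
    fix A m c assume *: "A \<in> stable k" "(m, c) \<in> Orb A"
    hence sub: "orbit_mset \<phi> m c \<subseteq># A" and m: "m > 0" "(\<phi> ^^ m) c = c" by (auto simp: Orb_def)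
    show "orbit_mset \<phi> m c + (A - orbit_mset \<phi> m c) = A" using sub by simp
    have "c \<in># orbit_mset \<phi> m c" using m by (auto simp: orbit_mset_def intro!: image_eqI[of _ _ 0])
    hence "c \<in> range rep" using sub *(1) mset_subset_eqD by (fastforce simp: stable_def)
    hence cT: "c \<in> T (q ^ m)" using m \<phi>_funpow_fixed by blast
    have mk: "m \<le> k" using size_mset_mono[OF sub] *(1) by (simp add: stable_def)
    have "A - orbit_mset \<phi> m c \<in> stable (k - m)"
      using *(1) sub sub_stable[OF cT] in_diffD[of _ A "orbit_mset \<phi> m c"]
      by (auto simp: stable_def size_Diff_submset image_mset_Diff)
    thus "Suc 0 \<le> m \<and> m \<le> k \<and> c \<in> T (q ^ m) \<and> A - orbit_mset \<phi> m c \<in> stable (k - m)"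
      using m mk cT by auto
  qed
  also have "\<dots> = (\<Sum>A\<in>stable k. \<Sum>(m, c)\<in>Orb A. wt A)"
    using finite_stable Orb by (subst sum.Sigma) (auto simp: case_prod_unfold)
  also have "\<dots> = (\<Sum>A\<in>stable k. of_nat k * wt A)"
    using Orb by (intro sum.cong) (auto simp: case_prod_unfold)
  finally show ?thesis by (simp add: Lcoeff_def sum_distrib_left)
qed

end

section \<open>Power sums of complex numbers\<close>

lemma poly_reciprocal_roots:
  fixes f :: "complex poly"
  assumes "coeff f 0 = 1"
  shows "\<exists>A. size A = degree f \<and> f = (\<Prod>\<alpha>\<in>#A. [:1, - \<alpha>:])"
proof -
  have f0: "f \<noteq> 0" using assms by auto
  obtain A where A: "size A = degree f" "f = Polynomial.smult (Polynomial.lead_coeff f) (\<Prod>x\<in>#A. [:- x, 1:])"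
    using alg_closed_imp_factorization[OF f0] by blast
  have "poly f 0 = Polynomial.lead_coeff f * (\<Prod>x\<in>#A. - x)" by (subst A(2)) (simp add: poly_prod_mset)
  hence prod: "Polynomial.lead_coeff f * (\<Prod>x\<in>#A. - x) = 1" using assms by (simp add: poly_0_coeff_0)
  have "0 \<notin># A"
  proof
    assume "0 \<in># A"
    hence "0 \<in># image_mset uminus A" by force
    hence "(\<Prod>x\<in>#A. - x) = 0" by (simp only: prod_mset_zero_iff)
    thus False using prod by (simp only: mult_zero_right zero_neq_one)
  qed
  hence "(\<Prod>x\<in>#A. [:- x, 1:]) = Polynomial.smult (\<Prod>x\<in>#A. - x) (\<Prod>x\<in>#A. [:1, - inverse x:])"
  proof (induction A)
    case (add x A)
    hence "[:- x, 1:] = Polynomial.smult (- x) [:1, - inverse x:]" by auto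
    thus ?case using add by (simp add: mult_ac del: mult_pCons_left smult_pCons)
  qed simp
  hence "f = Polynomial.smult (Polynomial.lead_coeff f * (\<Prod>x\<in>#A. - x)) (\<Prod>x\<in>#A. [:1, - inverse x:])"
    using A(2) by simp
  hence "f = (\<Prod>\<alpha>\<in>#image_mset inverse A. [:1, - \<alpha>:])" unfolding prod by (simp add: multiset.map_comp comp_def)
  thus ?thesis using A(1) by (intro exI[of _ "image_mset inverse A"]) simp
qed

text \<open>The logarithmic derivative is additive over the factors, and for 1 - \<alpha> * X,
  multiplied by X, it is minus the geometric series in \<alpha> * X without constant term.
  Multiplying out avoids division.\<close>

lemma fps_newton_product:
  fixes A :: "complex multiset"
  shows "fps_X * fps_deriv (fps_of_poly (\<Prod>\<alpha>\<in>#A. [:1, - \<alpha>:])) =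
    fps_of_poly (\<Prod>\<alpha>\<in>#A. [:1, - \<alpha>:]) * Abs_fps (\<lambda>m. if m = 0 then 0 else - (\<Sum>\<alpha>\<in>#A. \<alpha> ^ m))"
proof (induction A)
  case empty
  have "Abs_fps (\<lambda>m. if m = 0 then 0 else - (\<Sum>\<alpha>\<in>#{#}. \<alpha> ^ m)) = (0 :: complex fps)" by (intro fps_ext) simp
  thus ?case by (simp only: mult_zero_right) simp
next
  case (add \<alpha> A)
  define F where "F = fps_of_poly (\<Prod>\<alpha>\<in>#A. [:1, - \<alpha>:])"
  define l where "l = 1 - fps_const \<alpha> * fps_X"
  define G where "G A = Abs_fps (\<lambda>m. if m = 0 then 0 else - (\<Sum>\<alpha>\<in>#A. \<alpha> ^ m))" for A :: "complex multiset"
  have IH: "fps_X * fps_deriv F = F * G A" using add by (simp add: F_def G_def)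
  have Gadd: "G (add_mset \<alpha> A) = G A + G {#\<alpha>#}" by (intro fps_ext) (simp add: G_def)
  have lG: "l * G {#\<alpha>#} = - (fps_const \<alpha> * fps_X)"
  proof (rule fps_ext)
    fix k show "fps_nth (l * G {#\<alpha>#}) k = fps_nth (- (fps_const \<alpha> * fps_X)) k"
      by (cases k) (auto simp: l_def G_def left_diff_distrib mult.assoc)
  qed
  have "fps_of_poly [:1, - \<alpha>:] = l" by (simp add: l_def fps_of_poly_pCons)
  hence FF: "fps_of_poly (\<Prod>\<alpha>\<in>#add_mset \<alpha> A. [:1, - \<alpha>:]) = l * F"
    unfolding image_mset_add_mset prod_mset.add_mset fps_of_poly_mult F_def by simp
  have dl: "fps_deriv l = - fps_const \<alpha>" by (simp add: l_def)
  have "fps_X * fps_deriv (l * F) = l * (fps_X * fps_deriv F) + fps_X * fps_deriv l * F"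
    by (simp add: algebra_simps)
  also have "fps_X * fps_deriv l = l * G {#\<alpha>#}" unfolding lG dl by (simp add: mult.commute)
  also have "l * (fps_X * fps_deriv F) + l * G {#\<alpha>#} * F = l * F * (G A + G {#\<alpha>#})"
    unfolding IH by (simp add: algebra_simps)
  finally have "fps_X * fps_deriv (l * F) = l * F * (G A + G {#\<alpha>#})" .
  thus ?case unfolding FF Gadd[symmetric] unfolding G_def .
qed

text \<open>The recursion says X * F' = F * G, with G the generating function of \<open>S\<close>.
  The product over reciprocal roots satisfies the same equation with minus the power sums, and F is
  cancelled.\<close>

lemma newton_imp_power_sums:
  fixes L S :: "nat \<Rightarrow> complex"
  assumes "L 0 = 1" "\<And>k. k \<ge> n \<Longrightarrow> L k = 0" "n \<ge> 1"
    and newton: "\<And>k. of_nat k * L k = (\<Sum>m=1..k. S m * L (k - m))"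
  shows "\<exists>A. size A \<le> n - 1 \<and> (\<forall>m\<ge>1. S m = - (\<Sum>\<alpha>\<in>#A. \<alpha> ^ m))"
proof -
  define f where "f = (\<Sum>k<n. monom (L k) k)"
  have cf: "coeff f k = L k" for k
    using assms(2) by (auto simp: f_def coeff_sum sum.delta not_less)
  have "degree f \<le> n - 1" using assms by (intro degree_le) (auto simp: cf)
  then obtain A where A: "size A \<le> n - 1" "f = (\<Prod>\<alpha>\<in>#A. [:1, - \<alpha>:])"
    using poly_reciprocal_roots[of f] assms(1) cf by metis
  define G where "G = Abs_fps (\<lambda>m. if m = 0 then 0 else S m)"
  have F0: "fps_of_poly f \<noteq> 0" using assms(1) cf by (metis fps_of_poly_nth fps_zero_nth zero_neq_one)
  have "fps_X * fps_deriv (fps_of_poly f) = fps_of_poly f * G"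
  proof (rule fps_ext)
    fix k
    have "fps_nth (G * fps_of_poly f) k = (\<Sum>m=0..k. (if m = 0 then 0 else S m) * L (k - m))"
      by (simp add: fps_mult_nth G_def cf)
    also have "\<dots> = (\<Sum>m=1..k. S m * L (k - m))"
      by (intro sum.mono_neutral_cong_right) auto
    also have "\<dots> = of_nat k * L k" using newton by simp
    also have "\<dots> = fps_nth (fps_X * fps_deriv (fps_of_poly f)) k" by (cases k) (simp_all add: cf)
    finally show "fps_nth (fps_X * fps_deriv (fps_of_poly f)) k = fps_nth (fps_of_poly f * G) k"
      by (simp add: mult.commute)
  qed
  also have "fps_X * fps_deriv (fps_of_poly f) = fps_of_poly f * Abs_fps (\<lambda>m. if m = 0 then 0 else - (\<Sum>\<alpha>\<in>#A. \<alpha> ^ m))"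
    using fps_newton_product[of A] A(2) by simp
  finally have "Abs_fps (\<lambda>m. if m = 0 then 0 else - (\<Sum>\<alpha>\<in>#A. \<alpha> ^ m)) = G" using F0 by simp
  hence "S m = - (\<Sum>\<alpha>\<in>#A. \<alpha> ^ m)" if "m \<ge> 1" for m
    using that by (auto simp: G_def fps_eq_iff dest!: spec[of _ m])
  thus ?thesis using A(1) by blast
qed

lemma sum_mset_image_count:
  fixes f :: "'x \<Rightarrow> 'y::comm_semiring_1"
  shows "(\<Sum>x\<in>#A. f x) = (\<Sum>x\<in>set_mset A. of_nat (count A x) * f x)"
proof (induction A)
  case (add a A)
  show ?case
  proof (cases "a \<in># A")
    case True
    hence "(\<Sum>x\<in>set_mset A. of_nat (count (add_mset a A) x) * f x) = (\<Sum>x\<in>set_mset A. of_nat (count A x) * f x + (if x = a then f x else 0))"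
      by (intro sum.cong) (auto simp: algebra_simps)
    thus ?thesis using add True by (simp add: insert_absorb sum.distrib sum.delta add.commute)
  next
    case False
    hence "(\<Sum>x\<in>set_mset A. of_nat (count (add_mset a A) x) * f x) = (\<Sum>x\<in>set_mset A. of_nat (count A x) * f x)"
      by (intro sum.cong) auto
    thus ?thesis using add False by (simp add: not_in_iff)
  qed
qed simp

text \<open>Powers of different roots could cancel in the sum. Weighting consecutive power sums by
  the coefficients of a polynomial f that vanishes at every root except b isolates the term count A
  b * f(b) * b ^ k, so (cmod b / R) ^ k stays bounded.\<close>

lemma power_sum_bound_imp_root_bound:
  fixes A :: "complex multiset" and R :: real
  assumes R: "R > 0" and bound: "\<And>k. k \<ge> K \<Longrightarrow> cmod (\<Sum>x\<in>#A. x ^ k) \<le> C * R ^ k" and b: "b \<in># A"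
  shows "cmod b \<le> R"
proof (rule ccontr)
  assume nb: "\<not> cmod b \<le> R"
  define f where "f = (\<Prod>a\<in>set_mset A - {b}. [:- a, 1:])"
  have f: "poly f x = (\<Prod>a\<in>set_mset A - {b}. x - a)" for x by (simp add: f_def poly_prod)
  have fb: "poly f b \<noteq> 0" by (simp add: f)
  define D where "D = (\<Sum>i\<le>degree f. cmod (coeff f i) * (C * R ^ i))"
  have main: "real (count A b) * cmod (poly f b) * cmod b ^ k \<le> D * R ^ k" if k: "k \<ge> K" for k
  proof -
    have "(\<Sum>i\<le>degree f. coeff f i * (\<Sum>x\<in>#A. x ^ (k + i))) = (\<Sum>x\<in>#A. x ^ k * poly f x)"
      by (induction A) (simp_all add: poly_altdef sum_distrib_left sum.distrib algebra_simps power_add)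
    also have "\<dots> = (\<Sum>x\<in>set_mset A. of_nat (count A x) * (x ^ k * poly f x))"
      by (simp add: sum_mset_image_count)
    also have "\<dots> = (\<Sum>x\<in>{b}. of_nat (count A x) * (x ^ k * poly f x))"
      using b by (intro sum.mono_neutral_right) (auto simp: f)
    finally have eq: "of_nat (count A b) * (b ^ k * poly f b) = (\<Sum>i\<le>degree f. coeff f i * (\<Sum>x\<in>#A. x ^ (k + i)))"
      by simp
    have "cmod (of_nat (count A b) * (b ^ k * poly f b)) \<le> (\<Sum>i\<le>degree f. cmod (coeff f i) * (C * R ^ (k + i)))"
      unfolding eq using bound k by (intro order.trans[OF norm_sum] sum_mono) (auto simp: norm_mult intro!: mult_left_mono)
    also have "\<dots> = D * R ^ k" unfolding D_def sum_distrib_right by (intro sum.cong) (simp_all add: power_add)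
    finally show ?thesis by (simp add: norm_mult norm_power mult_ac)
  qed
  define c where "c = real (count A b) * cmod (poly f b)"
  have c: "c > 0" using b fb by (simp add: c_def)
  have "(cmod b / R) ^ k \<le> D / c" if "k \<ge> K" for k
    using main[OF that] c R by (simp add: c_def[symmetric] field_simps power_divide)
  moreover have "1 < cmod b / R" using nb R by (simp add: field_simps)
  then obtain k1 where k1: "D / c < (cmod b / R) ^ k1" using real_arch_pow by blast
  moreover have "(cmod b / R) ^ k1 \<le> (cmod b / R) ^ (max K k1)"
    using \<open>1 < cmod b / R\<close> by (intro power_increasing) auto
  ultimately show False using max.cobounded1[of K k1] by (meson le_less_trans not_less)
qed

text \<open>The sums along multiples of N are minus the power sums of the \<alpha> ^ N. Each of
  these is bounded by R ^ N, hence each \<alpha> by R, and S 1 is minus the sum of at most n - 1 of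
  them.\<close>

theorem newton_bound:
  fixes L S :: "nat \<Rightarrow> complex" and R :: real
  assumes "L 0 = 1" "\<And>k. k \<ge> n \<Longrightarrow> L k = 0" "n \<ge> 1"
    and "\<And>k. of_nat k * L k = (\<Sum>m=1..k. S m * L (k - m))"
    and R: "R > 0" and N: "N > 0" and bound: "\<And>k. k \<ge> K \<Longrightarrow> cmod (S (N * k)) \<le> C * R ^ (N * k)"
  shows "cmod (S 1) \<le> real (n - 1) * R"
proof -
  obtain A where A: "size A \<le> n - 1" "\<And>m. m \<ge> 1 \<Longrightarrow> S m = - (\<Sum>\<alpha>\<in>#A. \<alpha> ^ m)"
    using newton_imp_power_sums[of L n S] assms by blast
  have "cmod \<alpha> \<le> R" if \<alpha>: "\<alpha> \<in># A" for \<alpha>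
  proof -
    have "cmod (\<alpha> ^ N) \<le> R ^ N"
    proof (rule power_sum_bound_imp_root_bound)
      show "R ^ N > 0" using R by simp
      show "\<alpha> ^ N \<in># image_mset (\<lambda>x. x ^ N) A" using \<alpha> by simp
      fix k assume k: "k \<ge> max 1 K"
      have "(\<Sum>x\<in>#image_mset (\<lambda>x. x ^ N) A. x ^ k) = - S (N * k)"
        using k N A(2)[of "N * k"] by (simp add: multiset.map_comp comp_def power_mult)
      thus "cmod (\<Sum>x\<in>#image_mset (\<lambda>x. x ^ N) A. x ^ k) \<le> C * (R ^ N) ^ k"
        using bound[of k] k by (simp add: power_mult)
    qed
    thus ?thesis using R N by (simp add: norm_power power_mono_iff)
  qed
  hence "cmod (\<Sum>\<alpha>\<in>#A. \<alpha>) \<le> real (size A) * R"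
  proof (induction A)
    case (add x A)
    have "cmod (x + (\<Sum>\<alpha>\<in>#A. \<alpha>)) \<le> cmod x + cmod (\<Sum>\<alpha>\<in>#A. \<alpha>)" by (rule norm_triangle_ineq)
    also have "\<dots> \<le> R + real (size A) * R" using add by (intro add_mono) auto
    finally show ?case by (simp add: algebra_simps)
  qed simp
  also have "\<dots> \<le> real (n - 1) * R" using A(1) R by (intro mult_right_mono) auto
  finally show ?thesis using A(2)[of 1] by simp
qed

section \<open>Katz's bound\<close>

lemma geometric_sum_nat:
  fixes q :: nat assumes "q > 0" shows "(\<Sum>i<n. q ^ i) * (q - 1) + 1 = q ^ n"
proof -
  obtain b where "q = Suc b" using assms gr0_implies_Suc by blast
  thus ?thesis by (induction n) (simp_all add: algebra_simps)
qed

context katz_setup begin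

text \<open>
  The norm form \<open>G n\<close> has a simple zero at \<open>\<theta>\<close>. The substitution \<open>c = \<theta> + 1 / z\<close> moves it to infinity:
  up to the \<open>r\<close>-th power \<open>z ^ r\<close>, which the \<open>r\<close>-th power residue symbol ignores, \<open>G n c\<close> becomes
  \<open>hpoly\<close>, whose degree \<open>r - 1\<close> is prime to \<open>r\<close>.
\<close>

definition r :: nat where "r = q ^ n - 1"
text \<open>The degree of the norm form \<open>G n c\<close> as a polynomial in c.\<close>

definition N :: nat where "N = (\<Sum>i<n. q ^ i)"
text \<open>Modulo \<open>M\<close>, \<theta> - c ^ (q ^ i) is the q ^ i-th power of \<theta> ^ (q ^
  (n - i)) - c; this is the value of the latter base at c = \<theta>.\<close>

definition \<delta> :: "nat \<Rightarrow> 'r" where "\<delta> i = \<theta> ^ (q ^ (n - i)) - \<theta>"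
text \<open>For c = \<theta> + 1 / z, the i-th factor of \<open>G n c\<close> is the q ^ i-th power
  of lfac i (z) / z. As \<open>\<delta> 0\<close> is congruent to 0, the factor for i = 0 is written
  as the constant -1; this accounts for the degree r - 1 in place of r.\<close>

definition lfac :: "nat \<Rightarrow> 'r poly" where "lfac i = (if i = 0 then [:-1:] else [:-1, \<delta> i:])"
definition hpoly :: "'r poly" where "hpoly = monom 1 (r - N) * (\<Prod>i<n. lfac i ^ (q ^ i))"
definition G :: "nat \<Rightarrow> 'r \<Rightarrow> 'r" where "G m c = (\<Prod>i<m. \<theta> - c ^ (q ^ i))"

lemma N_le_r: "N \<le> r" and N_pos: "N \<ge> 1"
proof -
  have "N * 1 \<le> N * (q - 1)" using q by (intro mult_left_mono) auto
  moreover have "N * (q - 1) + 1 = q ^ n" unfolding N_def using q by (intro geometric_sum_nat) simp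
  ultimately show "N \<le> r" unfolding r_def by linarith
  have "(\<Sum>i\<in>{0}. q ^ i) \<le> N" unfolding N_def using n by (intro sum_mono2) auto
  thus "N \<ge> 1" by simp
qed

lemma \<delta>_notin_M: "0 < i \<Longrightarrow> i < n \<Longrightarrow> \<delta> i \<notin> M"
  using \<theta>_degree[of "n - i"] by (simp add: \<delta>_def eqv_def)

lemma \<theta>_fixed_mult: "\<theta> ^ (q ^ (n * j)) \<approx> \<theta>"
proof (induction j)
  case (Suc j)
  have "\<theta> ^ (q ^ (n * Suc j)) = (\<theta> ^ (q ^ (n * j))) ^ (q ^ n)"
    by (simp add: power_add mult.commute flip: power_mult)
  also have "\<dots> \<approx> \<theta> ^ (q ^ n)" using Suc by (rule eqv_power)
  also note \<theta>_fixed
  finally show ?case .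
qed simp

lemma hpoly_degree: "degree hpoly \<le> r - 1 \<and> coeff hpoly (r - 1) \<notin> M"
proof -
  define w where "w i = (if i = 0 then 0 else q ^ i)" for i :: nat
  have *: "degree (\<Prod>i<k. lfac i ^ (q ^ i)) \<le> (\<Sum>i<k. w i) \<and>
      coeff (\<Prod>i<k. lfac i ^ (q ^ i)) (\<Sum>i<k. w i) \<notin> M" if "k \<le> n" for k
    using that
  proof (induction k)
    case 0 thus ?case using one_M by simp
  next
    case (Suc k)
    define f where "f = (\<Prod>i<k. lfac i ^ (q ^ i))"
    define d where "d = (\<Sum>i<k. w i)"
    have f: "degree f \<le> d" "coeff f d \<notin> M" using Suc by (auto simp: f_def d_def)
    have g: "degree (lfac k ^ (q ^ k)) \<le> w k \<and> coeff (lfac k ^ (q ^ k)) (w k) \<notin> M"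
    proof (cases "k = 0")
      case True
      thus ?thesis using one_M uminus_M[of "-1"] by (auto simp: w_def lfac_def)
    next
      case False
      have "degree (lfac k) \<le> 1" using False by (simp add: lfac_def)
      from coeff_power_bound[OF this, of "q ^ k"] show ?thesis
        using False \<delta>_notin_M[of k] Suc.prems power_M by (auto simp: w_def lfac_def)
    qed
    have "degree (f * lfac k ^ (q ^ k)) \<le> d + w k"
      using degree_mult_le[of f "lfac k ^ (q ^ k)"] f g by linarith
    moreover have "coeff (f * lfac k ^ (q ^ k)) (d + w k) \<notin> M"
      using coeff_mult_bound[OF f(1) conjunct1[OF g]] f g prime_M by auto
    ultimately show ?case by (simp add: f_def d_def)
  qed
  have sw: "(\<Sum>i<n. w i) = N - 1"
  proof -
    obtain k where k: "n = Suc k" using n by (cases n) auto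
    have "N = 1 + (\<Sum>i<k. q * q ^ i)" unfolding N_def unfolding k by (simp add: sum.lessThan_Suc_shift del: sum.lessThan_Suc)
    moreover have "(\<Sum>i<n. w i) = (\<Sum>i<k. q * q ^ i)"
      unfolding k by (simp add: w_def sum.lessThan_Suc_shift del: sum.lessThan_Suc)
    ultimately show ?thesis by simp
  qed
  have r1: "r - 1 = (r - N) + (N - 1)" using N_le_r N_pos by linarith
  have m: "degree (monom (1::'r) (r - N)) \<le> r - N" by (rule degree_monom_le)
  have p: "degree (\<Prod>i<n. lfac i ^ (q ^ i)) \<le> N - 1" "coeff (\<Prod>i<n. lfac i ^ (q ^ i)) (N - 1) \<notin> M"
    using *[of n] sw by auto
  have "degree hpoly \<le> (r - N) + (N - 1)"
    unfolding hpoly_def using degree_mult_le m p(1) by (meson add_mono order.trans)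
  moreover have "coeff hpoly ((r - N) + (N - 1)) \<notin> M"
    unfolding hpoly_def coeff_mult_bound[OF m p(1)] using p(2) by simp
  ultimately show ?thesis unfolding r1 by blast
qed

lemma hpoly_fixed: "coeff hpoly i ^ (q ^ (n * j)) \<approx> coeff hpoly i"
proof -
  define Q where "Q = q ^ (n * j)"
  have Q: "ppow Q" unfolding Q_def by (rule ppow_qk)
  have m1: "(-1) ^ Q \<approx> (-1::'r)" using frob_diff[OF Q, of 0 1] ppow_pos[OF Q] by (simp add: zero_power)
  have "\<delta> i ^ Q \<approx> \<delta> i" for i
  proof -
    have "\<delta> i ^ Q \<approx> (\<theta> ^ (q ^ (n - i))) ^ Q - \<theta> ^ Q" unfolding \<delta>_def by (rule frob_diff[OF Q])
    also have "(\<theta> ^ (q ^ (n - i))) ^ Q = (\<theta> ^ Q) ^ (q ^ (n - i))" by (simp add: mult.commute flip: power_mult)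
    also have "\<dots> - \<theta> ^ Q \<approx> \<theta> ^ (q ^ (n - i)) - \<theta>"
      unfolding Q_def by (intro eqv_diff eqv_power \<theta>_fixed_mult)
    finally show ?thesis by (simp add: \<delta>_def)
  qed
  hence l: "coeff (lfac k) i ^ Q \<approx> coeff (lfac k) i" for k i
    using m1 ppow_pos[OF Q] by (auto simp: lfac_def coeff_pCons zero_power split: nat.splits)
  have "coeff (\<Prod>i<k. lfac i ^ (q ^ i)) i ^ Q \<approx> coeff (\<Prod>i<k. lfac i ^ (q ^ i)) i" for k i
  proof (induction k arbitrary: i)
    case 0 thus ?case using ppow_pos[OF Q] by (cases i) (auto simp: zero_power)
  next
    case (Suc k)
    show ?case unfolding prod.lessThan_Suc by (rule coeff_fixed_mult[OF Q Suc coeff_fixed_power[OF Q l]])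
  qed
  thus ?thesis unfolding hpoly_def Q_def[symmetric]
    by (intro coeff_fixed_mult[OF Q]) (use ppow_pos[OF Q] in \<open>auto simp: zero_power\<close>)
qed

text \<open>After n * j applications of Frobenius \<theta> has returned to itself, so the factors
  from there on are q ^ (n * j)-th powers of the first k.\<close>

lemma G_add: "G (n * j + k) c \<approx> G (n * j) c * G k c ^ (q ^ (n * j))"
proof -
  have "(\<Prod>i<k. \<theta> - c ^ (q ^ (n * j + i))) \<approx> (\<Prod>i<k. (\<theta> - c ^ (q ^ i)) ^ (q ^ (n * j)))"
  proof (rule eqv_prod)
    fix i
    have "(\<theta> - c ^ (q ^ i)) ^ (q ^ (n * j)) \<approx> \<theta> ^ (q ^ (n * j)) - (c ^ (q ^ i)) ^ (q ^ (n * j))"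
      by (rule frob_diff[OF ppow_qk])
    also have "\<dots> \<approx> \<theta> - c ^ (q ^ (n * j + i))"
      by (intro eqv_diff \<theta>_fixed_mult) (simp add: power_add mult.commute flip: power_mult)
    finally show "\<theta> - c ^ (q ^ (n * j + i)) \<approx> (\<theta> - c ^ (q ^ i)) ^ (q ^ (n * j))" by (rule eqv_sym)
  qed
  hence "G (n * j) c * (\<Prod>i<k. \<theta> - c ^ (q ^ (n * j + i))) \<approx> G (n * j) c * G k c ^ (q ^ (n * j))"
    by (intro eqv_mult eqv_refl) (simp add: G_def prod_power_distrib)
  moreover have "G (n * j + k) c = G (n * j) c * (\<Prod>i<k. \<theta> - c ^ (q ^ (n * j + i)))"
    unfolding G_def by (induction k) (simp_all add: mult.assoc)
  ultimately show ?thesis by simp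
qed

text \<open>The exponent is (q ^ (n * j) - 1) / (q ^ n - 1): for c in the field with q ^ (n * j)
  elements the power is the norm of \<open>G n c\<close> to the field with q ^ n elements, which
  turns \<open>S (n * j)\<close> into a Kummer sum.\<close>

lemma G_mult: "G (n * j) c \<approx> G n c ^ (\<Sum>i<j. q ^ (n * i))"
proof (induction j)
  case (Suc j)
  have "G (n * Suc j) c = G (n * j + n) c" by (simp add: add.commute)
  also have "\<dots> \<approx> G (n * j) c * G n c ^ (q ^ (n * j))" by (rule G_add)
  also have "\<dots> \<approx> G n c ^ (\<Sum>i<j. q ^ (n * i)) * G n c ^ (q ^ (n * j))" using Suc by (intro eqv_mult) auto
  finally show ?case by (simp add: power_add)
qed (simp add: G_def)

lemma hpoly_eval:
  assumes z: "(c - \<theta>) * z \<approx> 1"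
  shows "poly hpoly z \<approx> z ^ r * G n c"
proof -
  have fac: "poly (lfac i) z ^ (q ^ i) \<approx> (\<theta> - c ^ (q ^ i)) * z ^ (q ^ i)" if i: "i < n" for i
  proof -
    have "poly (lfac i) z \<approx> (\<theta> ^ (q ^ (n - i)) - c) * z"
    proof (cases "i = 0")
      case True
      have "(\<theta> ^ (q ^ n) - c) * z \<approx> (\<theta> - c) * z" by (intro eqv_mult eqv_diff \<theta>_fixed eqv_refl)
      also have "\<dots> = - ((c - \<theta>) * z)" by (simp add: algebra_simps)
      also have "\<dots> \<approx> -1" using z by (rule eqv_uminus)
      finally have "(\<theta> ^ (q ^ n) - c) * z \<approx> -1" .
      thus ?thesis using True by (simp add: lfac_def eqv_sym)
    next
      case False
      have "poly (lfac i) z = \<delta> i * z - 1" using False by (simp add: lfac_def mult.commute)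
      also have "\<dots> \<approx> \<delta> i * z - (c - \<theta>) * z" by (intro eqv_diff eqv_refl eqv_sym[OF z])
      also have "\<dots> = (\<theta> ^ (q ^ (n - i)) - c) * z" by (simp add: \<delta>_def algebra_simps)
      finally show ?thesis .
    qed
    hence "poly (lfac i) z ^ (q ^ i) \<approx> ((\<theta> ^ (q ^ (n - i)) - c) * z) ^ (q ^ i)" by (rule eqv_power)
    also have "\<dots> = (\<theta> ^ (q ^ (n - i)) - c) ^ (q ^ i) * z ^ (q ^ i)" by (rule power_mult_distrib)
    also have "\<dots> \<approx> ((\<theta> ^ (q ^ (n - i))) ^ (q ^ i) - c ^ (q ^ i)) * z ^ (q ^ i)"
      by (intro eqv_mult eqv_refl frob_diff ppow_qk)
    also have "(\<theta> ^ (q ^ (n - i))) ^ (q ^ i) = \<theta> ^ (q ^ n)"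
      using i by (simp flip: power_mult power_add)
    also have "(\<theta> ^ (q ^ n) - c ^ (q ^ i)) * z ^ (q ^ i) \<approx> (\<theta> - c ^ (q ^ i)) * z ^ (q ^ i)"
      by (intro eqv_mult eqv_diff \<theta>_fixed eqv_refl)
    finally show ?thesis .
  qed
  have "poly hpoly z = z ^ (r - N) * (\<Prod>i<n. poly (lfac i) z ^ (q ^ i))"
    by (simp add: hpoly_def poly_monom poly_prod)
  also have "\<dots> \<approx> z ^ (r - N) * (\<Prod>i<n. (\<theta> - c ^ (q ^ i)) * z ^ (q ^ i))"
    by (intro eqv_mult eqv_refl eqv_prod fac) auto
  also have "\<dots> = z ^ (r - N) * z ^ N * G n c"
    by (simp add: prod.distrib G_def N_def power_sum mult_ac)
  also have "\<dots> = z ^ r * G n c" using N_le_r by (simp flip: power_add)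
  finally show ?thesis .
qed

lemma fixed_inverse:
  assumes Q: "Q \<ge> 2" and x: "x ^ Q \<approx> x" "x \<notin> M"
  shows "x * x ^ (Q - 2) \<approx> 1" "x ^ (Q - 1) \<approx> 1"
proof -
  have Q1: "Q = Suc (Suc (Q - 2))" "Q - 1 = Suc (Q - 2)" using Q by simp_all
  have "x * x ^ (Q - 1) = x ^ Q" using Q1 by (metis power_Suc)
  hence "x * x ^ (Q - 1) \<approx> x * 1" using x(1) by simp
  thus "x ^ (Q - 1) \<approx> 1" by (rule eqv_cancel[OF x(2)])
  thus "x * x ^ (Q - 2) \<approx> 1" using Q1(2) by simp
qed

text \<open>The map sending c to 1 / (c - \<theta>) injects the fibre into the set counted by
  \<open>stepanov\<close> for \<open>hpoly\<close>: the extra factor z ^ r becomes z ^ (Q - 1) = 1.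
  The point c = \<theta> is no obstacle, since the norm form vanishes there and a does not.\<close>

lemma fiber_bound:
  assumes n2: "n \<ge> 2" and a: "a \<in> T (q ^ n)" "a \<notin> M"
    and e: "q ^ (n * k) = r * e + 1" and P: "P = q ^ (n * k)" and e2: "e \<ge> r ^ 2"
  shows "card {c \<in> T (q ^ (2 * n * k)). G (2 * n * k) c \<approx> a} \<le> (e + 2 * r + 1) * P"
proof -
  define Q where "Q = P * P"
  have r2: "r \<ge> 2"
  proof -
    have "(2::nat) ^ 2 \<le> q ^ n" using q n2 by (intro order.trans[OF power_mono power_increasing]) auto
    thus ?thesis by (simp add: r_def)
  qed
  have PQ: "Q = q ^ (n * (2 * k))" unfolding Q_def P power_add[symmetric] by (rule arg_cong[of _ _ "\<lambda>x. q ^ x"]) simp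
  have Pp: "ppow P" "P = r * e + 1" unfolding P by (rule ppow_qk) (rule e)
  have Qp: "ppow Q" unfolding PQ by (rule ppow_qk)
  have e0: "e > 0" using e2 r2 by (metis gr0I le_zero_eq not_numeral_le_zero power_eq_0_iff)
  have "r * e > 0" using r2 e0 by simp
  hence "P \<ge> 2" using Pp(2) by linarith
  hence "1 * 2 \<le> P * P" by (intro mult_le_mono) auto
  hence Q2: "Q \<ge> 2" by (simp add: Q_def)
  \<comment> \<open>Both sides are (Q - 1) / r.\<close>
  have expo: "(\<Sum>i<2 * k. q ^ (n * i)) = e * (P + 1)"
  proof -
    have "(\<Sum>i<2 * k. (q ^ n) ^ i) * (q ^ n - 1) = Q - 1"
      using geometric_sum_nat[of "q ^ n" "2 * k"] q by (simp add: PQ power_mult)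
    also have "\<dots> = e * (P + 1) * r" by (simp add: Q_def Pp(2) algebra_simps)
    finally have "(\<Sum>i<2 * k. (q ^ n) ^ i) * r = e * (P + 1) * r" unfolding r_def .
    moreover have "r \<noteq> 0" using r2 by simp
    ultimately have "(\<Sum>i<2 * k. (q ^ n) ^ i) = e * (P + 1)" using mult_right_cancel by blast
    thus ?thesis by (simp add: power_mult)
  qed
  define C where "C = {c \<in> T Q. G (2 * n * k) c \<approx> a}"
  define Z where "Z = {z \<in> T Q. poly hpoly z \<notin> M \<and> poly hpoly z ^ (e * (P + 1)) \<approx> a}"
  \<comment> \<open>The inverse of c - \<theta> in the field with \<open>Q\<close> elements, written
    as a power.\<close>
  define \<psi> where "\<psi> c = rep ((c - \<theta>) ^ (Q - 2))" for c
  have T: "finite (T Q)" using T_finite_card[OF Qp] Q2 by auto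
  have \<theta>Q: "\<theta> ^ Q \<approx> \<theta>" unfolding PQ by (rule \<theta>_fixed_mult)
  have Gc: "G (2 * n * k) c \<approx> G n c ^ (e * (P + 1))" for c
    using G_mult[of "2 * k" c] expo by (simp add: mult_ac)
  have C: "(c - \<theta>) ^ Q \<approx> c - \<theta>" "c - \<theta> \<notin> M" if c: "c \<in> C" for c
  proof -
    have "(c - \<theta>) ^ Q \<approx> c ^ Q - \<theta> ^ Q" by (rule frob_diff[OF Qp])
    also have "\<dots> \<approx> c - \<theta>" using c by (intro eqv_diff \<theta>Q T_power) (auto simp: C_def)
    finally show "(c - \<theta>) ^ Q \<approx> c - \<theta>" .
    show "c - \<theta> \<notin> M"
    proof
      assume "c - \<theta> \<in> M"
      hence "\<theta> - c ^ (q ^ 0) \<in> M" using uminus_M[of "c - \<theta>"] by simp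
      hence "G n c \<in> M" unfolding G_def using n by (subst prod_M) (auto intro!: bexI[of _ 0])
      hence "G n c ^ (e * (P + 1)) \<in> M" using e0 by (cases "e * (P + 1)") (auto simp: mult_M2)
      thus False using c a(2) eqv_M[OF Gc[of c]] eqv_M[of "G (2 * n * k) c" a] by (simp add: C_def)
    qed
  qed
  have inv: "(c - \<theta>) * \<psi> c \<approx> 1" if c: "c \<in> C" for c
  proof -
    have "(c - \<theta>) * \<psi> c \<approx> (c - \<theta>) * (c - \<theta>) ^ (Q - 2)" unfolding \<psi>_def by (intro eqv_mult eqv_refl rep_eqv)
    also have "\<dots> \<approx> 1" by (rule fixed_inverse[OF Q2 C[OF c]])
    finally show ?thesis .
  qed
  have inj: "inj_on \<psi> C"
  proof (rule inj_onI)
    fix c d assume cd: "c \<in> C" "d \<in> C" "\<psi> c = \<psi> d"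
    have "\<psi> c \<notin> M"
    proof
      assume "\<psi> c \<in> M"
      hence "(c - \<theta>) * \<psi> c \<in> M" by (rule mult_M)
      thus False using inv[OF cd(1)] eqv_M one_M by blast
    qed
    moreover have "\<psi> c * (c - \<theta>) \<approx> \<psi> c * (d - \<theta>)"
      using eqv_trans[OF inv[OF cd(1)] eqv_sym[OF inv[OF cd(2)]]] cd(3) by (simp add: mult.commute)
    ultimately have "c - \<theta> \<approx> d - \<theta>" by (rule eqv_cancel)
    hence "c \<approx> d" by (simp add: eqv_def)
    thus "c = d" using cd T_eqI by (auto simp: C_def)
  qed
  have sub: "\<psi> ` C \<subseteq> Z"
  proof
    fix z assume "z \<in> \<psi> ` C"
    then obtain c where c: "c \<in> C" "z = \<psi> c" by auto
    have "((c - \<theta>) ^ (Q - 2)) ^ Q = ((c - \<theta>) ^ Q) ^ (Q - 2)" by (simp add: mult.commute flip: power_mult)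
    also have "\<dots> \<approx> (c - \<theta>) ^ (Q - 2)" by (rule eqv_power[OF C(1)[OF c(1)]])
    finally have zT: "z \<in> T Q" unfolding c(2) \<psi>_def by (rule T_rep)
    have zM: "z \<notin> M"
    proof
      assume "z \<in> M"
      hence "(c - \<theta>) * z \<in> M" by (rule mult_M)
      thus False using inv[OF c(1)] c(2) eqv_M one_M by blast
    qed
    have rQ: "r * (e * (P + 1)) = Q - 1" by (simp add: Q_def Pp(2) algebra_simps)
    have "poly hpoly z ^ (e * (P + 1)) \<approx> (z ^ r * G n c) ^ (e * (P + 1))"
      using hpoly_eval[of c z] inv[OF c(1)] c(2) by (intro eqv_power) simp
    also have "\<dots> = z ^ (Q - 1) * G n c ^ (e * (P + 1))"
      unfolding power_mult_distrib power_mult[symmetric] rQ ..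
    also have "\<dots> \<approx> 1 * G (2 * n * k) c"
      by (intro eqv_mult eqv_sym[OF Gc] fixed_inverse(2)[OF Q2 T_power[OF zT] zM])
    also have "\<dots> \<approx> a" using c(1) by (simp add: C_def)
    finally have 1: "poly hpoly z ^ (e * (P + 1)) \<approx> a" .
    have "poly hpoly z \<notin> M"
    proof
      assume "poly hpoly z \<in> M"
      hence "poly hpoly z ^ (e * (P + 1)) \<in> M" using e0 by (cases "e * (P + 1)") (auto simp: mult_M2)
      thus False using 1 a(2) eqv_M by blast
    qed
    thus "z \<in> Z" using 1 zT by (simp add: Z_def)
  qed
  have "card C \<le> card Z" using T inj sub by (intro card_inj_on_le[of \<psi>]) (auto simp: Z_def)
  also have "card Z \<le> (e + 2 * r + 1) * P"
    unfolding Z_def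
  proof (rule stepanov[OF r2 e2 Pp Q_def])
    show "degree hpoly \<le> r - 1" "coeff hpoly (r - 1) \<notin> M" using hpoly_degree by auto
    show "coeff hpoly i ^ Q \<approx> coeff hpoly i" for i unfolding PQ by (rule hpoly_fixed)
    have "a ^ (q ^ (n * j)) \<approx> a" for j
    proof (induction j)
      case (Suc j)
      have "a ^ (q ^ (n * Suc j)) = (a ^ (q ^ (n * j))) ^ (q ^ n)"
        by (simp add: power_add mult.commute flip: power_mult)
      also have "\<dots> \<approx> a ^ (q ^ n)" using Suc by (rule eqv_power)
      also note T_power[OF a(1)]
      finally show ?case .
    qed simp
    thus "a ^ Q \<approx> a" unfolding PQ .
  qed
  finally show ?thesis by (simp add: C_def PQ mult_ac)
qed

section \<open>Character sums over the extensions of degree 2 * n * k\<close>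

lemma card_G_zero:
  assumes m: "m = n * (2 * k)" "k > 0"
  shows "card {c \<in> T (q ^ m). G m c \<in> M} \<le> n"
proof -
  have "\<exists>i<n. c = rep (\<theta> ^ (q ^ (n - i)))" if c: "c \<in> T (q ^ m)" "G m c \<in> M" for c
  proof -
    have "G n c \<in> M" using eqv_M[OF G_mult[of "2 * k" c]] c(2) power_M by (simp add: m)
    then obtain i where i: "i < n" "\<theta> - c ^ (q ^ i) \<in> M" by (auto simp: G_def prod_M)
    have "(\<theta> ^ (q ^ (n - i))) ^ (q ^ i) = \<theta> ^ (q ^ n)" using i by (simp flip: power_mult power_add)
    also have "\<dots> \<approx> \<theta>" by (rule \<theta>_fixed)
    also have "\<theta> \<approx> c ^ (q ^ i)" using i(2) by (simp add: eqv_def)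
    finally have "c \<approx> \<theta> ^ (q ^ (n - i))" using frob_inj[OF ppow_qk] eqv_sym by blast
    hence "rep c = rep (\<theta> ^ (q ^ (n - i)))" by (simp add: rep_eq_iff)
    thus ?thesis using i(1) rep_rep[OF T_range[OF c(1)]] by auto
  qed
  hence "{c \<in> T (q ^ m). G m c \<in> M} \<subseteq> (\<lambda>i. rep (\<theta> ^ (q ^ (n - i)))) ` {..<n}" by auto
  hence "card {c \<in> T (q ^ m). G m c \<in> M} \<le> card ((\<lambda>i. rep (\<theta> ^ (q ^ (n - i)))) ` {..<n})"
    by (intro card_mono) auto
  also have "\<dots> \<le> n" using card_image_le[of "{..<n}"] by fastforce
  finally show ?thesis .
qed

lemma G_fixed:
  assumes "c \<in> T (q ^ m)" shows "G m c ^ (q ^ n) \<approx> G m c"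
proof -
  define A where "A = orbit_mset \<phi> m c"
  have "image_mset \<phi> A = A"
    unfolding A_def using assms \<phi>_funpow_fixed[of c m] T_range by (intro orbit_mset_stable) auto
  hence "(\<Prod>c\<in>#A. \<theta> - c) ^ (q ^ n) \<approx> (\<Prod>c\<in>#A. \<theta> - c)" by (rule wt_fixed)
  moreover have "(\<Prod>c\<in>#A. \<theta> - c) \<approx> G m c"
    unfolding A_def orbit_mset_def multiset.map_comp comp_def G_def
    by (auto simp flip: prod_unfold_prod_mset intro!: eqv_prod eqv_diff \<phi>_funpow_eqv)
  ultimately show ?thesis using eqv_power eqv_sym eqv_trans by meson
qed

lemma S_bound:
  assumes n2: "n \<ge> 2" and k: "k \<ge> r ^ 2"
  shows "cmod (S (2 * n * k)) \<le> (2 * real r * (2 * real r + 1) + real n) * real (q ^ (n * k))"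
proof -
  define m where "m = 2 * n * k"
  define P where "P = q ^ (n * k)"
  define E where "E = T (q ^ n) - M"
  define e where "e = (\<Sum>i<k. (q ^ n) ^ i)"
  have r0: "r > 0" using qk_gt_1[of n] n by (simp add: r_def)
  have k0: "k > 0" using k r0 by (metis gr0I le_zero_eq power_eq_0_iff less_irrefl)
  have e: "P = r * e + 1"
    using geometric_sum_nat[of "q ^ n" k] q by (simp add: e_def P_def r_def mult.commute[of "q ^ n - Suc 0"] power_mult)
  \<comment> \<open>\<open>k \<ge> r ^ 2\<close> serves to give \<open>e\<close> the size that
    Stepanov's bound demands.\<close>
  have "(\<Sum>i<k. 1) \<le> e" unfolding e_def using q by (intro sum_mono) (simp add: Suc_leI)
  hence e2: "e \<ge> r ^ 2" using k by simp
  have Q: "q ^ m = P * P" unfolding m_def P_def power_add[symmetric] by (rule arg_cong[of _ _ "\<lambda>x. q ^ x"]) simp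
  have finT: "finite (T (q ^ m))" "card (T (q ^ m)) = P * P" using T_qk[of m] k0 n Q by (auto simp: m_def)
  have finE: "finite E" using T_qk(1)[of n] n by (simp add: E_def)
  have cE: "card E = r"
  proof -
    have "T (q ^ n) \<inter> M = {rep 0}"
    proof
      show "T (q ^ n) \<inter> M \<subseteq> {rep 0}"
      proof
        fix x assume x: "x \<in> T (q ^ n) \<inter> M"
        hence "rep x = rep 0" by (simp add: rep_eq_iff eqv_0)
        thus "x \<in> {rep 0}" using x rep_rep[OF T_range[of x "q ^ n"]] by simp
      qed
      have "(0::'r) ^ (q ^ n) = 0" using q by (simp add: zero_power)
      hence "rep 0 \<in> T (q ^ n)" by (intro T_rep) simp
      thus "{rep 0} \<subseteq> T (q ^ n) \<inter> M" using rep_eqv[of 0] by (simp add: eqv_0)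
    qed
    thus ?thesis using T_qk[of n] n by (simp add: E_def card_Diff_subset_Int r_def)
  qed
  have sumE: "(\<Sum>a\<in>E. \<chi> a) = 0"
  proof -
    have "\<chi> a = 0" if "a \<in> M" for a using \<chi>_cong[of a 0] \<chi>_0 that by (simp add: eqv_0)
    hence "(\<Sum>a\<in>E. \<chi> a) = (\<Sum>a\<in>T (q ^ n). \<chi> a)"
      using T_qk[of n] n by (intro sum.mono_neutral_left) (auto simp: E_def)
    thus ?thesis using \<chi>_sum by simp
  qed
  define F where "F a = {c \<in> T (q ^ m). G m c \<approx> a}" for a
  define Z where "Z = {c \<in> T (q ^ m). G m c \<in> M}"
  have Feq: "F a = {c \<in> T (q ^ m) - Z. rep (G m c) = a}" if "a \<in> E" for a
  proof -
    have "G m c \<approx> a \<longleftrightarrow> rep (G m c) = a" for c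
      using that rep_rep[of a] T_range[of a] rep_eq_iff[of "G m c" a] by (auto simp: E_def)
    moreover have "G m c \<notin> M" if "rep (G m c) = a" for c
      using that \<open>a \<in> E\<close> eqv_M[OF rep_eqv[of "G m c"]] by (auto simp: E_def)
    ultimately show ?thesis by (auto simp: F_def Z_def)
  qed
  have img: "(\<lambda>c. rep (G m c)) ` (T (q ^ m) - Z) \<subseteq> E"
    using G_fixed eqv_M[OF rep_eqv] by (auto simp: E_def Z_def intro!: T_rep)
  have fin: "finite (T (q ^ m) - Z)" using finT by simp
  have cardF: "(\<Sum>a\<in>E. card (F a)) = P * P - card Z"
  proof -
    have "(\<Sum>a\<in>E. card (F a)) = (\<Sum>a\<in>E. \<Sum>c\<in>{c \<in> T (q ^ m) - Z. rep (G m c) = a}. 1)"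
      using Feq by (intro sum.cong) auto
    also have "\<dots> = (\<Sum>c\<in>T (q ^ m) - Z. 1)" by (rule sum.group[OF fin finE img])
    also have "\<dots> = P * P - card Z" using finT by (simp add: card_Diff_subset Z_def)
    finally show ?thesis .
  qed
  have cardZ: "card Z \<le> n" unfolding Z_def using k0 by (intro card_G_zero[of m k]) (auto simp: m_def)
  have cardZ2: "card Z \<le> P * P" using finT card_mono[of "T (q ^ m)" Z] by (auto simp: Z_def)
  have Fb: "card (F a) \<le> (e + 2 * r + 1) * P" if "a \<in> E" for a
    unfolding F_def m_def using that e e2 by (intro fiber_bound[OF n2]) (auto simp: E_def P_def)
  have "S m = (\<Sum>c\<in>T (q ^ m). \<chi> (G m c))" by (simp add: S_def G_def)
  also have "\<dots> = (\<Sum>c\<in>T (q ^ m) - Z. \<chi> (rep (G m c)))"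
  proof (rule sum.mono_neutral_cong_right)
    show "\<forall>c\<in>T (q ^ m) - (T (q ^ m) - Z). \<chi> (G m c) = 0"
      using \<chi>_cong[of _ 0] \<chi>_0 by (auto simp: Z_def eqv_0)
    show "\<chi> (G m c) = \<chi> (rep (G m c))" for c by (rule \<chi>_cong[OF eqv_sym[OF rep_eqv]])
  qed (use finT in auto)
  also have "\<dots> = (\<Sum>a\<in>E. \<Sum>c\<in>{c \<in> T (q ^ m) - Z. rep (G m c) = a}. \<chi> (rep (G m c)))"
    by (rule sum.group[OF fin finE img, symmetric])
  also have "\<dots> = (\<Sum>a\<in>E. of_nat (card (F a)) * \<chi> a)"
    using Feq by (intro sum.cong) auto
  \<comment> \<open>The values of \<chi> on \<open>E\<close> sum to 0, so the mean fibre size may be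
    subtracted throughout.\<close>
  also have "\<dots> = (\<Sum>a\<in>E. (of_nat (card (F a)) - of_real (real (P * P) / real r)) * \<chi> a)"
  proof -
    have "(\<Sum>a\<in>E. (f a - d) * \<chi> a) = (\<Sum>a\<in>E. f a * \<chi> a)" for f d
      using sumE by (simp add: left_diff_distrib sum_subtractf flip: sum_distrib_left)
    thus ?thesis by simp
  qed
  finally have "cmod (S m) \<le> (\<Sum>a\<in>E. \<bar>real (card (F a)) - real (P * P) / real r\<bar>)"
  proof -
    assume eq: "S m = (\<Sum>a\<in>E. (of_nat (card (F a)) - of_real (real (P * P) / real r)) * \<chi> a)"
    have "cmod (S m) \<le> (\<Sum>a\<in>E. cmod ((of_nat (card (F a)) - of_real (real (P * P) / real r)) * \<chi> a))"
      unfolding eq by (rule norm_sum)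
    also have "\<dots> = (\<Sum>a\<in>E. \<bar>real (card (F a)) - real (P * P) / real r\<bar>)"
    proof (intro sum.cong refl)
      fix a assume "a \<in> E"
      hence "cmod (\<chi> a) = 1" by (intro \<chi>_norm T_power) (auto simp: E_def)
      moreover have "of_nat (card (F a)) - complex_of_real (real (P * P) / real r) = of_real (real (card (F a)) - real (P * P) / real r)"
        by simp
      ultimately show "cmod ((of_nat (card (F a)) - of_real (real (P * P) / real r)) * \<chi> a) = \<bar>real (card (F a)) - real (P * P) / real r\<bar>"
        by (metis norm_mult norm_of_real mult_1_right)
    qed
    finally show ?thesis .
  qed
  \<comment> \<open>One-sided bounds suffice: if x \<le> b and b \<ge> 0, then \<bar>x\<bar> \<le> 2
    * b - x, and the deviations x sum to minus the number of zeros of the norm form.\<close>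
  also have "\<dots> \<le> (\<Sum>a\<in>E. 2 * ((2 * real r + 1) * real P) - (real (card (F a)) - real (P * P) / real r))"
  proof (rule sum_mono)
    fix a assume a: "a \<in> E"
    have "real e * real P \<le> real (P * P) / real r"
      using r0 e by (simp add: field_simps)
    moreover have "real (card (F a)) \<le> real ((e + 2 * r + 1) * P)" using Fb[OF a] by (rule of_nat_mono)
    hence "real (card (F a)) \<le> real e * real P + (2 * real r + 1) * real P" by (simp add: algebra_simps)
    ultimately have "real (card (F a)) - real (P * P) / real r \<le> (2 * real r + 1) * real P" by linarith
    moreover have "(2 * real r + 1) * real P \<ge> 0" by simp
    ultimately show "\<bar>real (card (F a)) - real (P * P) / real r\<bar> \<le> 2 * ((2 * real r + 1) * real P) - (real (card (F a)) - real (P * P) / real r)"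
      by linarith
  qed
  also have "\<dots> = 2 * real r * ((2 * real r + 1) * real P) - (real (\<Sum>a\<in>E. card (F a)) - real (P * P))"
    using r0 by (simp add: sum_subtractf cE)
  also have "\<dots> = 2 * real r * ((2 * real r + 1) * real P) + real (card Z)"
    unfolding cardF using cardZ2 by (simp add: of_nat_diff)
  also have "\<dots> \<le> 2 * real r * ((2 * real r + 1) * real P) + real n * real P"
  proof -
    have "real (card Z) \<le> real n * 1" using cardZ by simp
    also have "\<dots> \<le> real n * real P" using e by (intro mult_left_mono) auto
    finally show ?thesis by simp
  qed
  finally show ?thesis by (simp add: m_def P_def algebra_simps)
qed

text \<open>The sum is \<open>S 1\<close>. In degree m = 2 * n * k, \<open>S_bound\<close> is a
  constant times q ^ (n * k) = sqrt q ^ m, so the reciprocal roots have modulus at most sqrt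
  q.\<close>

theorem katz_bound:
  assumes n2: "n \<ge> 2"
  shows "cmod (\<Sum>c\<in>T q. \<chi> (\<theta> - c)) \<le> real (n - 1) * sqrt (real q)"
proof -
  have "cmod (S 1) \<le> real (n - 1) * sqrt (real q)"
  proof (rule newton_bound[where L = Lcoeff and n = n and N = "2 * n" and K = "r ^ 2"
        and C = "2 * real r * (2 * real r + 1) + real n"])
    show "cmod (S (2 * n * k)) \<le> (2 * real r * (2 * real r + 1) + real n) * sqrt (real q) ^ (2 * n * k)" if "k \<ge> r ^ 2" for k
      using S_bound[OF n2 that] q by (simp add: power_mult mult.assoc)
  qed (use Lcoeff_0 Lcoeff_eq_0 n newton_identity q in auto)
  thus ?thesis by (simp add: S_def)
qed

end

section \<open>Finite fields as residue rings\<close>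

lemma poly_mapping_add_induct [case_names zero add]:
  fixes f :: "'x \<Rightarrow>\<^sub>0 'y::ab_group_add"
  assumes "P 0" "\<And>f k a. P f \<Longrightarrow> P (Poly_Mapping.single k a + f)"
  shows "P f"
proof -
  have "P (\<Sum>k\<in>A. Poly_Mapping.single k (g k))" if "finite A" for A and g :: "'x \<Rightarrow> 'y"
    using that by induction (auto intro: assms)
  moreover have "f = (\<Sum>k\<in>Poly_Mapping.keys f. Poly_Mapping.single k (Poly_Mapping.lookup f k))"
  proof (rule poly_mapping_eqI)
    fix l
    have "(\<Sum>k\<in>Poly_Mapping.keys f. (Poly_Mapping.lookup f k when k = l)) = Poly_Mapping.lookup f l"
      by (auto simp: when_def sum.delta in_keys_iff)
    thus "Poly_Mapping.lookup f l = Poly_Mapping.lookup (\<Sum>k\<in>Poly_Mapping.keys f. Poly_Mapping.single k (Poly_Mapping.lookup f k)) l"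
      by (simp add: lookup_sum lookup_single)
  qed
  ultimately show ?thesis by (metis finite_keys)
qed

text \<open>Integer polynomials with a variable for each element of the type: monomials are
  multisets, and adding multisets multiplies monomials. This is a commutative ring on a whole type,
  whichever field is to be represented.\<close>

type_synonym 'l free_ring = "'l multiset \<Rightarrow>\<^sub>0 int"

section \<open>Evaluation of integer polynomials in the elements of a field\<close>

context field begin

text \<open>Elements outside the carrier are read as \<open>\<one>\<close>, so that \<open>fold_mset\<close> applies.\<close>

definition mon_step :: "'a \<Rightarrow> 'a \<Rightarrow> 'a" where
  "mon_step x y = (if x \<in> carrier R then x else \<one>) \<otimes> (if y \<in> carrier R then y else \<one>)"

definition mon :: "'a multiset \<Rightarrow> 'a" where "mon A = fold_mset mon_step \<one> A"

lemma mon_step_commute: "comp_fun_commute mon_step"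
proof
  show "mon_step y \<circ> mon_step x = mon_step x \<circ> mon_step y" for x y
    by (rule ext) (auto simp: mon_step_def m_lcomm)
qed

lemma mon_empty [simp]: "mon {#} = \<one>"
  by (simp add: mon_def)

lemma mon_closed [simp, intro]: "mon A \<in> carrier R"
proof (cases A)
  case (add x A)
  interpret comp_fun_commute mon_step by (rule mon_step_commute)
  show ?thesis by (simp add: add mon_def mon_step_def)
qed simp

lemma mon_add_mset: "mon (add_mset x A) = (if x \<in> carrier R then x else \<one>) \<otimes> mon A"
proof -
  interpret comp_fun_commute mon_step by (rule mon_step_commute)
  have "mon (add_mset x A) = mon_step x (mon A)" by (simp add: mon_def)
  thus ?thesis by (simp add: mon_step_def)
qed

lemma mon_add: "mon (A + B) = mon A \<otimes> mon B"
  by (induction A) (auto simp: mon_add_mset m_assoc)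

definition ev :: "'a free_ring \<Rightarrow> 'a" where
  "ev f = (\<Oplus>A\<in>Poly_Mapping.keys f. [Poly_Mapping.lookup f A] \<cdot> mon A)"

lemma ev_superset:
  assumes "finite S" "Poly_Mapping.keys f \<subseteq> S"
  shows "ev f = (\<Oplus>A\<in>S. [Poly_Mapping.lookup f A] \<cdot> mon A)"
proof -
  have "[(0::int)] \<cdot> x = \<zero>" for x by (simp add: add_pow_def int_pow_def)
  thus ?thesis unfolding ev_def using assms
    by (intro add.finprod_mono_neutral_cong_left) (auto simp: in_keys_iff)
qed

lemma ev_closed [simp, intro]: "ev f \<in> carrier R"
  by (auto simp: ev_def)

lemma ev_add: "ev (f + g) = ev f \<oplus> ev g"
proof -
  define S where "S = Poly_Mapping.keys f \<union> Poly_Mapping.keys g"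
  have S: "finite S" by (simp add: S_def)
  have "ev (f + g) = (\<Oplus>A\<in>S. [Poly_Mapping.lookup f A] \<cdot> mon A \<oplus> [Poly_Mapping.lookup g A] \<cdot> mon A)"
    using S Poly_Mapping.keys_add[of f g]
    by (subst ev_superset[OF S]) (auto simp: S_def lookup_add add.int_pow_mult)
  also have "\<dots> = (\<Oplus>A\<in>S. [Poly_Mapping.lookup f A] \<cdot> mon A) \<oplus> (\<Oplus>A\<in>S. [Poly_Mapping.lookup g A] \<cdot> mon A)"
    by (intro finsum_addf) auto
  also have "\<dots> = ev f \<oplus> ev g" using S by (simp add: ev_superset[of S] S_def)
  finally show ?thesis .
qed

lemma ev_0 [simp]: "ev 0 = \<zero>"
  by (simp add: ev_def)

lemma ev_single: "ev (Poly_Mapping.single A k) = [k] \<cdot> mon A"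
  by (subst ev_superset[of "{A}"]) auto

lemma ev_uminus: "ev (- f) = \<ominus> ev f"
proof -
  have "ev (- f) \<oplus> ev f = \<zero>" by (simp flip: ev_add)
  thus ?thesis by (metis ev_closed minus_equality)
qed

lemma ev_diff: "ev (f - g) = ev f \<ominus> ev g"
  using ev_add[of f "- g"] by (simp add: ev_uminus a_minus_def)

lemma ev_1 [simp]: "ev 1 = \<one>"
  using ev_single[of "{#}" 1] by simp

lemma ev_mult: "ev (f * g) = ev f \<otimes> ev g"
proof (induction f rule: poly_mapping_add_induct)
  case (add f A k)
  have "ev (Poly_Mapping.single A k * g) = ev (Poly_Mapping.single A k) \<otimes> ev g"
  proof (induction g rule: poly_mapping_add_induct)
    case (add g B l)
    have "ev (Poly_Mapping.single A k * Poly_Mapping.single B l) = ev (Poly_Mapping.single A k) \<otimes> ev (Poly_Mapping.single B l)"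
      by (simp add: mult_single ev_single mon_add add_pow_ldistr_int add_pow_rdistr_int add.int_pow_pow mult.commute)
    thus ?case using add by (simp add: ev_add distrib_left r_distr)
  qed simp
  thus ?case using add by (simp add: ev_add distrib_right l_distr)
qed simp

lemma ev_power: "ev (f ^ k) = ev f [^] k"
  by (induction k) (auto simp: ev_mult m_comm)

lemma ev_of_nat: "ev (of_nat k) = [k] \<cdot> \<one>"
  by (induction k) (auto simp: ev_add a_comm)

definition \<iota> :: "'a \<Rightarrow> 'a free_ring" where "\<iota> x = Poly_Mapping.single {#x#} 1"

lemma ev_\<iota>: "x \<in> carrier R \<Longrightarrow> ev (\<iota> x) = x"
  by (simp add: \<iota>_def ev_single mon_add_mset)

text \<open>\<open>Poly\<close> lists coefficients from the constant term, \<open>eval\<close> from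
  the leading one; hence the reversal.\<close>

lemma ev_poly: 
  assumes "x \<in> carrier R"
  shows "ev (poly (Poly (rev fs)) (\<iota> x)) = eval (map ev fs) x"
proof (induction fs)
  case (Cons f fs)
  have "poly (Poly (rev (f # fs))) (\<iota> x) = poly (Poly (rev fs)) (\<iota> x) + f * \<iota> x ^ length fs"
    by (simp add: Poly_append poly_monom mult.commute)
  thus ?case using assms by (simp add: ev_add ev_mult ev_power ev_\<iota> Cons[symmetric] a_comm)
qed simp

end

text \<open>The kernel of a homomorphism into a field is prime. A monic polynomial keeps its degree
  under \<open>ev\<close>, so its image has a root in the closed field, and \<iota> lifts that
  root.\<close>

theorem (in algebraically_closed) free_ring_residue_field:
  assumes p: "Factorial_Ring.prime p" "[p] \<cdot> \<one> = \<zero>"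
  shows "residue_field {f. ev f = \<zero>} p"
proof
  show "x \<in> {f. ev f = \<zero>} \<or> y \<in> {f. ev f = \<zero>}" if "x * y \<in> {f. ev f = \<zero>}" for x y
    using that integral[of "ev x" "ev y"] by (simp add: ev_mult)
  fix f :: "'a free_ring poly"
  assume f: "degree f > 0" "Polynomial.lead_coeff f = 1"
  define P where "P = map ev (rev (coeffs f))"
  have f0: "f \<noteq> 0" using f by auto
  have "hd P = ev (last (coeffs f))" using f0 by (simp add: P_def hd_map hd_rev)
  hence "hd P \<noteq> \<zero>" using f by (simp add: last_coeffs_eq_coeff_degree[OF f0])
  hence P: "P \<in> carrier (poly_ring L)"
    by (auto simp: univ_poly_def polynomial_def P_def)
  have "Polynomials.degree P = degree f"
    by (simp add: P_def degree_eq_length_coeffs)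
  hence "roots P \<noteq> {#}" using roots_over_carrier[OF P] f by (auto simp: splitted_def)
  then obtain x where "x \<in># roots P" by blast
  hence "is_root P x" using roots_mem_iff_is_root[OF P] by auto
  hence x: "x \<in> carrier L" "eval P x = \<zero>" by (auto simp: is_root_def)
  have "ev (poly (Poly (rev (rev (coeffs f)))) (\<iota> x)) = \<zero>"
    using ev_poly[OF x(1), of "rev (coeffs f)"] x(2) by (simp add: P_def)
  thus "\<exists>x. poly f x \<in> {f. ev f = \<zero>}" by auto
qed (use p in \<open>auto simp: ev_add ev_mult ev_of_nat\<close>)

text \<open>\<open>j\<close> is a homomorphism only up to congruence: in the free ring it will send
  x to a variable, which respects sums and products only modulo \<open>M\<close>.\<close>

locale finite_field_model = residue_field M p + field R
  for M :: "'r::comm_ring_1 set" and p :: nat and R :: "('a, 'b) ring_scheme" (structure) +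
  fixes K :: "'a set" and q n :: nat and j :: "'a \<Rightarrow> 'r"
  assumes q: "ppow q" "q > 1" and n: "n \<ge> 2"
    and card_R: "card (carrier R) = q ^ n" and K: "subfield K R" and card_K: "card K = q"
    and j_add: "x \<in> carrier R \<Longrightarrow> y \<in> carrier R \<Longrightarrow> j (x \<oplus> y) \<approx> j x + j y"
    and j_mult: "x \<in> carrier R \<Longrightarrow> y \<in> carrier R \<Longrightarrow> j (x \<otimes> y) \<approx> j x * j y"
    and j_one: "j \<one> \<approx> 1"
    and j_inj: "x \<in> carrier R \<Longrightarrow> y \<in> carrier R \<Longrightarrow> j x \<approx> j y \<Longrightarrow> x = y"
begin

lemma finite_R: "finite (carrier R)"
  using card_R q by (metis card.infinite not_less_zero power_eq_0_iff less_imp_neq zero_less_one less_trans)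

lemma K_sub: "K \<subseteq> carrier R" "finite K"
  using subfieldE(3)[OF K] finite_R finite_subset by auto

lemma j_eq: "x \<in> carrier R \<Longrightarrow> y \<in> carrier R \<Longrightarrow> j x \<approx> j y \<longleftrightarrow> x = y"
  using j_inj by auto

lemma j_minus:
  assumes "x \<in> carrier R" "y \<in> carrier R" shows "j (x \<ominus> y) \<approx> j x - j y"
proof -
  have "j ((x \<ominus> y) \<oplus> y) \<approx> j (x \<ominus> y) + j y" using assms by (intro j_add) auto
  moreover have "(x \<ominus> y) \<oplus> y = x" using assms by algebra
  ultimately show ?thesis using uminus_M[of "j x - (j (x \<ominus> y) + j y)"] by (simp add: eqv_def algebra_simps)
qed

lemma j_zero: "j \<zero> \<approx> 0"
  using j_minus[of \<zero> \<zero>] by (simp add: a_minus_def)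

lemma j_power: "x \<in> carrier R \<Longrightarrow> j (x [^] k) \<approx> j x ^ k" for k :: nat
proof (induction k)
  case (Suc k)
  hence "j (x [^] k \<otimes> x) \<approx> j (x [^] k) * j x" by (intro j_mult) auto
  also have "\<dots> \<approx> j x ^ k * j x" using Suc by (intro eqv_mult) auto
  finally show ?case by (simp add: mult.commute)
qed (simp add: j_one)

lemma fixed_iff: "x \<in> carrier R \<Longrightarrow> x [^] (q ^ d) = x \<longleftrightarrow> j x ^ (q ^ d) \<approx> j x"
  using j_eq[of "x [^] (q ^ d)" x] j_power[of x "q ^ d"] eqv_trans eqv_sym by (metis nat_pow_closed)

lemma pow_card_R: "x \<in> carrier R \<Longrightarrow> x [^] (q ^ n) = x"
proof -
  assume x: "x \<in> carrier R"
  have qn: "q ^ n > 1" using q n by (intro one_less_power) auto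
  show ?thesis
  proof (cases "x = \<zero>")
    case True
    have "q ^ n \<noteq> 0" using qn by linarith
    thus ?thesis unfolding True by (rule nat_pow_zero)
  next
    case False
    hence "x \<in> carrier (Multiplicative_Group.mult_of R)" using x by simp
    hence "x [^]\<^bsub>Multiplicative_Group.mult_of R\<^esub> Coset.order (Multiplicative_Group.mult_of R) = \<one>\<^bsub>Multiplicative_Group.mult_of R\<^esub>"
      by (rule group.pow_order_eq_1[OF field_mult_group])
    hence "x [^] (q ^ n - 1) = \<one>"
      using finite_R card_R by (simp add: order_mult_of Multiplicative_Group.nat_pow_mult_of Coset.order_def)
    moreover have "x [^] (q ^ n) = x [^] (q ^ n - 1) \<otimes> x" using qn by (metis Suc_diff_1 less_trans nat_pow_Suc zero_less_one)
    ultimately show ?thesis using x by simp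
  qed
qed

lemma pow_card_K: "x \<in> K \<Longrightarrow> x [^] q = x"
proof -
  assume x: "x \<in> K"
  interpret KF: field "R\<lparr>carrier := K\<rparr>" using subfield_iff(2)[OF K] .
  show ?thesis
  proof (cases "x = \<zero>")
    case True
    have "q \<noteq> 0" using q by linarith
    thus ?thesis unfolding True by (rule nat_pow_zero)
  next
    case False
    hence x': "x \<in> carrier (Multiplicative_Group.mult_of (R\<lparr>carrier := K\<rparr>))" using x by simp
    have "x [^]\<^bsub>Multiplicative_Group.mult_of (R\<lparr>carrier := K\<rparr>)\<^esub> Coset.order (Multiplicative_Group.mult_of (R\<lparr>carrier := K\<rparr>)) = \<one>\<^bsub>Multiplicative_Group.mult_of (R\<lparr>carrier := K\<rparr>)\<^esub>"
      by (rule group.pow_order_eq_1[OF KF.field_mult_group x'])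
    moreover have "\<zero> \<in> K" using subringE(2)[OF subfieldE(1)[OF K]] .
    ultimately have "x [^]\<^bsub>R\<lparr>carrier := K\<rparr>\<^esub> (q - 1) = \<one>"
      using K_sub card_K by (simp add: KF.order_mult_of Multiplicative_Group.nat_pow_mult_of Coset.order_def)
    hence "x [^] (q - 1) = \<one>" by (simp add: nat_pow_def)
    moreover have "x [^] q = x [^] (q - 1) \<otimes> x" using q by (metis Suc_diff_1 less_trans nat_pow_Suc zero_less_one)
    ultimately show ?thesis using x K_sub by auto
  qed
qed

lemma j_in_T: "x \<in> carrier R \<Longrightarrow> x [^] (q ^ d) = x \<Longrightarrow> rep (j x) \<in> T (q ^ d)"
  using fixed_iff T_rep by blast

lemma rep_j_inj: "inj_on (\<lambda>x. rep (j x)) (carrier R)"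
  by (rule inj_onI) (simp add: rep_eq_iff j_eq)

lemma T_card: "d > 0 \<Longrightarrow> finite (T (q ^ d)) \<and> card (T (q ^ d)) = q ^ d"
  using q by (intro T_finite_card ppow_power one_less_power) auto

lemma bij_R_T: "bij_betw (\<lambda>x. rep (j x)) (carrier R) (T (q ^ n))"
proof -
  have "(\<lambda>x. rep (j x)) ` carrier R = T (q ^ n)"
    using T_card[of n] n j_in_T[of _ n] pow_card_R rep_j_inj card_R
    by (intro card_subset_eq) (auto simp: card_image)
  thus ?thesis using rep_j_inj by (simp add: bij_betw_def)
qed

lemma bij_K_T: "bij_betw (\<lambda>x. rep (j x)) K (T q)"
proof -
  have inj: "inj_on (\<lambda>x. rep (j x)) K" using rep_j_inj K_sub inj_on_subset by blast
  have "(\<lambda>x. rep (j x)) ` K \<subseteq> T q" using j_in_T[of _ 1] pow_card_K K_sub by auto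
  hence "(\<lambda>x. rep (j x)) ` K = T q"
    using T_card[of 1] inj card_K by (intro card_subset_eq) (auto simp: card_image)
  thus ?thesis using inj by (simp add: bij_betw_def)
qed

text \<open>The subfield fixed by the d-th iterate of the q-Frobenius. As d need not divide n, it
  can have fewer than q ^ d elements; an upper bound is all that is claimed.\<close>

definition Fix :: "nat \<Rightarrow> 'a set" where "Fix d = {x \<in> carrier R. x [^] (q ^ d) = x}"

lemma Fix_card: "d > 0 \<Longrightarrow> card (Fix d) \<le> q ^ d"
proof -
  assume d: "d > 0"
  have "inj_on (\<lambda>x. rep (j x)) (Fix d)" using rep_j_inj by (rule inj_on_subset) (auto simp: Fix_def)
  hence "card (Fix d) \<le> card (T (q ^ d))"
    using T_card[OF d] j_in_T by (intro card_inj_on_le) (auto simp: Fix_def)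
  thus ?thesis using T_card[OF d] by simp
qed

lemma K_Fix: "K \<subseteq> Fix d"
proof
  fix x assume x: "x \<in> K"
  have "x [^] (q ^ d) = x"
  proof (induction d)
    case (Suc d)
    have "x [^] (q ^ Suc d) = (x [^] (q ^ d)) [^] q" using x K_sub by (simp add: nat_pow_pow subsetD mult.commute)
    thus ?case using Suc pow_card_K[OF x] by simp
  qed (use x K_sub in auto)
  thus "x \<in> Fix d" using x K_sub by (auto simp: Fix_def)
qed

lemma Fix_mult: "x \<in> Fix d \<Longrightarrow> y \<in> Fix d \<Longrightarrow> x \<otimes> y \<in> Fix d"
  by (auto simp: Fix_def nat_pow_distrib)

lemma Fix_add: "x \<in> Fix d \<Longrightarrow> y \<in> Fix d \<Longrightarrow> x \<oplus> y \<in> Fix d"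
proof -
  assume xy: "x \<in> Fix d" "y \<in> Fix d"
  hence c: "x \<in> carrier R" "y \<in> carrier R" by (auto simp: Fix_def)
  have "j (x \<oplus> y) ^ (q ^ d) \<approx> (j x + j y) ^ (q ^ d)" using c by (intro eqv_power j_add)
  also have "\<dots> \<approx> j x ^ (q ^ d) + j y ^ (q ^ d)" by (rule frob_add[OF ppow_power[OF q(1)]])
  also have "\<dots> \<approx> j x + j y" using xy c by (intro eqv_add) (auto simp: Fix_def fixed_iff)
  also have "\<dots> \<approx> j (x \<oplus> y)" using c by (intro eqv_sym[OF j_add])
  finally show ?thesis using c fixed_iff[of "x \<oplus> y" d] by (simp add: Fix_def)
qed

lemma Fix_diff: "x \<in> Fix d \<Longrightarrow> y \<in> Fix d \<Longrightarrow> x \<ominus> y \<in> Fix d"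
proof -
  assume xy: "x \<in> Fix d" "y \<in> Fix d"
  hence c: "x \<in> carrier R" "y \<in> carrier R" by (auto simp: Fix_def)
  have "j (x \<ominus> y) ^ (q ^ d) \<approx> (j x - j y) ^ (q ^ d)" using c by (intro eqv_power j_minus)
  also have "\<dots> \<approx> j x ^ (q ^ d) - j y ^ (q ^ d)" by (rule frob_diff[OF ppow_power[OF q(1)]])
  also have "\<dots> \<approx> j x - j y" using xy c by (intro eqv_diff) (auto simp: Fix_def fixed_iff)
  also have "\<dots> \<approx> j (x \<ominus> y)" using c by (intro eqv_sym[OF j_minus])
  finally show ?thesis using c fixed_iff[of "x \<ominus> y" d] by (simp add: Fix_def)
qed

section \<open>Multiplicative characters and the bound on lines\<close>

lemma character_norm:
  assumes "multiplicative_character R \<chi>" "x \<in> carrier R" "x \<noteq> \<zero>"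
  shows "cmod (\<chi> x) = 1"
  using assms by (auto simp: multiplicative_character_def unit_circle_def hom_def)

lemma character_mult:
  assumes "multiplicative_character R \<chi>" "x \<in> carrier R" "y \<in> carrier R"
  shows "\<chi> (x \<otimes> y) = \<chi> x * \<chi> y"
proof (cases "x = \<zero> \<or> y = \<zero>")
  case True thus ?thesis using assms by (auto simp: multiplicative_character_def)
next
  case False
  thus ?thesis using assms by (auto simp: multiplicative_character_def unit_circle_def hom_def)
qed

lemma character_one:
  assumes "multiplicative_character R \<chi>" shows "\<chi> \<one> = 1"
proof -
  have "\<chi> \<one> * \<chi> \<one> = \<chi> \<one>" using character_mult[OF assms, of \<one> \<one>] by simp
  moreover have "\<chi> \<one> \<noteq> 0" using character_norm[OF assms, of \<one>] by auto
  ultimately show ?thesis by simp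
qed

lemma character_sum:
  assumes \<chi>: "multiplicative_character R \<chi>" "\<not> trivial_character R \<chi>"
  shows "(\<Sum>x\<in>carrier R. \<chi> x) = 0"
proof -
  obtain a where a: "a \<in> carrier R" "a \<noteq> \<zero>" "\<chi> a \<noteq> 1"
    using \<chi>(2) by (auto simp: trivial_character_def)
  have "inj_on (\<lambda>x. a \<otimes> x) (carrier R)" using a by (intro inj_onI) (simp add: m_lcancel)
  moreover have "(\<lambda>x. a \<otimes> x) ` carrier R = carrier R"
    using finite_R a calculation by (intro endo_inj_surj) auto
  ultimately have bij: "bij_betw (\<lambda>x. a \<otimes> x) (carrier R) (carrier R)" by (simp add: bij_betw_def)
  have "(\<Sum>x\<in>carrier R. \<chi> x) = (\<Sum>x\<in>carrier R. \<chi> (a \<otimes> x))" by (rule sum.reindex_bij_betw[OF bij, symmetric])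
  also have "\<dots> = \<chi> a * (\<Sum>x\<in>carrier R. \<chi> x)"
    using character_mult[OF \<chi>(1)] a by (simp add: sum_distrib_left)
  finally show ?thesis using a(3) by (metis mult_cancel_right1)
qed

theorem katz_line_bound:
  assumes \<chi>: "multiplicative_character R \<chi>" "\<not> trivial_character R \<chi>"
    and b: "b \<in> carrier R" "\<And>i. 0 < i \<Longrightarrow> i < n \<Longrightarrow> b \<notin> Fix i"
  shows "cmod (\<Sum>c\<in>K. \<chi> (b \<oplus> c)) \<le> real (n - 1) * sqrt (real q)"
proof -
  \<comment> \<open>The character carried over by \<open>j\<close> and extended to congruent
    elements. The value 0 elsewhere is a default: apart from compatibility with congruence, the
    conditions on X concern elements fixed by the q ^ n-th power, all congruent to some
    \<open>j x\<close>.\<close>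
  define X where "X z = (if \<exists>x\<in>carrier R. z \<approx> j x then \<chi> (THE x. x \<in> carrier R \<and> z \<approx> j x) else 0)" for z
  have X_cong: "X y = X z" if "y \<approx> z" for y z
  proof -
    have "y \<approx> j x \<longleftrightarrow> z \<approx> j x" for x using that eqv_trans eqv_sym by metis
    thus ?thesis by (simp add: X_def)
  qed
  have X_j: "X (j x) = \<chi> x" if x: "x \<in> carrier R" for x
  proof -
    have "(THE y. y \<in> carrier R \<and> j x \<approx> j y) = x" using x j_eq by (intro the_equality) auto
    thus ?thesis using x by (auto simp: X_def)
  qed
  have ex: "\<exists>x\<in>carrier R. z \<approx> j x" if z: "z ^ (q ^ n) \<approx> z" for z
  proof -
    have "rep z \<in> T (q ^ n)" using z by (rule T_rep)
    then obtain x where "x \<in> carrier R" "rep z = rep (j x)" using bij_R_T by (auto simp: bij_betw_def)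
    thus ?thesis by (auto simp: rep_eq_iff)
  qed
  have X_rep: "X (rep (j x)) = \<chi> x" if "x \<in> carrier R" for x
    using X_cong[OF rep_eqv] X_j[OF that] by simp
  note n2 = n
  interpret katz_setup M p q n "j b" X
  proof
    show "j b ^ (q ^ n) \<approx> j b" using pow_card_R b fixed_iff by blast
    show "\<not> j b ^ (q ^ i) \<approx> j b" if "0 < i" "i < n" for i
      using b(2)[OF that] b(1) fixed_iff by (auto simp: Fix_def)
    show "X x = X y" if "x \<approx> y" for x y using that by (rule X_cong)
    show "X (x * y) = X x * X y" if xy: "x ^ (q ^ n) \<approx> x" "y ^ (q ^ n) \<approx> y" for x y
    proof -
      obtain a c where ac: "a \<in> carrier R" "c \<in> carrier R" "x \<approx> j a" "y \<approx> j c" using ex xy by metis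
      have "x * y \<approx> j a * j c" using ac by (intro eqv_mult)
      also have "\<dots> \<approx> j (a \<otimes> c)" using ac by (intro eqv_sym[OF j_mult])
      finally have "X (x * y) = \<chi> (a \<otimes> c)" using X_cong X_j ac by (metis m_closed)
      also have "\<dots> = X x * X y" using character_mult[OF \<chi>(1)] X_cong X_j ac by metis
      finally show ?thesis .
    qed
    show "X 1 = 1" using X_cong[OF j_one] X_j[of \<one>] character_one[OF \<chi>(1)] by simp
    show "X 0 = 0" using X_cong[OF j_zero] X_j[of \<zero>] \<chi>(1) by (simp add: multiplicative_character_def)
    show "cmod (X x) = 1" if x: "x \<notin> M" "x ^ (q ^ n) \<approx> x" for x
    proof -
      obtain a where a: "a \<in> carrier R" "x \<approx> j a" using ex x by metis
      have "a \<noteq> \<zero>"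
      proof
        assume "a = \<zero>"
        hence "x \<approx> 0" using a j_zero eqv_trans by blast
        thus False using x by (simp add: eqv_0)
      qed
      thus ?thesis using character_norm[OF \<chi>(1) a(1)] X_cong[OF a(2)] X_j[OF a(1)] by simp
    qed
    have "(\<Sum>z\<in>T (q ^ n). X z) = (\<Sum>x\<in>carrier R. X (rep (j x)))" by (rule sum.reindex_bij_betw[OF bij_R_T, symmetric])
    also have "\<dots> = (\<Sum>x\<in>carrier R. \<chi> x)" using X_rep by (intro sum.cong) auto
    finally show "(\<Sum>z\<in>T (q ^ n). X z) = 0" using character_sum[OF \<chi>] by simp
    show "ppow q" "1 < q" by (rule q)+
    show "1 \<le> n" using n by linarith
  qed
  \<comment> \<open>\<open>katz_bound\<close> sums over differences \<theta> - c, the line consists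
    of sums b + c.\<close>
  have neg: "bij_betw (\<lambda>c. \<ominus> c) K K"
  proof -
    have closed: "\<ominus> c \<in> K" if "c \<in> K" for c using subringE(5)[OF subfieldE(1)[OF K] that] .
    have inv: "\<ominus> (\<ominus> c) = c" if "c \<in> K" for c using that K_sub(1) by auto
    show ?thesis by (rule bij_betw_byWitness[where f' = "\<lambda>c. \<ominus> c"]) (use closed inv in auto)
  qed
  have "(\<Sum>c\<in>T q. X (j b - c)) = (\<Sum>c\<in>K. X (j b - rep (j c)))" by (rule sum.reindex_bij_betw[OF bij_K_T, symmetric])
  also have "\<dots> = (\<Sum>c\<in>K. \<chi> (b \<oplus> \<ominus> c))"
  proof (intro sum.cong refl)
    fix c assume "c \<in> K"
    hence c: "c \<in> carrier R" using K_sub by auto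
    have "j b - rep (j c) \<approx> j b - j c" by (intro eqv_diff eqv_refl rep_eqv)
    also have "\<dots> \<approx> j (b \<ominus> c)" using b c by (intro eqv_sym[OF j_minus])
    finally show "X (j b - rep (j c)) = \<chi> (b \<oplus> \<ominus> c)" using X_cong X_j[of "b \<ominus> c"] b c by (simp add: a_minus_def)
  qed
  also have "\<dots> = (\<Sum>c\<in>K. \<chi> (b \<oplus> c))" by (rule sum.reindex_bij_betw[OF neg])
  finally show ?thesis using katz_bound[OF n2] by simp
qed

end

text \<open>The variables are the elements of an algebraic closure \<open>L\<close> of
  \<open>R\<close>, \<open>M\<close> is the kernel of evaluation in \<open>L\<close>, and
  \<open>j\<close> sends x to the variable that stands for its image in \<open>L\<close>.\<close>

lemma (in field) finite_field_model_exists: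
  assumes "primepow q" "n \<ge> 2" "card (carrier R) = q ^ n" "subfield K R" "card K = q"
  shows "\<exists>(M :: (('a list \<times> nat) multiset \<Rightarrow> 'a) free_ring set) p j. finite_field_model M p R K q n j"
proof -
  obtain L :: "(('a list \<times> nat) multiset \<Rightarrow> 'a) ring"
    where L: "algebraic_closure L (indexed_const ` (carrier R))" and h: "indexed_const \<in> ring_hom R L"
    by (rule exists_closure)
  interpret L: algebraic_closure L "indexed_const ` (carrier R)" by (rule L)
  obtain p s where p: "Factorial_Ring.prime p" "q = p ^ s" and s: "s > 0" using assms(1) by (auto simp: primepow_def)
  have hom: "indexed_const (x \<oplus> y) = indexed_const x \<oplus>\<^bsub>L\<^esub> indexed_const y"
    "indexed_const (x \<otimes> y) = indexed_const x \<otimes>\<^bsub>L\<^esub> indexed_const y" "indexed_const x \<in> carrier L"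
    if "x \<in> carrier R" "y \<in> carrier R" for x y
    using ring_hom_memE[OF h] that by auto
  have h1: "indexed_const \<one> = \<one>\<^bsub>L\<^esub>" using ring_hom_memE(4)[OF h] .
  have h0: "indexed_const \<zero> = \<zero>\<^bsub>L\<^esub>" using ring_hom_zero[OF h] is_ring L.is_ring by blast
  have "indexed_const ([k] \<cdot> \<one>) = [k] \<cdot>\<^bsub>L\<^esub> \<one>\<^bsub>L\<^esub>" for k :: nat
    by (induction k) (auto simp: hom h1 h0)
  \<comment> \<open>Lagrange's theorem in the additive group. As q ^ n is a power of p, the multiple
    of the unit by p is nilpotent in \<open>L\<close>, hence zero.\<close>
  moreover have "[(q ^ n)] \<cdot> \<one> = \<zero>"
  proof -
    have "\<one> [^]\<^bsub>add_monoid R\<^esub> Coset.order (add_monoid R) = \<one>\<^bsub>add_monoid R\<^esub>"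
      by (rule group.pow_order_eq_1[OF a_group]) simp
    thus ?thesis using assms(3) by (simp add: Coset.order_def add_pow_def)
  qed
  ultimately have qL: "[(p ^ (s * n))] \<cdot>\<^bsub>L\<^esub> \<one>\<^bsub>L\<^esub> = \<zero>\<^bsub>L\<^esub>" using h0 p(2) by (metis power_mult)
  have "L.ev (of_nat p) [^]\<^bsub>L\<^esub> (s * n) = \<zero>\<^bsub>L\<^esub>"
    using qL by (metis L.ev_of_nat L.ev_power of_nat_power)
  moreover have "x = \<zero>\<^bsub>L\<^esub>" if "x [^]\<^bsub>L\<^esub> k = \<zero>\<^bsub>L\<^esub>" "x \<in> carrier L" for x and k :: nat
    using that by (induction k) (auto dest: L.integral)
  ultimately have "L.ev (of_nat p) = \<zero>\<^bsub>L\<^esub>" by blast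
  hence pL: "[p] \<cdot>\<^bsub>L\<^esub> \<one>\<^bsub>L\<^esub> = \<zero>\<^bsub>L\<^esub>" by (simp add: L.ev_of_nat)
  define M where "M = {f. L.ev f = \<zero>\<^bsub>L\<^esub>}"
  interpret RF: residue_field M p unfolding M_def by (rule L.free_ring_residue_field[OF p(1) pL])
  have eqv: "RF.eqv f g \<longleftrightarrow> L.ev f = L.ev g" for f g
    unfolding RF.eqv_def by (simp add: M_def L.ev_diff)
  have "finite_field_model M p R K q n (\<lambda>x. L.\<iota> (indexed_const x))"
  proof (intro finite_field_model.intro finite_field_model_axioms.intro RF.residue_field_axioms field_axioms assms)
    show "RF.ppow q" using p(2) by (auto simp: RF.ppow_def)
    show "q > 1" using assms(1) primepow_gt_Suc_0 by auto
    show "x = y" if "x \<in> carrier R" "y \<in> carrier R" "RF.eqv (L.\<iota> (indexed_const x)) (L.\<iota> (indexed_const y))" for x y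
      using that hom(3) by (intro inj_onD[OF indexed_const_inj_on _ that(1,2)]) (simp add: eqv L.ev_\<iota>)
  qed (use assms in \<open>simp_all add: eqv L.ev_\<iota> L.ev_add L.ev_mult hom h1\<close>)
  thus ?thesis by blast
qed

section \<open>Sums over affine spaces\<close>

text \<open>A coincidence puts (k - k') * v in \<open>E\<close>, and dividing by k - k' would put v
  there. Only closure properties of \<open>E\<close> are assumed, so that the lemma serves both the
  steps of \<open>dimension\<close> and the exceptional subspaces below.\<close>

lemma (in field) inj_on_line_extension:
  assumes K: "subfield K R" and E: "E \<subseteq> carrier R" and v: "v \<in> carrier R" "v \<notin> E"
    and diff: "\<And>w w'. w \<in> E \<Longrightarrow> w' \<in> E \<Longrightarrow> w \<ominus> w' \<in> E"
    and smult: "\<And>k w. k \<in> K \<Longrightarrow> w \<in> E \<Longrightarrow> k \<otimes> w \<in> E"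
  shows "inj_on (\<lambda>(k, w). k \<otimes> v \<oplus> w) (K \<times> E)"
proof (rule inj_onI, clarsimp)
  fix k w k' w' assume *: "k \<in> K" "w \<in> E" "k' \<in> K" "w' \<in> E" "k \<otimes> v \<oplus> w = k' \<otimes> v \<oplus> w'"
  have KR: "K \<subseteq> carrier R" using subfieldE(3)[OF K] .
  have c: "k \<in> carrier R" "k' \<in> carrier R" "w \<in> carrier R" "w' \<in> carrier R" using * KR E by auto
  have eq: "(k \<ominus> k') \<otimes> v = w' \<ominus> w"
  proof -
    have "(k \<ominus> k') \<otimes> v = (k \<otimes> v \<oplus> w) \<ominus> (k' \<otimes> v \<oplus> w')  \<oplus> (w' \<ominus> w)" using c v by algebra
    also have "\<dots> = w' \<ominus> w" using *(5) c v by (simp add: a_minus_def r_neg)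
    finally show ?thesis .
  qed
  have "k = k'"
  proof (rule ccontr)
    assume "k \<noteq> k'"
    hence nz: "k \<ominus> k' \<noteq> \<zero>" using c by simp
    have kk: "k \<ominus> k' \<in> K" using * subringE(5,7)[OF subfieldE(1)[OF K]] by (simp add: a_minus_def)
    hence i: "inv (k \<ominus> k') \<in> K" "inv (k \<ominus> k') \<otimes> (k \<ominus> k') = \<one>" using subfield_m_inv[OF K, of "k \<ominus> k'"] nz by auto
    have "inv (k \<ominus> k') \<in> carrier R" "k \<ominus> k' \<in> carrier R" using i(1) kk KR by auto
    hence "v = inv (k \<ominus> k') \<otimes> ((k \<ominus> k') \<otimes> v)"
      using i v by (simp flip: m_assoc)
    also have "\<dots> \<in> E" unfolding eq using smult diff i(1) * by blast
    finally show False using v by simp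
  qed
  moreover from this have "w = w'" using *(5) c v by simp
  ultimately show "k = k' \<and> w = w'" by simp
qed

lemma (in field) card_dimension:
  assumes "dimension t K V" "subfield K R" "finite K"
  shows "finite V \<and> card V = card K ^ t"
  using assms
proof (induction rule: dimension.induct)
  case (Suc_dim v E t K)
  note K = Suc_dim.prems
  obtain Vs where Vs: "set Vs \<subseteq> carrier R" "Span K Vs = E" using exists_base[OF K(1) Suc_dim.hyps(3)] by blast
  hence sub: "subalgebra K E R" using Span_is_subalgebra[OF K(1)] by blast
  have E: "subgroup E (add_monoid R)" using subalgebra.axioms(1)[OF sub] .
  have img: "line_extension K v E = (\<lambda>(k, w). k \<otimes> v \<oplus> w) ` (K \<times> E)"
    by (auto simp: line_extension_mem_iff image_iff) blast
  have "inj_on (\<lambda>(k, w). k \<otimes> v \<oplus> w) (K \<times> E)"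
  proof (rule inj_on_line_extension[OF K(1) subalgebra_in_carrier[OF sub] Suc_dim.hyps(1,2)])
    show "w \<ominus> w' \<in> E" if "w \<in> E" "w' \<in> E" for w w'
      unfolding a_minus_def using add.subgroupE(3,4)[OF E] that by blast
    show "k \<otimes> w \<in> E" if "k \<in> K" "w \<in> E" for k w using subalgebra.smult_closed[OF sub that] .
  qed
  thus ?case using Suc_dim.IH[OF K] K(2) unfolding img by (simp add: card_image card_cartesian_product)
qed simp

text \<open>With s = sqrt q and m = n - 1 the claim reduces to N * (s * s - m * s) < q ^ t * s. This
  is clear for s \<le> m; otherwise N * s * s \<le> m * q ^ t reduces it to m * (s - m) < s *
  s.\<close>

lemma affine_average_estimate:
  fixes q n t N :: nat
  assumes q: "q > 1" and n: "n \<ge> 2" and N: "real N * real q \<le> real (n - 1) * real q ^ t" "real N \<le> real q ^ t"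
  shows "(real q ^ t - real N) * (real (n - 1) * sqrt (real q)) + real N * real q < real q * (real n * real q powr (real t - 1 / 2))"
proof -
  define s where "s = sqrt (real q)"
  define m where "m = real (n - 1)"
  have s: "s > 0" "s * s = real q" using q by (auto simp: s_def)
  have m: "m > 0" "real n = m + 1" using n by (auto simp: m_def)
  have "real q powr (real t - 1 / 2) = real q ^ t / s"
    using q by (simp add: powr_diff powr_realpow powr_half_sqrt s_def)
  moreover have "real q / s = s" using s by (metis nonzero_mult_div_cancel_right less_irrefl)
  moreover have "real q * (real n * (w / s)) = real n * (w * (real q / s))" for w by simp
  ultimately have rhs: "real q * (real n * real q powr (real t - 1 / 2)) = (m + 1) * (real q ^ t * s)"
    using m(2) by (simp only:)
  have qt: "real q ^ t > 0" using q by simp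
  have "real N * (s * s - m * s) < real q ^ t * s"
  proof (cases "s \<le> m")
    case True
    hence "real N * (s * (s - m)) \<le> 0" using s by (intro mult_nonneg_nonpos) auto
    moreover have "real q ^ t * s > 0" using qt s by simp
    ultimately show ?thesis by (simp add: algebra_simps)
  next
    case False
    have "real N * (s * s) * (s * (s - m)) \<le> m * real q ^ t * (s * (s - m))"
    proof (rule mult_right_mono)
      show "real N * (s * s) \<le> m * real q ^ t" using N(1) unfolding s(2) m_def .
      show "0 \<le> s * (s - m)" using s(1) False by (intro mult_nonneg_nonneg) linarith+
    qed
    also have "\<dots> = (real q ^ t * s) * (m * (s - m))" by (simp add: algebra_simps)
    also have "\<dots> < (real q ^ t * s) * (s * s)"
    proof (rule mult_strict_left_mono)
      \<comment> \<open>The square shows that m * (s - m) is at most a quarter of s * s, which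
        yields strictness.\<close>
      have "(s - 2 * m)\<^sup>2 \<ge> 0" by simp
      moreover have "s * s > 0" by (rule mult_pos_pos[OF s(1) s(1)])
      moreover have "(s - 2 * m)\<^sup>2 = s * s - 4 * (m * (s - m))" by (simp add: power2_eq_square algebra_simps)
      ultimately show "m * (s - m) < s * s" by linarith
    qed (use qt s in simp)
    finally have "(real N * (s * s - m * s)) * (s * s) < (real q ^ t * s) * (s * s)" by (simp add: algebra_simps)
    thus ?thesis by (rule mult_right_less_imp_less) simp
  qed
  hence "(real q ^ t - real N) * (m * s) + real N * (s * s) < (m + 1) * (real q ^ t * s)"
    by (simp add: algebra_simps)
  thus ?thesis unfolding rhs by (simp add: s m_def s_def[symmetric])
qed

context finite_field_model begin

text \<open>The powers \<open>P k\<close> of the indeterminate give infinitely many polynomials over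
  \<open>K\<close>, evaluated in a finite ring: two polynomials agree at x.\<close>

lemma algebraic_K: "x \<in> carrier R \<Longrightarrow> (algebraic over K) x"
proof -
  assume x: "x \<in> carrier R"
  define P where "P k = \<one> # replicate k \<zero>" for k
  have "P k \<in> carrier (K[X])" for k
    using subringE(2,3)[OF subfieldE(1)[OF K]] by (auto simp: P_def univ_poly_def polynomial_def)
  moreover have "inj P" by (rule injI) (metis P_def length_replicate list.inject)
  ultimately have "infinite (carrier (K[X]))" by (meson finite_subset image_subsetI infinite_UNIV_nat finite_imageD)
  moreover have "(\<lambda>p. eval p x) ` carrier (K[X]) \<subseteq> carrier R"
    using x K_sub(1) eval_in_carrier by (auto simp: univ_poly_def polynomial_def)
  ultimately have "\<not> inj_on (\<lambda>p. eval p x) (carrier (K[X]))"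
    using finite_R finite_subset finite_imageD by metis
  thus ?thesis by (simp add: algebraic_def over_def transcendental_def)
qed

text \<open>\<open>Fix d\<close> contains \<open>K\<close> and is closed under sums and products, so
  with x it would contain the whole simple extension, which has q ^ n elements.\<close>

lemma element_degree_imp_not_Fix:
  assumes x: "x \<in> carrier R" and deg: "element_degree R K x = n" and d: "0 < d" "d < n"
  shows "x \<notin> Fix d"
proof
  assume xF: "x \<in> Fix d"
  have "dimension n K (simple_extension K x)"
    using dimension_simple_extension[OF K x algebraic_K[OF x]] deg by (simp add: element_degree_def)
  hence c: "card (simple_extension K x) = q ^ n" using card_dimension[OF _ K K_sub(2)] card_K by blast
  have "simple_extension K x \<subseteq> Fix d"
  proof
    fix y assume "y \<in> simple_extension K x"
    thus "y \<in> Fix d"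
    proof induction
      case zero thus ?case using K_Fix subringE(2)[OF subfieldE(1)[OF K]] by blast
    next
      case (lin k1 k2) thus ?case using K_Fix[of d] xF Fix_mult Fix_add by blast
    qed
  qed
  hence "card (simple_extension K x) \<le> card (Fix d)"
    using finite_R by (intro card_mono) (auto simp: Fix_def)
  also have "\<dots> \<le> q ^ d" using Fix_card d by blast
  also have "\<dots> < q ^ n" using q d by (intro power_strict_increasing) auto
  finally show False using c by simp
qed

theorem affine_character_sum_bound:
  assumes \<chi>: "multiplicative_character R \<chi>" "\<not> trivial_character R \<chi>"
    and A: "is_affine_space R K t u V A" and y: "y \<in> V" "y \<noteq> \<zero>"
    and x: "x \<in> (\<lambda>a. a \<otimes> inv y) ` A" "element_degree R K x = n"
  shows "cmod (\<Sum>a\<in>A. \<chi> a) < real n * real q powr (real t - 1 / 2)"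
proof -
  have u: "u \<in> carrier R" and V: "subalgebra K V R" and dim: "dimension t K V" and Aeq: "A = u <+ V"
    using A by (auto simp: is_affine_space_def)
  have Vadd: "subgroup V (add_monoid R)" using subalgebra.axioms(1)[OF V] .
  have VR: "V \<subseteq> carrier R" using subalgebra_in_carrier[OF V] .
  have Vsmult: "k \<otimes> v \<in> V" if "k \<in> K" "v \<in> V" for k v using subalgebra.smult_closed[OF V that] .
  have Vplus: "v \<oplus> w \<in> V" if "v \<in> V" "w \<in> V" for v w using add.subgroupE(4)[OF Vadd that] .
  have Vneg: "\<ominus> v \<in> V" if "v \<in> V" for v using add.subgroupE(3)[OF Vadd that] .
  have cV: "finite V" "card V = q ^ t" using card_dimension[OF dim K K_sub(2)] card_K by auto
  have Aim: "A = (\<lambda>v. u \<oplus> v) ` V" unfolding Aeq a_l_coset_def l_coset_def by auto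
  have inj: "inj_on (\<lambda>v. u \<oplus> v) V" using u VR by (auto simp: inj_on_def subset_iff)
  have cA: "finite A" "card A = q ^ t" using cV inj by (simp_all add: Aim card_image)
  have AR: "A \<subseteq> carrier R" using u VR by (auto simp: Aim)
  have Ashift: "a \<oplus> v \<in> A" if "a \<in> A" "v \<in> V" for a v
    using that Vplus u VR by (auto simp: Aim a_assoc subset_iff)
  have Adiff: "a \<ominus> b \<in> V" if ab: "a \<in> A" "b \<in> A" for a b
  proof -
    obtain v w where vw: "a = u \<oplus> v" "b = u \<oplus> w" "v \<in> V" "w \<in> V" using ab by (auto simp: Aim)
    hence "a \<ominus> b = v \<oplus> \<ominus> w" using u VR by (simp add: subset_iff) algebra
    thus ?thesis using vw Vplus Vneg by simp
  qed
  have yR: "y \<in> carrier R" using y VR by auto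
  hence yU: "y \<in> Units R" using y field_Units by simp
  have iy: "inv y \<in> carrier R" "y \<otimes> inv y = \<one>" "inv y \<otimes> y = \<one>" using yU by auto
  have KR: "k \<in> carrier R" if "k \<in> K" for k using that K_sub by auto
  define f where "f a = a \<otimes> inv y" for a
  have fR: "f a \<in> carrier R" if "a \<in> carrier R" for a using that iy by (simp add: f_def)
  have fdiff: "f (a \<ominus> b) = f a \<ominus> f b" if "a \<in> carrier R" "b \<in> carrier R" for a b
    using that iy(1) unfolding f_def by algebra
  have finj: "a = b" if "f a = f b" "a \<in> carrier R" "b \<in> carrier R" for a b
    using that iy yU by (metis Units_inv_Units Units_l_cancel f_def m_comm)
  obtain a0 where a0: "a0 \<in> A" "x = f a0" using x by (auto simp: f_def)
  have a0R: "a0 \<in> carrier R" using a0 AR by auto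
  have a0good: "f a0 \<notin> Fix d" if "0 < d" "d < n" for d
    using element_degree_imp_not_Fix[OF fR[OF a0R] _ that] x(2) a0(2) by simp
  define Bd where "Bd d = {a \<in> A. f a \<in> Fix d}" for d
  \<comment> \<open>Subtracting one member a1 moves \<open>Bd d\<close> into the subspace
    \<open>W\<close> of \<open>V\<close>. It misses v0 = a0 - a1, because a0 / y has degree n;
    adjoining the line through v0 stays inside \<open>V\<close> and multiplies the size by
    q.\<close>
  have Bd: "q * card (Bd d) \<le> q ^ t" if d: "0 < d" "d < n" for d
  proof (cases "Bd d = {}")
    case True
    show ?thesis unfolding True by simp
  next
    case False
    then obtain a1 where a1: "a1 \<in> A" "f a1 \<in> Fix d" by (auto simp: Bd_def)
    have a1R: "a1 \<in> carrier R" using a1 AR by auto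
    define W where "W = {v \<in> V. f v \<in> Fix d}"
    define v0 where "v0 = a0 \<ominus> a1"
    have v0: "v0 \<in> V" "v0 \<in> carrier R" using Adiff a0 a1 VR by (auto simp: v0_def)
    have v0W: "v0 \<notin> W"
    proof
      assume "v0 \<in> W"
      hence "f a0 \<ominus> f a1 \<in> Fix d" using fdiff[OF a0R a1R] by (simp add: W_def v0_def)
      hence "(f a0 \<ominus> f a1) \<oplus> f a1 \<in> Fix d" using a1 Fix_add by blast
      moreover have "(f a0 \<ominus> f a1) \<oplus> f a1 = f a0" using fR[OF a0R] fR[OF a1R] by algebra
      ultimately show False using a0good[OF d] by simp
    qed
    have Wdiff: "w \<ominus> w' \<in> W" if "w \<in> W" "w' \<in> W" for w w'
    proof -
      have c: "w \<in> carrier R" "w' \<in> carrier R" using that VR by (auto simp: W_def)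
      have "w \<ominus> w' \<in> V" using that Vplus Vneg by (auto simp: W_def a_minus_def)
      moreover have "f (w \<ominus> w') \<in> Fix d" using fdiff[OF c] that Fix_diff by (simp add: W_def)
      ultimately show ?thesis by (simp add: W_def)
    qed
    have Wsmult: "k \<otimes> w \<in> W" if "k \<in> K" "w \<in> W" for k w
    proof -
      have "f (k \<otimes> w) = k \<otimes> f w" using that KR VR iy by (auto simp: W_def f_def m_assoc subset_iff)
      thus ?thesis using that Vsmult Fix_mult K_Fix[of d] by (auto simp: W_def)
    qed
    have finW: "finite W" using cV by (simp add: W_def)
    have "card (Bd d) \<le> card W"
    proof (rule card_inj_on_le[of "\<lambda>a. a \<ominus> a1"])
      show "inj_on (\<lambda>a. a \<ominus> a1) (Bd d)"
      proof (rule inj_onI)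
        fix a b assume ab: "a \<in> Bd d" "b \<in> Bd d" "a \<ominus> a1 = b \<ominus> a1"
        have "a \<in> carrier R" "b \<in> carrier R" using ab AR by (auto simp: Bd_def)
        thus "a = b" using ab(3) a1R by (simp add: a_minus_def)
      qed
      show "(\<lambda>a. a \<ominus> a1) ` Bd d \<subseteq> W"
      proof
        fix w assume "w \<in> (\<lambda>a. a \<ominus> a1) ` Bd d"
        then obtain a where a: "a \<in> A" "f a \<in> Fix d" "w = a \<ominus> a1" by (auto simp: Bd_def)
        have "f w = f a \<ominus> f a1" unfolding a(3) using a(1) AR a1R by (intro fdiff) auto
        thus "w \<in> W" using a Adiff a1 Fix_diff by (simp add: W_def)
      qed
    qed (rule finW)
    moreover have "q * card W \<le> card V"
    proof -
      have "inj_on (\<lambda>(k, w). k \<otimes> v0 \<oplus> w) (K \<times> W)"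
        using VR by (intro inj_on_line_extension[OF K _ v0(2) v0W Wdiff Wsmult]) (auto simp: W_def)
      moreover have "(\<lambda>(k, w). k \<otimes> v0 \<oplus> w) ` (K \<times> W) \<subseteq> V"
        using v0 Vsmult Vplus by (auto simp: W_def)
      ultimately have "card (K \<times> W) \<le> card V" using cV by (intro card_inj_on_le) auto
      thus ?thesis by (simp add: card_cartesian_product card_K)
    qed
    ultimately show ?thesis using cV by (metis le_trans mult_le_mono2)
  qed
  define B where "B = (\<Union>d\<in>{1..<n}. Bd d)"
  have BA: "B \<subseteq> A" "finite B" using cA finite_subset[of B A] by (auto simp: B_def Bd_def)
  have "q * card B \<le> q * (\<Sum>d\<in>{1..<n}. card (Bd d))"
    unfolding B_def by (intro mult_le_mono card_UN_le) auto
  also have "\<dots> = (\<Sum>d\<in>{1..<n}. q * card (Bd d))" by (simp add: sum_distrib_left)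
  also have "\<dots> \<le> (\<Sum>d\<in>{1..<n}. q ^ t)" by (intro sum_mono Bd) auto
  finally have cB: "card B * q \<le> (n - 1) * q ^ t" by (simp add: mult.commute)
  \<comment> \<open>Division by y turns the line a + K * y into a / y + K at the cost of the factor
    \<chi> y of modulus 1.\<close>
  have line: "cmod (\<Sum>c\<in>K. \<chi> (a \<oplus> c \<otimes> y)) \<le> (if a \<in> B then real q else real (n - 1) * sqrt (real q))"
    if a: "a \<in> A" for a
  proof -
    have aR: "a \<in> carrier R" using a AR by auto
    have eq: "\<chi> (a \<oplus> c \<otimes> y) = \<chi> y * \<chi> (f a \<oplus> c)" if "c \<in> K" for c
    proof -
      have c: "c \<in> carrier R" using that KR by auto
      have "y \<otimes> (f a \<oplus> c) = a \<otimes> (inv y \<otimes> y) \<oplus> c \<otimes> y" unfolding f_def using aR c yR iy(1) by algebra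
      hence "y \<otimes> (f a \<oplus> c) = a \<oplus> c \<otimes> y" using iy aR by simp
      thus ?thesis using character_mult[OF \<chi>(1) yR, of "f a \<oplus> c"] fR[OF aR] c by simp
    qed
    have "(\<Sum>c\<in>K. \<chi> (a \<oplus> c \<otimes> y)) = \<chi> y * (\<Sum>c\<in>K. \<chi> (f a \<oplus> c))"
      using eq by (simp add: sum_distrib_left)
    hence norm: "cmod (\<Sum>c\<in>K. \<chi> (a \<oplus> c \<otimes> y)) = cmod (\<Sum>c\<in>K. \<chi> (f a \<oplus> c))"
      using character_norm[OF \<chi>(1) yR y(2)] by (simp add: norm_mult)
    show ?thesis
    proof (cases "a \<in> B")
      case True
      have "cmod (\<chi> z) \<le> 1" if "z \<in> carrier R" for z
        using character_norm[OF \<chi>(1) that] \<chi>(1) by (cases "z = \<zero>") (auto simp: multiplicative_character_def)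
      hence "cmod (\<Sum>c\<in>K. \<chi> (f a \<oplus> c)) \<le> (\<Sum>c\<in>K. 1)"
        using fR[OF aR] KR by (intro order.trans[OF norm_sum] sum_mono) auto
      thus ?thesis using True norm card_K by simp
    next
      case False
      have "cmod (\<Sum>c\<in>K. \<chi> (f a \<oplus> c)) \<le> real (n - 1) * sqrt (real q)"
        using False a by (intro katz_line_bound[OF \<chi> fR[OF aR]]) (auto simp: B_def Bd_def)
      thus ?thesis using False norm by simp
    qed
  qed
  \<comment> \<open>Since y lies in \<open>V\<close>, translation by K * y permutes
    \<open>A\<close>; averaging over these q translations leaves the sum unchanged.\<close>
  have shift: "(\<Sum>a\<in>A. \<chi> (a \<oplus> c \<otimes> y)) = (\<Sum>a\<in>A. \<chi> a)" if c: "c \<in> K" for c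
  proof -
    have cy: "c \<otimes> y \<in> V" "c \<otimes> y \<in> carrier R" using Vsmult[OF c y(1)] VR by auto
    have i: "inj_on (\<lambda>a. a \<oplus> c \<otimes> y) A" using AR cy by (auto simp: inj_on_def subset_iff)
    have "(\<lambda>a. a \<oplus> c \<otimes> y) ` A = A" using i cA Ashift cy by (intro endo_inj_surj) auto
    hence "bij_betw (\<lambda>a. a \<oplus> c \<otimes> y) A A" using i by (simp add: bij_betw_def)
    thus ?thesis by (rule sum.reindex_bij_betw)
  qed
  have "of_nat q * (\<Sum>a\<in>A. \<chi> a) = (\<Sum>c\<in>K. \<Sum>a\<in>A. \<chi> (a \<oplus> c \<otimes> y))"
    using shift by (simp add: card_K)
  also have "\<dots> = (\<Sum>a\<in>A. \<Sum>c\<in>K. \<chi> (a \<oplus> c \<otimes> y))" by (rule sum.swap)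
  finally have "real q * cmod (\<Sum>a\<in>A. \<chi> a) = cmod (\<Sum>a\<in>A. \<Sum>c\<in>K. \<chi> (a \<oplus> c \<otimes> y))"
    by (metis norm_mult norm_of_nat)
  also have "\<dots> \<le> (\<Sum>a\<in>A. if a \<in> B then real q else real (n - 1) * sqrt (real q))"
    by (rule order.trans[OF norm_sum sum_mono[OF line]])
  also have "\<dots> = (\<Sum>a\<in>B. real q) + (\<Sum>a\<in>A - B. real (n - 1) * sqrt (real q))"
    using BA cA by (subst sum.subset_diff[of B]) (auto simp: add.commute)
  also have "\<dots> = (real q ^ t - real (card B)) * (real (n - 1) * sqrt (real q)) + real (card B) * real q"
    using BA cA card_mono[OF cA(1) BA(1)] by (simp add: card_Diff_subset of_nat_diff)
  also have "\<dots> < real q * (real n * real q powr (real t - 1 / 2))"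
  proof (rule affine_average_estimate[OF q(2) n])
    show "real (card B) * real q \<le> real (n - 1) * real q ^ t"
      using cB by (metis of_nat_le_iff of_nat_mult of_nat_power)
    show "real (card B) \<le> real q ^ t" using card_mono[OF cA(1) BA(1)] cA(2) by (metis of_nat_le_iff of_nat_power)
  qed
  finally show ?thesis using q by simp
qed

end

theorem theorem3p2:
  fixes R :: "('a, 'b) ring_scheme" (structure)
    and K V A :: "'a set"
    and u :: 'a
    and \<chi> :: "'a \<Rightarrow> complex"
    and q n t :: nat
  assumes "primepow q" and "n > 1"
    and "field R" and "card (carrier R) = q ^ n"
    and "subfield K R" and "card K = q"
    and "is_affine_space R K t u V A" and "t \<ge> 1"
    and "\<exists>y \<in> V. y \<noteq> \<zero> \<and> (\<exists>x \<in> (\<lambda>a. a \<otimes> inv y) ` A. element_degree R K x = n)"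
    and "multiplicative_character R \<chi>" and "\<not> trivial_character R \<chi>"
  shows "cmod (\<Sum>a \<in> A. \<chi> a) < real n * real q powr (real t - 1 / 2)"
proof -
  have n: "n \<ge> 2" using assms(2) by simp
  obtain M :: "(('a list \<times> nat) multiset \<Rightarrow> 'a) free_ring set" and p j where model: "finite_field_model M p R K q n j"
    using field.finite_field_model_exists[OF assms(3,1) n assms(4,5,6)] by blast
  obtain y x where y: "y \<in> V" "y \<noteq> \<zero>" and x: "x \<in> (\<lambda>a. a \<otimes> inv y) ` A" "element_degree R K x = n"
    using assms(9) by blast
  show ?thesis
    by (rule finite_field_model.affine_character_sum_bound[OF model assms(10,11,7) y x])
qed

end
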